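(* Let $X$ be a metric space with bounded geometry and $1\leq p<\infty$. The Morita equivalence $(E^{<},E^{>})$ between $UB^p(X)$ and $B_u^p(X)$ described in the context induces, via $I\mapsto\operatorname{Ind}_{B_u^p(X)}^{UB^p(X)}(I)$, an order isomorphism $$\mathcal G\bigl(B_u^p(X);\mathbb C_u[X]\bigr)\xrightarrow{\ \cong\ }\mathcal G\bigl(UB^p(X);U\mathbb C^p[X]\bigr).$$ Equivalently, a closed two-sided ideal $I$ of $B_u^p(X)$ is geometric if and only if the induced ideal $\operatorname{Ind}_{B_u^p(X)}^{UB^p(X)}(I)$ is geometric.
   Context: Banach spaces are complex. $X$ has bounded geometry if $\sup_{x\in X}|B(x,r)|<\infty$ for every $r\geq0$. Let $1/p+1/q=1$ ($q=\infty$ if $p=1$). A matrix indexed by $X\times X$ has finite propagation if $\sup\{d(x,y):\text{the }(x,y)\text{ entry is nonzero}\}<\infty$. $\ell^p=\ell^p(\mathbb N)$ and $\ell^p(X,\ell^p)=(\bigoplus_{x\in X}\ell^p)_{\ell^p}$. $\mathbb C_u[X]$ is the algebra of finite-propagation $X\times X$ complex matrices with uniformly bounded entries, acting on $\ell^p(X)$, and $B_u^p(X)$ is its closure in $B(\ell^p(X))$. $U\mathbb C^p[X]$ is the algebra of finite-propagation operators $T=(T_{xy})\in B(\ell^p(X,\ell^p))$, $T_{xy}\in B(\ell^p)$, with $\sup_{x,y}\operatorname{rank}(T_{xy})<\infty$, and $UB^p(X)$ is its operator-norm closure. $E^{>}_{\mathrm{alg}}$ is the space of finite-propagation $X\times X$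 matrices with uniformly bounded entries in $\ell^p$, regarded as operators $\ell^p(X)\to\ell^p(X,\ell^p)$; $E^{<}_{\mathrm{alg}}$ is the space of finite-propagation $X\times X$ matrices with uniformly bounded entries in $\ell^q$ (acting as functionals on $\ell^p$), regarded as operators $\ell^p(X,\ell^p)\to\ell^p(X)$. $E^{>},E^{<}$ are their operator-norm completions. With module actions given by composition of operators, $E^{>}$ is a $UB^p(X)$-$B_u^p(X)$-bimodule and $E^{<}$ is a $B_u^p(X)$-$UB^p(X)$-bimodule; with pairings $\langle e^{<},e^{>}\rangle_{B_u^p(X)}=e^{<}e^{>}$ and ${}_{UB^p(X)}\langle e^{>},e^{<}\rangle=e^{>}e^{<}$ they form a Morita equivalence (known theorem of Chung). Here a Morita equivalence between Banach algebras $A$ and $B$ means a pair of Banach bimodules with contractive actions and pairings of norm at most one satisfying the evident bilinearity, balancing and associativity identities, with nondegenerate actions (products span dense subspaces) and full pairings (ranges span dense subspaces of $B$ and $A$). Induction: with $A=UB^p(X)$, $B=B_u^p(X)$ and $I$ a closed two-sided ideal of $B$, let $E_I^{>}=\{\xi\in E^{>}:\langle\eta,\xi\rangle_B\in I\ \forall\eta\in E^{<}\}$, and let $\operatorname{Ind}_B^A(I)$ be the closed linear span of $\{{}_A\langle\xi,\eta\rangle:\xi\in E_I^{>},\eta\in E^{<}\}$, a closed two-sided ideal of $A$. A closed two-sided ideal $J$ of $A$ is $A_0$-geometric, for a dense subalgebra $A_0\subseteq A$, if $\overline{J\cap A_0}=J$; $\mathcal G(A;A_0)$ is the set of such ideals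 ordered by inclusion. "Geometric" means $\mathbb C_u[X]$-geometric for ideals of $B_u^p(X)$ and $U\mathbb C^p[X]$-geometric for ideals of $UB^p(X)$. *)

theory Defs
  imports "HOL-Analysis.Analysis" "HOL-Library.Function_Algebras"
begin

text \<open>
  All Banach spaces involved are spaces of complex functions on an index set. A normed space is
  a pair of its carrier and its norm; the vector operations are pointwise. A bounded operator is a
  function that vanishes outside the carrier of its domain, so that two operators agreeing
  on that carrier are equal, and sums and composites of operators are again of this form.
\<close>

type_synonym 'i fn = "'i \<Rightarrow> complex"
type_synonym 'i nspace = "'i fn set \<times> ('i fn \<Rightarrow> real)"
type_synonym ('i, 'j) opr = "'i fn \<Rightarrow> 'j fn"

definition fscale :: "complex \<Rightarrow> 'i fn \<Rightarrow> 'i fn" where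
  "fscale c f = (\<lambda>i. c * f i)"

definition oscale :: "complex \<Rightarrow> ('i, 'j) opr \<Rightarrow> ('i, 'j) opr" where
  "oscale c T = (\<lambda>f. fscale c (T f))"

interpretation cfun: vector_space "fscale :: complex \<Rightarrow> 'i fn \<Rightarrow> 'i fn"
  by unfold_locales (auto simp: fscale_def fun_eq_iff algebra_simps)

interpretation cop: vector_space "oscale :: complex \<Rightarrow> ('i, 'j) opr \<Rightarrow> ('i, 'j) opr"
  by unfold_locales (auto simp: oscale_def fscale_def fun_eq_iff algebra_simps)


section \<open>Bounded operators\<close>

definition bounded_ops :: "'i nspace \<Rightarrow> 'j nspace \<Rightarrow> ('i, 'j) opr set" where
  "bounded_ops E F = {T.
     (\<forall>f. f \<notin> fst E \<longrightarrow> T f = 0) \<and>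
     (\<forall>f\<in>fst E. T f \<in> fst F) \<and>
     (\<forall>f\<in>fst E. \<forall>g\<in>fst E. T (f + g) = T f + T g) \<and>
     (\<forall>c. \<forall>f\<in>fst E. T (fscale c f) = fscale c (T f)) \<and>
     (\<exists>K. \<forall>f\<in>fst E. snd F (T f) \<le> K * snd E f)}"

definition op_norm :: "'i nspace \<Rightarrow> 'j nspace \<Rightarrow> ('i, 'j) opr \<Rightarrow> real" where
  "op_norm E F T = Inf {K. 0 \<le> K \<and> (\<forall>f\<in>fst E. snd F (T f) \<le> K * snd E f)}"

definition op_closure :: "'i nspace \<Rightarrow> 'j nspace \<Rightarrow> ('i, 'j) opr set \<Rightarrow> ('i, 'j) opr set" where
  "op_closure E F S = {T \<in> bounded_ops E F. \<forall>\<epsilon>>0. \<exists>R\<in>S. op_norm E F (T - R) < \<epsilon>}"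

definition op_rank :: "('i, 'j) opr \<Rightarrow> enat" where
  "op_rank T = (if \<exists>V. finite V \<and> range T \<subseteq> cfun.span V
                then enat (cfun.dim (range T)) else \<infinity>)"


section \<open>The sequence spaces\<close>

definition lp_norm :: "real \<Rightarrow> 'i fn \<Rightarrow> real" where
  "lp_norm p f = (\<Sum>\<^sub>\<infinity>i. cmod (f i) powr p) powr (1 / p)"

definition lp :: "real \<Rightarrow> 'i nspace" where
  "lp p = ({f. (\<lambda>i. cmod (f i) powr p) summable_on UNIV}, lp_norm p)"

definition linf :: "'i nspace" where
  "linf = ({f. bdd_above (range (\<lambda>i. cmod (f i)))}, \<lambda>f. SUP i. cmod (f i))"

text \<open>The space \<open>\<ell>\<^sup>q\<close> for the exponent \<open>q\<close> conjugate to \<open>p\<close>.\<close>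

definition lp_conj :: "real \<Rightarrow> 'i nspace" where
  "lp_conj p = (if p = 1 then linf else lp (p / (p - 1)))"

text \<open>
  \<open>\<ell>\<^sup>p(X, \<ell>\<^sup>p)\<close>, a vector \<open>f\<close> having the component \<open>\<lambda>n. f (x, n)\<close> in \<open>\<ell>\<^sup>p(\<nat>)\<close> at \<open>x\<close>.
\<close>

definition lp_sum_norm :: "real \<Rightarrow> ('x \<times> nat) fn \<Rightarrow> real" where
  "lp_sum_norm p f = (\<Sum>\<^sub>\<infinity>x. lp_norm p (\<lambda>n. f (x, n)) powr p) powr (1 / p)"

definition lp_sum :: "real \<Rightarrow> ('x \<times> nat) nspace" where
  "lp_sum p = ({f. (\<forall>x. (\<lambda>n. f (x, n)) \<in> fst (lp p)) \<and>
                   (\<lambda>x. lp_norm p (\<lambda>n. f (x, n)) powr p) summable_on UNIV},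
               lp_sum_norm p)"


section \<open>The Roe-type algebras and the bimodules\<close>

definition bounded_geometry :: "'x::metric_space itself \<Rightarrow> bool" where
  "bounded_geometry _ \<longleftrightarrow>
     (\<forall>r\<ge>0. (\<forall>x::'x. finite (cball x r)) \<and> bdd_above (range (\<lambda>x::'x. card (cball x r))))"

definition finite_propagation :: "('x::metric_space \<Rightarrow> 'x \<Rightarrow> 'v::zero) \<Rightarrow> bool" where
  "finite_propagation k \<longleftrightarrow> bdd_above {dist x y | x y. k x y \<noteq> 0}"

definition bounded_entries :: "'i nspace \<Rightarrow> ('x \<Rightarrow> 'x \<Rightarrow> 'i fn) \<Rightarrow> bool" where
  "bounded_entries V k \<longleftrightarrow>
     (\<forall>x y. k x y \<in> fst V) \<and> bdd_above (range (\<lambda>(x, y). snd V (k x y)))"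

text \<open>
  The operators given by a finite-propagation matrix with entries in \<open>\<complex>\<close>, \<open>\<ell>\<^sup>p\<close> and \<open>\<ell>\<^sup>q\<close>
  respectively. Over a space of bounded geometry the sums over \<open>y\<close> have finitely many nonzero terms.
\<close>

definition scalar_op :: "real \<Rightarrow> ('x \<Rightarrow> 'x \<Rightarrow> complex) \<Rightarrow> ('x, 'x) opr" where
  "scalar_op p k = (\<lambda>f. if f \<in> fst (lp p) then (\<lambda>x. \<Sum>\<^sub>\<infinity>y. k x y * f y) else 0)"

definition column_op :: "real \<Rightarrow> ('x \<Rightarrow> 'x \<Rightarrow> nat fn) \<Rightarrow> ('x, 'x \<times> nat) opr" where
  "column_op p k = (\<lambda>f. if f \<in> fst (lp p) then (\<lambda>(x, n). \<Sum>\<^sub>\<infinity>y. k x y n * f y) else 0)"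

definition row_op :: "real \<Rightarrow> ('x \<Rightarrow> 'x \<Rightarrow> nat fn) \<Rightarrow> ('x \<times> nat, 'x) opr" where
  "row_op p k = (\<lambda>f. if f \<in> fst (lp_sum p)
                     then (\<lambda>x. \<Sum>\<^sub>\<infinity>y. \<Sum>\<^sub>\<infinity>n. k x y n * f (y, n)) else 0)"

definition Cu :: "real \<Rightarrow> ('x::metric_space, 'x) opr set" where
  "Cu p = {scalar_op p k | k.
     finite_propagation k \<and> bdd_above (range (\<lambda>(x, y). cmod (k x y)))}"

definition Bu :: "real \<Rightarrow> ('x::metric_space, 'x) opr set" where
  "Bu p = op_closure (lp p) (lp p) (Cu p)"

definition block :: "('x \<times> nat, 'x \<times> nat) opr \<Rightarrow> 'x \<Rightarrow> 'x \<Rightarrow> (nat, nat) opr" where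
  "block T x y = (\<lambda>v n. T (\<lambda>(z, m). if z = y then v m else 0) (x, n))"

definition UC :: "real \<Rightarrow> ('x::metric_space \<times> nat, 'x \<times> nat) opr set" where
  "UC p = {T \<in> bounded_ops (lp_sum p) (lp_sum p).
     finite_propagation (block T) \<and> (SUP (x, y). op_rank (block T x y)) < \<infinity>}"

definition UB :: "real \<Rightarrow> ('x::metric_space \<times> nat, 'x \<times> nat) opr set" where
  "UB p = op_closure (lp_sum p) (lp_sum p) (UC p)"

definition Egt_alg :: "real \<Rightarrow> ('x::metric_space, 'x \<times> nat) opr set" where
  "Egt_alg p = {column_op p k | k. finite_propagation k \<and> bounded_entries (lp p) k}"

definition Elt_alg :: "real \<Rightarrow> ('x::metric_space \<times> nat, 'x) opr set" where
  "Elt_alg p = {row_op p k | k. finite_propagation k \<and> bounded_entries (lp_conj p) k}"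

text \<open>
  The spaces of all bounded operators being complete, the operator-norm completions are
  the closures in them.
\<close>

definition Egt :: "real \<Rightarrow> ('x::metric_space, 'x \<times> nat) opr set" where
  "Egt p = op_closure (lp p) (lp_sum p) (Egt_alg p)"

definition Elt :: "real \<Rightarrow> ('x::metric_space \<times> nat, 'x) opr set" where
  "Elt p = op_closure (lp_sum p) (lp p) (Elt_alg p)"


section \<open>Ideals and induction\<close>

text \<open>\<open>A\<close> is a norm-closed algebra of bounded operators on \<open>E\<close>.\<close>

definition closed_ideal :: "'i nspace \<Rightarrow> ('i, 'i) opr set \<Rightarrow> ('i, 'i) opr set \<Rightarrow> bool" where
  "closed_ideal E A J \<longleftrightarrow>
     J \<subseteq> A \<and> cop.subspace J \<and> (\<forall>a\<in>A. \<forall>j\<in>J. a \<circ> j \<in> J \<and> j \<circ> a \<in> J) \<and> op_closure E E J = J"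

definition geometric :: "'i nspace \<Rightarrow> ('i, 'i) opr set \<Rightarrow> ('i, 'i) opr set \<Rightarrow> bool" where
  "geometric E A\<^sub>0 J \<longleftrightarrow> op_closure E E (J \<inter> A\<^sub>0) = J"

definition geometric_ideals ::
    "'i nspace \<Rightarrow> ('i, 'i) opr set \<Rightarrow> ('i, 'i) opr set \<Rightarrow> ('i, 'i) opr set set" where
  "geometric_ideals E A A\<^sub>0 = {J. closed_ideal E A J \<and> geometric E A\<^sub>0 J}"

text \<open>
  Both pairings are composition: \<open>\<langle>\<eta>, \<xi>\<rangle> = \<eta> \<circ> \<xi>\<close> in \<open>Bu p\<close> and \<open>\<langle>\<xi>, \<eta>\<rangle> = \<xi> \<circ> \<eta>\<close> in \<open>UB p\<close>.
\<close>

definition Egt_ideal :: "real \<Rightarrow> ('x::metric_space, 'x) opr set \<Rightarrow> ('x, 'x \<times> nat) opr set" where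
  "Egt_ideal p I = {\<xi> \<in> Egt p. \<forall>\<eta>\<in>Elt p. \<eta> \<circ> \<xi> \<in> I}"

definition Ind ::
    "real \<Rightarrow> ('x::metric_space, 'x) opr set \<Rightarrow> ('x \<times> nat, 'x \<times> nat) opr set" where
  "Ind p I = op_closure (lp_sum p) (lp_sum p)
     (cop.span {\<xi> \<circ> \<eta> | \<xi> \<eta>. \<xi> \<in> Egt_ideal p I \<and> \<eta> \<in> Elt p})"

end

(*
  A bounded operator of finite propagation is the same thing as a finite-propagation matrix
  with uniformly bounded entries (by Riesz representation for rows), so the algebraic bimodules
  and algebras compose as expected. With xi0, eta0 the diagonal column and row of unit vectors,
  eta0 xi0 = 1, and so B is the corner of A cut out by the idempotent xi0 eta0. Hence an ideal I
  is recovered from J = Ind I as the set of b with xi0 b eta0 in J, and for any closed ideal J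
  of A this recipe sends geometric ideals to geometric ideals.

  Two approximation arguments replace the missing unit of A. For the module, elements xi of the
  completion are limits of P xi with P of norm at most one in the span of E> E<, because l^p has
  the uniform approximation property; so an element of E_I> is a limit of sums of zeta b with
  b in I. For a geometric ideal J and T in J of uniformly finite rank, subtracting suitable
  operators T U Phi from T, with U a diagonal column and Phi a diagonal row, lowers the rank of
  every block column by one, so that T is a finite sum of products (T_k U_k) Phi_k lying in Ind.
*)

theory Submission
  imports Defs
begin

section \<open>The spaces \<open>\<ell>\<^sup>p\<close>\<close>


text \<open>The vector-valued space is identified with l^p(X x N), so every operator in sight acts
  between spaces \<open>Lp p\<close>, and propagation is measured after projecting the index sets to
  X.

  The module \<open>Egt_ideal p I\<close> is defined by testing against rows, and a test produces no
  factors. Composition with P does: P xi is a sum of zeta (eta xi), whose inner factor is a test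
  value in I. But P is adapted to an algebraic xi' near xi, and only its norm controls P (xi - xi'),
  so the bound on P must not depend on xi'.

  Splitting the blocks of T in J into rank-one pieces directly need not stay in J. The pieces T U
  Phi are right multiples of T, hence stay in J, and T U pairs with every row into the restricted
  ideal. As U and Phi are diagonal, one subtraction treats all block columns at once, and the
  uniform rank bound makes the process stop; this is where geometric ideals enter. The functionals
  in Phi need a bound independent of the column: the norm of a column may not be attained, so a
  vector exceeding half of it is used, and the bound is 2.\<close>

abbreviation Lp :: "real \<Rightarrow> 'i fn set" where
  "Lp p \<equiv> fst (lp p)"

definition restr :: "'i set \<Rightarrow> 'i fn \<Rightarrow> 'i fn" where
  "restr A f = (\<lambda>i. if i \<in> A then f i else 0)"

definition basis_fn :: "'i \<Rightarrow> 'i fn" where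
  "basis_fn i = (\<lambda>j. if j = i then 1 else 0)"

lemma Lp_iff: "f \<in> Lp p \<longleftrightarrow> (\<lambda>i. cmod (f i) powr p) summable_on UNIV"
  by (simp add: lp_def)

lemma snd_lp [simp]: "snd (lp p) = lp_norm p"
  by (simp add: lp_def)

lemma lp_norm_nonneg [simp]: "0 \<le> lp_norm p f"
  by (simp add: lp_norm_def)

lemma lp_norm_powr:
  assumes "1 \<le> p"
  shows "lp_norm p f powr p = (\<Sum>\<^sub>\<infinity>i. cmod (f i) powr p)"
  using assms by (simp add: lp_norm_def powr_powr infsum_nonneg)

lemma sum_powr_le_lp_norm:
  assumes "1 \<le> p" "f \<in> Lp p" "finite F"
  shows "(\<Sum>i\<in>F. cmod (f i) powr p) \<le> lp_norm p f powr p"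
  unfolding lp_norm_powr[OF assms(1)]
  by (rule finite_sum_le_infsum) (use assms in \<open>auto simp: Lp_iff\<close>)

text \<open>Bounds on finite partial sums give summability and the norm bound together, so a norm
  estimate need not presuppose membership.\<close>

lemma
  assumes p: "1 \<le> p" and K: "0 \<le> K"
    and le: "\<And>F. finite F \<Longrightarrow> (\<Sum>i\<in>F. cmod (f i) powr p) \<le> K powr p"
  shows LpI: "f \<in> Lp p" and lp_norm_leI: "lp_norm p f \<le> K"
proof -
  show f: "f \<in> Lp p" unfolding Lp_iff
    by (rule nonneg_bdd_above_summable_on) (use le in \<open>auto intro!: bdd_aboveI\<close>)
  have "(\<Sum>\<^sub>\<infinity>i. cmod (f i) powr p) \<le> K powr p"
    by (rule infsum_le_finite_sums) (use f le in \<open>auto simp: Lp_iff\<close>)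
  then have "lp_norm p f powr p \<le> K powr p" using lp_norm_powr[OF p] by metis
  then show "lp_norm p f \<le> K"
    using p K by (smt (verit) lp_norm_nonneg powr_less_mono2)
qed

lemma cmod_le_lp_norm:
  assumes "1 \<le> p" "f \<in> Lp p"
  shows "cmod (f i) \<le> lp_norm p f"
proof -
  have "cmod (f i) powr p \<le> lp_norm p f powr p"
    using sum_powr_le_lp_norm[OF assms, of "{i}"] by simp
  then show ?thesis
    using assms(1) by (smt (verit) lp_norm_nonneg norm_ge_zero powr_less_mono2)
qed

lemma lp_norm_eq_0_iff:
  assumes "1 \<le> p" "f \<in> Lp p"
  shows "lp_norm p f = 0 \<longleftrightarrow> f = 0"
proof
  assume "lp_norm p f = 0"
  then show "f = 0" using cmod_le_lp_norm[OF assms] by (auto simp: fun_eq_iff)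
qed (simp add: lp_norm_def)

lemma Lp_0 [simp]: "0 \<in> Lp p" and lp_norm_0 [simp]: "lp_norm p 0 = 0"
  by (simp_all add: Lp_iff lp_norm_def)

lemma
  assumes p: "1 \<le> p" and g: "g \<in> Lp p" and C: "0 \<le> C" and le: "\<And>i. cmod (f i) \<le> C * cmod (g i)"
  shows Lp_dominated: "f \<in> Lp p" and lp_norm_dominated: "lp_norm p f \<le> C * lp_norm p g"
proof -
  have *: "(\<Sum>i\<in>F. cmod (f i) powr p) \<le> (C * lp_norm p g) powr p" if "finite F" for F
  proof -
    have "(\<Sum>i\<in>F. cmod (f i) powr p) \<le> (\<Sum>i\<in>F. (C * cmod (g i)) powr p)"
      by (intro sum_mono powr_mono2) (use le p in auto)
    also have "\<dots> = C powr p * (\<Sum>i\<in>F. cmod (g i) powr p)"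
      using C by (simp add: powr_mult sum_distrib_left)
    also have "\<dots> \<le> C powr p * lp_norm p g powr p"
      by (intro mult_left_mono sum_powr_le_lp_norm) (use p g that in auto)
    finally show ?thesis using C by (simp add: powr_mult)
  qed
  show "f \<in> Lp p" "lp_norm p f \<le> C * lp_norm p g"
    by (rule LpI[OF p _ *] lp_norm_leI[OF p _ *]; use C in simp)+
qed

lemma Lp_scale [simp]:
  assumes "1 \<le> p" "f \<in> Lp p"
  shows "fscale c f \<in> Lp p"
  by (rule Lp_dominated[OF assms, of "cmod c"]) (auto simp: fscale_def norm_mult)

lemma lp_norm_scale:
  assumes "1 \<le> p"
  shows "lp_norm p (fscale c f) = cmod c * lp_norm p f"
proof -
  have "lp_norm p (fscale c f) = (cmod c powr p * (\<Sum>\<^sub>\<infinity>i. cmod (f i) powr p)) powr (1 / p)"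
    by (simp add: lp_norm_def fscale_def norm_mult powr_mult infsum_cmult_right')
  also have "\<dots> = cmod c * lp_norm p f"
    using assms by (simp add: lp_norm_def powr_mult infsum_nonneg powr_powr)
  finally show ?thesis .
qed

text \<open>Convexity of the p-th power at \<open>a / A\<close> and \<open>b / B\<close> with
  weights \<open>A / (A + B)\<close> and \<open>B / (A + B)\<close>. It is applied at positive
  points; if \<open>a\<close> or \<open>b\<close> vanishes, the inequality u^p <= u on [0,1],
  applied to the remaining weight, does the same.\<close>

lemma powr_add_le_weighted:
  fixes p :: real
  assumes p: "1 \<le> p" and "0 < A" "0 < B" "0 \<le> a" "0 \<le> b"
  shows "((a + b) / (A + B)) powr p
    \<le> A / (A + B) * (a / A) powr p + B / (A + B) * (b / B) powr p"
proof -
  have *: "u powr p \<le> u" if "0 \<le> u" "u \<le> 1" for u :: real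
    using powr_mono'[of 1 p u] p that by simp
  have w: "A / (A + B) + B / (A + B) = 1" "0 < A / (A + B)" "0 < B / (A + B)"
    using assms by (auto simp flip: add_divide_distrib)
  have e: "(a + b) / (A + B) = A / (A + B) * (a / A) + B / (A + B) * (b / B)"
    using assms by (simp add: add_divide_distrib)
  show ?thesis
  proof (cases "a = 0 \<or> b = 0")
    case True
    then show ?thesis
    proof
      assume "a = 0"
      have "((a + b) / (A + B)) powr p = (B / (A + B)) powr p * (b / B) powr p"
        using assms \<open>a = 0\<close> by (subst e) (simp flip: powr_mult)
      also have "\<dots> \<le> B / (A + B) * (b / B) powr p"
        by (intro mult_right_mono *) (use w in auto)
      finally show ?thesis using \<open>a = 0\<close> by simp
    next
      assume "b = 0"
      have "((a + b) / (A + B)) powr p = (A / (A + B)) powr p * (a / A) powr p"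
        using assms \<open>b = 0\<close> by (subst e) (simp flip: powr_mult)
      also have "\<dots> \<le> A / (A + B) * (a / A) powr p"
        by (intro mult_right_mono *) (use w in auto)
      finally show ?thesis using \<open>b = 0\<close> by simp
    qed
  next
    case False
    have "1 - B / (A + B) = A / (A + B)" using w by linarith
    moreover have "((1 - B / (A + B)) *\<^sub>R (a / A) + (B / (A + B)) *\<^sub>R (b / B)) powr p
        \<le> (1 - B / (A + B)) * (a / A) powr p + B / (A + B) * (b / B) powr p"
      by (rule convex_onD[OF powr_convex[OF p]]) (use assms w False in \<open>auto simp: divide_le_eq\<close>)
    ultimately show ?thesis unfolding e by (simp only: real_scaleR_def)
  qed
qed

text \<open>Minkowski's inequality: with the two norms as A and B in
  \<open>powr_add_le_weighted\<close>, the normalised power sums are at most 1 and the weights add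
  up to 1.\<close>

lemma
  assumes p: "1 \<le> p" and f: "f \<in> Lp p" and g: "g \<in> Lp p"
  shows Lp_add [simp]: "f + g \<in> Lp p"
    and lp_norm_triangle: "lp_norm p (f + g) \<le> lp_norm p f + lp_norm p g"
proof -
  let ?A = "lp_norm p f" and ?B = "lp_norm p g"
  have "f + g \<in> Lp p \<and> lp_norm p (f + g) \<le> ?A + ?B"
  proof (cases "?A = 0 \<or> ?B = 0")
    case True
    then have "f = 0 \<or> g = 0" using lp_norm_eq_0_iff[OF p f] lp_norm_eq_0_iff[OF p g] by blast
    then show ?thesis using f g by auto
  next
    case False
    then have A: "0 < ?A" and B: "0 < ?B" by (auto simp: less_le)
    have *: "(\<Sum>i\<in>F. cmod ((f + g) i) powr p) \<le> (?A + ?B) powr p" if F: "finite F" for F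
    proof -
      have "(\<Sum>i\<in>F. cmod ((f + g) i) powr p)
          \<le> (\<Sum>i\<in>F. (cmod (f i) + cmod (g i)) powr p)"
        by (intro sum_mono powr_mono2) (use p in \<open>auto simp: norm_triangle_ineq\<close>)
      also have "\<dots> = (?A + ?B) powr p * (\<Sum>i\<in>F. ((cmod (f i) + cmod (g i)) / (?A + ?B)) powr p)"
        using A B by (simp add: powr_divide sum_distrib_left)
      also have "\<dots> \<le> (?A + ?B) powr p *
          (\<Sum>i\<in>F. ?A / (?A + ?B) * (cmod (f i) / ?A) powr p + ?B / (?A + ?B) * (cmod (g i) / ?B) powr p)"
        by (intro mult_left_mono sum_mono powr_add_le_weighted) (use p A B in auto)
      also have "\<dots> = (?A + ?B) powr p *
          (?A / (?A + ?B) * ((\<Sum>i\<in>F. cmod (f i) powr p) / ?A powr p) +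
           ?B / (?A + ?B) * ((\<Sum>i\<in>F. cmod (g i) powr p) / ?B powr p))"
        by (simp add: sum.distrib powr_divide sum_distrib_left sum_divide_distrib)
      also have "\<dots> \<le> (?A + ?B) powr p * (?A / (?A + ?B) * 1 + ?B / (?A + ?B) * 1)"
        using sum_powr_le_lp_norm[OF p f F] sum_powr_le_lp_norm[OF p g F] A B
        by (intro mult_left_mono add_mono) auto
      also have "\<dots> = (?A + ?B) powr p"
        using A B by (simp flip: add_divide_distrib)
      finally show ?thesis .
    qed
    show ?thesis
      using LpI[where f = "f + g", OF p _ *] lp_norm_leI[where f = "f + g", OF p _ *] A B by auto
  qed
  then show "f + g \<in> Lp p" "lp_norm p (f + g) \<le> ?A + ?B" by auto
qed

lemma fscale_simps [simp]: "fscale 0 f = 0" "fscale 1 f = f" "fscale c 0 = 0"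
  by (auto simp: fscale_def)

lemma fscale_minus1: "fscale (-1) f = - f"
  by (auto simp: fscale_def)

lemma Lp_uminus [simp]: "1 \<le> p \<Longrightarrow> f \<in> Lp p \<Longrightarrow> - f \<in> Lp p"
  by (metis Lp_scale fscale_minus1)

lemma Lp_diff [simp]: "1 \<le> p \<Longrightarrow> f \<in> Lp p \<Longrightarrow> g \<in> Lp p \<Longrightarrow> f - g \<in> Lp p"
  by (metis Lp_add Lp_uminus diff_conv_add_uminus)

lemma lp_norm_uminus [simp]: "1 \<le> p \<Longrightarrow> lp_norm p (- f) = lp_norm p f"
  by (metis fscale_minus1 lp_norm_scale mult_1 norm_minus_cancel norm_one)

lemma lp_norm_triangle_diff:
  "1 \<le> p \<Longrightarrow> f \<in> Lp p \<Longrightarrow> g \<in> Lp p \<Longrightarrow> lp_norm p (f - g) \<le> lp_norm p f + lp_norm p g"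
  by (metis Lp_uminus diff_conv_add_uminus lp_norm_triangle lp_norm_uminus)

lemma
  assumes p: "1 \<le> p" and f: "\<And>a. a \<in> A \<Longrightarrow> f a \<in> Lp p"
  shows Lp_sum: "(\<Sum>a\<in>A. f a) \<in> Lp p"
    and lp_norm_sum: "lp_norm p (\<Sum>a\<in>A. f a) \<le> (\<Sum>a\<in>A. lp_norm p (f a))"
proof -
  have "(\<Sum>a\<in>A. f a) \<in> Lp p \<and> lp_norm p (\<Sum>a\<in>A. f a) \<le> (\<Sum>a\<in>A. lp_norm p (f a))"
    using f
  proof (induction A rule: infinite_finite_induct)
    case (insert a A)
    then have "f a \<in> Lp p" "(\<Sum>a\<in>A. f a) \<in> Lp p"
      and "lp_norm p (\<Sum>a\<in>A. f a) \<le> (\<Sum>a\<in>A. lp_norm p (f a))" by auto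
    then show ?case
      using lp_norm_triangle[OF p, of "f a" "\<Sum>a\<in>A. f a"] Lp_add[OF p, of "f a" "\<Sum>a\<in>A. f a"]
      unfolding sum.insert[OF insert(1,2)] by linarith
  qed auto
  then show "(\<Sum>a\<in>A. f a) \<in> Lp p" "lp_norm p (\<Sum>a\<in>A. f a) \<le> (\<Sum>a\<in>A. lp_norm p (f a))"
    by auto
qed

lemma Lp_restr [simp]: "1 \<le> p \<Longrightarrow> f \<in> Lp p \<Longrightarrow> restr A f \<in> Lp p"
  by (rule Lp_dominated[of _ f 1]) (auto simp: restr_def)

lemma lp_norm_restr: "1 \<le> p \<Longrightarrow> f \<in> Lp p \<Longrightarrow> lp_norm p (restr A f) \<le> lp_norm p f"
  using lp_norm_dominated[of p f 1 "restr A f"] by (auto simp: restr_def)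

lemma
  assumes p: "1 \<le> p"
  shows Lp_basis_fn [simp]: "basis_fn i \<in> Lp p"
    and lp_norm_basis_fn [simp]: "lp_norm p (basis_fn i) = 1"
proof -
  have *: "(\<Sum>j\<in>F. cmod (basis_fn i j) powr p) \<le> 1 powr p" if "finite F" for F
  proof -
    have "(\<Sum>j\<in>F. cmod (basis_fn i j) powr p) = (\<Sum>j\<in>F. if j = i then 1 else 0)"
      by (intro sum.cong) (auto simp: basis_fn_def)
    then show ?thesis using that by simp
  qed
  show b: "basis_fn i \<in> Lp p"
    by (rule LpI[OF p _ *]) auto
  show "lp_norm p (basis_fn i) = 1"
    using lp_norm_leI[OF p _ *] cmod_le_lp_norm[OF p b, of i] by (simp add: basis_fn_def)
qed

lemma sum_fn_apply: "(\<Sum>a\<in>A. f a) x = (\<Sum>a\<in>A. f a x :: 'b::comm_monoid_add)"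
  by (induction A rule: infinite_finite_induct) auto

lemma restr_finite_eq_sum:
  assumes "finite F"
  shows "restr F f = (\<Sum>i\<in>F. fscale (f i) (basis_fn i))"
proof
  fix j
  have "(\<Sum>i\<in>F. fscale (f i) (basis_fn i)) j = (\<Sum>i\<in>F. if j = i then f i else 0)"
    by (simp add: fscale_def basis_fn_def sum_fn_apply if_distrib cong: if_cong)
  then show "restr F f j = (\<Sum>i\<in>F. fscale (f i) (basis_fn i)) j"
    using assms by (simp add: restr_def)
qed

text \<open>Additivity of the p-th power over disjoint supports: the left side is the power sum over
  the union of the sets \<open>A s\<close>.\<close>

lemma lp_norm_disjoint_le:
  assumes p: "1 \<le> p" and f: "f \<in> Lp p" and A: "finite S" "disjoint_family_on A S"
  shows "(\<Sum>s\<in>S. lp_norm p (restr (A s) f) powr p) \<le> lp_norm p f powr p"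
proof -
  have s: "(\<lambda>i. cmod (f i) powr p) summable_on B" for B
    using f by (auto simp: Lp_iff intro: summable_on_subset_banach)
  have "lp_norm p (restr B f) powr p = (\<Sum>\<^sub>\<infinity>i\<in>B. cmod (f i) powr p)" for B
    unfolding lp_norm_powr[OF p]
    by (rule infsum_cong_neutral) (auto simp: restr_def)
  then have "(\<Sum>s\<in>S. lp_norm p (restr (A s) f) powr p) = (\<Sum>s\<in>S. \<Sum>\<^sub>\<infinity>i\<in>A s. cmod (f i) powr p)"
    by simp
  also have "\<dots> = (\<Sum>\<^sub>\<infinity>i\<in>(\<Union>s\<in>S. A s). cmod (f i) powr p)"
    by (rule sum_infsum) (use A s in \<open>auto simp: disjoint_family_on_def\<close>)
  also have "\<dots> \<le> lp_norm p f powr p"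
    unfolding lp_norm_powr[OF p] by (rule infsum_mono2) (use s in auto)
  finally show ?thesis .
qed

lemma Lp_finite_approx:
  assumes p: "1 \<le> p" and f: "f \<in> Lp p" and e: "0 < e"
  obtains F where "finite F" "lp_norm p (f - restr F f) < e"
proof -
  \<comment> \<open>The approximation is non-strict; \<open>e / 2\<close> leaves room for the strict
    bound.\<close>
  obtain F where F: "finite F"
    "dist (\<Sum>i\<in>F. cmod (f i) powr p) (\<Sum>\<^sub>\<infinity>i. cmod (f i) powr p) \<le> (e / 2) powr p"
    using infsum_finite_approximation[of "\<lambda>i. cmod (f i) powr p" UNIV "(e / 2) powr p"] f e
    by (auto simp: Lp_iff)
  have s: "(\<lambda>i. cmod (f i) powr p) summable_on B" for B
    using f by (auto simp: Lp_iff intro: summable_on_subset_banach)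
  have "lp_norm p (f - restr F f) powr p = (\<Sum>\<^sub>\<infinity>i\<in>-F. cmod (f i) powr p)"
    unfolding lp_norm_powr[OF p]
    by (rule infsum_cong_neutral) (auto simp: restr_def)
  moreover have "(\<Sum>\<^sub>\<infinity>i. cmod (f i) powr p)
      = (\<Sum>i\<in>F. cmod (f i) powr p) + (\<Sum>\<^sub>\<infinity>i\<in>-F. cmod (f i) powr p)"
    using infsum_Un_disjoint[OF s s, of F "- F"] F by (simp add: Compl_partition)
  ultimately have "lp_norm p (f - restr F f) powr p \<le> (e / 2) powr p"
    using F(2) by (simp add: dist_real_def)
  then have "lp_norm p (f - restr F f) \<le> e / 2"
    using p e by (smt (verit) powr_less_mono2 half_gt_zero)
  then show ?thesis using that[OF F(1)] e by simp
qed

section \<open>Duality\<close>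


abbreviation Lq :: "real \<Rightarrow> 'i fn set" where
  "Lq p \<equiv> fst (lp_conj p)"

abbreviation lq_norm :: "real \<Rightarrow> 'i fn \<Rightarrow> real" where
  "lq_norm p \<equiv> snd (lp_conj p)"

definition pairing :: "'i fn \<Rightarrow> 'i fn \<Rightarrow> complex" where
  "pairing a f = (\<Sum>\<^sub>\<infinity>i. a i * f i)"

lemma conj_exponent:
  fixes p :: real
  assumes "1 < p"
  shows "1 < p / (p - 1)" "1 / p + 1 / (p / (p - 1)) = 1" "(p / (p - 1)) * (p - 1) = p"
    "(p - 1) * (p / (p - 1)) = p"
  using assms by (auto simp: field_simps)

lemma lq_1 [simp]: "a \<in> Lq 1 \<longleftrightarrow> bdd_above (range (\<lambda>i. cmod (a i)))"
    "lq_norm 1 a = (SUP i. cmod (a i))"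
  by (simp_all add: lp_conj_def linf_def)

lemma lq_gt_1: "1 < p \<Longrightarrow> lp_conj p = lp (p / (p - 1))"
  by (simp add: lp_conj_def)

lemma lq_norm_nonneg [simp]:
  assumes "1 \<le> p" "a \<in> Lq p"
  shows "0 \<le> lq_norm p a"
proof (cases "p = 1")
  case True
  then show ?thesis using assms by (auto intro: cSUP_upper2)
qed (use assms in \<open>auto simp: lq_gt_1\<close>)

text \<open>After normalising both factors, Young's inequality termwise leaves 1/p + 1/q = 1. The
  form with finite sums also yields the absolute summability of the pairing.\<close>

lemma Holder_sum:
  assumes p: "1 \<le> p" and a: "a \<in> Lq p" and f: "f \<in> Lp p" and F: "finite F"
  shows "(\<Sum>i\<in>F. cmod (a i) * cmod (f i)) \<le> lq_norm p a * lp_norm p f"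
proof (cases "p = 1")
  case True
  have "cmod (a i) \<le> lq_norm p a" for i
    using a True by (auto intro: cSUP_upper)
  then have "(\<Sum>i\<in>F. cmod (a i) * cmod (f i)) \<le> (\<Sum>i\<in>F. lq_norm p a * cmod (f i))"
    by (intro sum_mono mult_right_mono) auto
  also have "\<dots> \<le> lq_norm p a * lp_norm p f"
    using sum_powr_le_lp_norm[OF p f F] True a p
    by (auto simp flip: sum_distrib_left intro!: mult_left_mono cSUP_upper2)
  finally show ?thesis .
next
  case False
  define q where "q = p / (p - 1)"
  have p1: "1 < p" using p False by simp
  note q = conj_exponent[OF p1, folded q_def]
  have q1: "1 \<le> q" using q by simp
  have a': "a \<in> Lp q" and nq: "lq_norm p a = lp_norm q a"
    using a p1 by (simp_all add: lq_gt_1 q_def)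
  let ?A = "lp_norm q a" and ?B = "lp_norm p f"
  show ?thesis
  proof (cases "?A = 0 \<or> ?B = 0")
    case True
    then have "a = 0 \<or> f = 0" using lp_norm_eq_0_iff[OF q1 a'] lp_norm_eq_0_iff[OF p f] by blast
    then show ?thesis by (auto simp: nq)
  next
    case False
    then have A: "0 < ?A" and B: "0 < ?B" by (auto simp: less_le)
    have "(\<Sum>i\<in>F. cmod (a i) * cmod (f i)) = ?A * ?B * (\<Sum>i\<in>F. (cmod (f i) / ?B) * (cmod (a i) / ?A))"
      using A B by (simp add: sum_distrib_left mult_ac)
    also have "\<dots> \<le> ?A * ?B * (\<Sum>i\<in>F. (cmod (f i) / ?B) powr p / p + (cmod (a i) / ?A) powr q / q)"
      by (intro mult_left_mono sum_mono Youngs_inequality) (use p1 q A B in auto)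
    also have "\<dots> = ?A * ?B * ((\<Sum>i\<in>F. cmod (f i) powr p) / ?B powr p / p
        + (\<Sum>i\<in>F. cmod (a i) powr q) / ?A powr q / q)"
      by (simp add: sum.distrib powr_divide sum_divide_distrib)
    also have "\<dots> \<le> ?A * ?B * (1 / p + 1 / q)"
    proof (intro mult_left_mono add_mono divide_right_mono)
      show "(\<Sum>i\<in>F. cmod (f i) powr p) / ?B powr p \<le> 1"
        using sum_powr_le_lp_norm[OF p f F] B by simp
      show "(\<Sum>i\<in>F. cmod (a i) powr q) / ?A powr q \<le> 1"
        using sum_powr_le_lp_norm[OF q1 a' F] A by simp
    qed (use p q1 in auto)
    finally show ?thesis using q nq by simp
  qed
qed

lemma
  assumes p: "1 \<le> p" and a: "a \<in> Lq p" and f: "f \<in> Lp p"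
  shows pairing_summable: "(\<lambda>i. a i * f i) summable_on A"
    and norm_pairing_le: "cmod (pairing a f) \<le> lq_norm p a * lp_norm p f"
proof -
  have s: "(\<lambda>i. norm (a i * f i)) summable_on UNIV"
    unfolding abs_summable_iff_bdd_above
    using Holder_sum[OF p a f] by (auto simp: norm_mult intro!: bdd_aboveI)
  then show "(\<lambda>i. a i * f i) summable_on A"
    by (rule summable_on_subset_banach[OF abs_summable_summable]) auto
  have "cmod (pairing a f) \<le> (\<Sum>\<^sub>\<infinity>i. cmod (a i * f i))"
    unfolding pairing_def using s by (rule norm_infsum_bound)
  also have "\<dots> \<le> lq_norm p a * lp_norm p f"
    using s Holder_sum[OF p a f] by (intro infsum_le_finite_sums) (auto simp: norm_mult)
  finally show "cmod (pairing a f) \<le> lq_norm p a * lp_norm p f" .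
qed

lemma pairing_add:
  "1 \<le> p \<Longrightarrow> a \<in> Lq p \<Longrightarrow> f \<in> Lp p \<Longrightarrow> g \<in> Lp p \<Longrightarrow> pairing a (f + g) = pairing a f + pairing a g"
  unfolding pairing_def
  by (subst infsum_add[symmetric]) (auto intro: pairing_summable simp: algebra_simps)

lemma pairing_scale: "pairing a (fscale c f) = c * pairing a f"
  unfolding pairing_def by (subst infsum_cmult_right'[symmetric]) (simp add: fscale_def mult_ac)

lemma pairing_0 [simp]: "pairing a 0 = 0"
  by (simp add: pairing_def)

lemma pairing_basis_fn: "pairing a (basis_fn i) = a i"
proof -
  have "pairing a (basis_fn i) = (\<Sum>\<^sub>\<infinity>j\<in>{i}. a j * basis_fn i j)"
    unfolding pairing_def by (rule infsum_cong_neutral) (auto simp: basis_fn_def)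
  then show ?thesis by (simp add: basis_fn_def)
qed

lemma pairing_cong:
  "(\<And>i. a i \<noteq> 0 \<Longrightarrow> f i = g i) \<Longrightarrow> pairing a f = pairing a g"
  unfolding pairing_def by (rule infsum_cong) auto

lemma sgn_mult_cnj: "z * cnj (sgn z) = of_real (cmod z)" for z :: complex
proof (cases "z = 0")
  case False
  have "z * cnj (sgn z) = z * cnj z / of_real (cmod z)"
    by (simp add: sgn_eq)
  then show ?thesis
    using False by (simp add: power2_eq_square flip: complex_norm_square)
qed simp

lemma infsum_of_real_complex:
  "g summable_on A \<Longrightarrow> (\<Sum>\<^sub>\<infinity>i\<in>A. complex_of_real (g i)) = of_real (\<Sum>\<^sub>\<infinity>i\<in>A. g i)"
  by (intro infsumI has_sum_of_real has_sum_infsum)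

text \<open>The classical extremiser conj(sgn y) |y|^(p-1) / ||y||^(p-1), which for p = 1 is
  conj(sgn y). The support condition is recorded so that functionals norming disjointly supported
  vectors are disjointly supported themselves.\<close>

lemma norming_functional:
  fixes y :: "'i fn"
  assumes p: "1 \<le> p" and y: "y \<in> Lp p"
  obtains a where "a \<in> Lq p" "lq_norm p a \<le> 1" "pairing a y = lp_norm p y" "\<And>i. y i = 0 \<Longrightarrow> a i = 0"
proof (cases "p = 1")
  case True
  define a where "a i = cnj (sgn (y i))" for i
  have le: "cmod (a i) \<le> 1" for i by (auto simp: a_def norm_sgn)
  have "a i * y i = of_real (cmod (y i))" for i
    using sgn_mult_cnj[of "y i"] by (simp add: a_def mult.commute)
  then have "pairing a y = (\<Sum>\<^sub>\<infinity>i. of_real (cmod (y i)))" by (simp add: pairing_def)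
  also have "\<dots> = of_real (lp_norm p y)"
    using lp_norm_powr[OF p, of y] True y
    by (subst infsum_of_real_complex) (auto simp: Lp_iff)
  finally show ?thesis
    using True le by (intro that[of a]) (auto simp: a_def intro!: cSUP_least bdd_aboveI2[where M = 1])
next
  case False
  define q where "q = p / (p - 1)"
  have p1: "1 < p" using p False by simp
  note q = conj_exponent[OF p1, folded q_def]
  have q1: "1 \<le> q" using q by simp
  let ?B = "lp_norm p y"
  show ?thesis
  proof (cases "?B = 0")
    case True
    then have "y = 0" using lp_norm_eq_0_iff[OF p y] by blast
    then show ?thesis using that[of 0] True p1 by (simp add: lq_gt_1)
  next
    case False
    then have B: "0 < ?B" by (auto simp: less_le)
    define a where "a i = cnj (sgn (y i)) * of_real ((cmod (y i) / ?B) powr (p - 1))" for i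
    have na: "cmod (a i) powr q = (cmod (y i) / ?B) powr p" for i
      using p1 q by (cases "y i = 0") (auto simp: a_def norm_mult norm_sgn powr_powr)
    have *: "(\<Sum>i\<in>F. cmod (a i) powr q) \<le> 1 powr q" if F: "finite F" for F
      unfolding na using sum_powr_le_lp_norm[OF p y F] B
      by (simp add: powr_divide flip: sum_divide_distrib)
    have "a i * y i = of_real (cmod (y i) powr p / ?B powr (p - 1))" for i
    proof (cases "y i = 0")
      case False
      then have "a i * y i = of_real (cmod (y i) * (cmod (y i) / ?B) powr (p - 1))"
        using sgn_mult_cnj[of "y i"] by (simp add: a_def mult_ac)
      also have "cmod (y i) * (cmod (y i) / ?B) powr (p - 1) = cmod (y i) powr p / ?B powr (p - 1)"
        using False by (simp add: powr_divide powr_diff)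
      finally show ?thesis .
    qed simp
    then have "pairing a y = of_real (\<Sum>\<^sub>\<infinity>i. cmod (y i) powr p / ?B powr (p - 1))"
      unfolding pairing_def using y
      by (subst infsum_of_real_complex[symmetric]) (auto simp: Lp_iff divide_inverse intro: summable_on_cmult_left)
    also have "(\<Sum>\<^sub>\<infinity>i. cmod (y i) powr p / ?B powr (p - 1)) = ?B powr p / ?B powr (p - 1)"
      by (simp add: lp_norm_powr[OF p] divide_inverse infsum_cmult_left')
    also have "\<dots> = ?B" using B by (simp add: powr_diff)
    finally have pa: "pairing a y = of_real ?B" .
    show ?thesis
    proof (rule that[of a])
      show "a \<in> Lq p" "lq_norm p a \<le> 1"
        using LpI[where f = a, OF q1 _ *] lp_norm_leI[where f = a, OF q1 _ *] p1
        by (simp_all add: lq_gt_1 q_def)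
    qed (use pa in \<open>auto simp: a_def\<close>)
  qed
qed

text \<open>The coefficients are bounded by testing on finitely supported vectors; these are dense
  because p is finite, and density then gives the representation.\<close>

lemma Riesz_lp:
  fixes \<phi> :: "'i fn \<Rightarrow> complex"
  assumes p: "1 \<le> p"
    and add: "\<And>f g. f \<in> Lp p \<Longrightarrow> g \<in> Lp p \<Longrightarrow> \<phi> (f + g) = \<phi> f + \<phi> g"
    and scale: "\<And>c f. f \<in> Lp p \<Longrightarrow> \<phi> (fscale c f) = c * \<phi> f"
    and bound: "\<And>f. f \<in> Lp p \<Longrightarrow> cmod (\<phi> f) \<le> C * lp_norm p f"
  defines "a \<equiv> \<lambda>i. \<phi> (basis_fn i)"
  shows "a \<in> Lq p" and "lq_norm p a \<le> C" and "\<And>f. f \<in> Lp p \<Longrightarrow> \<phi> f = pairing a f"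
proof -
  have ai: "cmod (a i) \<le> C" for i
    using bound[of "basis_fn i"] p by (simp add: a_def)
  then have C: "0 \<le> C" using order_trans norm_ge_zero by blast
  have z: "\<phi> 0 = 0" using scale[of 0 0] p by simp
  have finsum: "\<phi> (\<Sum>i\<in>F. fscale (c i) (basis_fn i)) = (\<Sum>i\<in>F. c i * a i)" if "finite F" for F c
    using that
  proof induction
    case (insert x F)
    have "(\<Sum>i\<in>F. fscale (c i) (basis_fn i)) \<in> Lp p" by (intro Lp_sum Lp_scale Lp_basis_fn p)
    then show ?case unfolding sum.insert[OF insert(1,2)]
      using insert(3) by (simp only: add[OF Lp_scale[OF p Lp_basis_fn[OF p]]] scale[OF Lp_basis_fn[OF p]] a_def)
  qed (simp only: sum.empty z)
  have *: "a \<in> Lq p \<and> lq_norm p a \<le> C"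
  proof (cases "p = 1")
    case True
    then show ?thesis using ai by (auto intro!: cSUP_least bdd_aboveI2[where M = C])
  next
    case False
    define q where "q = p / (p - 1)"
    have p1: "1 < p" using p False by simp
    note q = conj_exponent[OF p1, folded q_def]
    have q1: "1 \<le> q" using q by simp
    have *: "(\<Sum>i\<in>F. cmod (a i) powr q) \<le> C powr q" if F: "finite F" for F
    proof (cases "(\<Sum>i\<in>F. cmod (a i) powr q) = 0")
      case False
      define S where "S = (\<Sum>i\<in>F. cmod (a i) powr q)"
      have S: "0 < S" using False by (auto simp: S_def less_le sum_nonneg)
      \<comment> \<open>The equality case of Hoelder: \<open>c i * a i\<close> equals |a_i|^q, and
        so does |c_i|^p because (q - 1) p = q. Hence S <= C S^(1/p), which is S^(1/q) <= C.\<close>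
      define c where "c i = cnj (sgn (a i)) * of_real (cmod (a i) powr (q - 1))" for i
      define f where "f = (\<Sum>i\<in>F. fscale (c i) (basis_fn i))"
      have f: "f \<in> Lp p" unfolding f_def by (intro Lp_sum Lp_scale Lp_basis_fn p)
      have fr: "f = restr F c" unfolding f_def using restr_finite_eq_sum[OF F] by metis
      have qp: "(q - 1) * p = q" using p1 by (simp add: q_def field_simps)
      have nf: "lp_norm p f \<le> S powr (1 / p)"
      proof (rule lp_norm_leI[OF p])
        fix G :: "'i set" assume G: "finite G"
        have "(\<Sum>i\<in>G. cmod (f i) powr p) = (\<Sum>i\<in>G \<inter> F. cmod (a i) powr q)"
          using G qp q1
          by (intro sum.mono_neutral_cong_right)
            (auto simp: fr restr_def c_def norm_mult norm_sgn powr_powr)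
        also have "\<dots> \<le> S" unfolding S_def by (intro sum_mono2) (use F in auto)
        finally show "(\<Sum>i\<in>G. cmod (f i) powr p) \<le> (S powr (1 / p)) powr p"
          using S p by (simp add: powr_powr)
      qed simp
      have "c i * a i = of_real (cmod (a i) powr q)" for i
      proof (cases "a i = 0")
        case False
        have "c i * a i = of_real (cmod (a i) * cmod (a i) powr (q - 1))"
          using sgn_mult_cnj[of "a i"] by (simp add: c_def mult_ac)
        then show ?thesis using False by (simp add: powr_diff)
      qed (simp add: c_def)
      then have "\<phi> f = of_real S"
        by (simp add: f_def finsum[OF F] S_def)
      then have "S \<le> C * S powr (1 / p)"
        using bound[OF f] nf C S by (smt (verit) mult_left_mono norm_of_real)
      also have "S powr (1 / p) = S powr (1 - 1 / q)" by (rule arg_cong[where f = "\<lambda>t. S powr t"]) (use q(2) in linarith)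
      also have "\<dots> = S / S powr (1 / q)" using S by (simp add: powr_diff)
      finally have "S powr (1 / q) \<le> C" using S by (simp add: field_simps)
      then have "(S powr (1 / q)) powr q \<le> C powr q" using q1 by (intro powr_mono2) auto
      then show ?thesis using S q1 by (simp add: powr_powr S_def)
    qed simp
    show ?thesis
      using LpI[OF q1 C *] lp_norm_leI[OF q1 C *] p1 by (simp add: lq_gt_1 q_def)
  qed
  then show a: "a \<in> Lq p" and na: "lq_norm p a \<le> C" by auto
  fix f :: "'i fn" assume f: "f \<in> Lp p"
  show "\<phi> f = pairing a f"
  proof (rule ccontr)
    assume ne: "\<phi> f \<noteq> pairing a f"
    \<comment> \<open>The tail contributes at most 2 C e, less than (2 C + 1) e, which is the
      assumed discrepancy; the added 1 covers C = 0.\<close>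
    define e where "e = cmod (\<phi> f - pairing a f) / (2 * C + 1)"
    have e: "0 < e" using ne C by (auto simp: e_def)
    obtain F where F: "finite F" "lp_norm p (f - restr F f) < e"
      using Lp_finite_approx[OF p f e] by blast
    define g where "g = f - restr F f"
    have g: "g \<in> Lp p" and fg: "f = restr F f + g" and rf: "restr F f \<in> Lp p"
      using p f by (auto simp: g_def)
    have "pairing a (restr F f) = (\<Sum>\<^sub>\<infinity>i\<in>F. a i * f i)"
      unfolding pairing_def by (rule infsum_cong_neutral) (auto simp: restr_def)
    then have "\<phi> (restr F f) = pairing a (restr F f)"
      using F finsum[OF F(1), of f] by (simp add: restr_finite_eq_sum[OF F(1)] mult.commute)
    then have "\<phi> f - pairing a f = \<phi> g - pairing a g"
      using add[OF rf g] pairing_add[OF p a rf g] fg by simp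
    then have "cmod (\<phi> f - pairing a f) \<le> cmod (\<phi> g) + cmod (pairing a g)"
      using norm_triangle_ineq4 by metis
    also have "\<dots> \<le> C * lp_norm p g + C * lp_norm p g"
      using bound[OF g] norm_pairing_le[OF p a g] na
      by (smt (verit) lp_norm_nonneg mult_right_mono)
    also have "\<dots> \<le> 2 * C * e" using F(2) C by (simp add: g_def mult_left_mono)
    also have "\<dots> < (2 * C + 1) * e" using e by (simp add: algebra_simps)
    finally show False using C by (simp add: e_def)
  qed
qed

lemma pairing_finite_sum:
  assumes "1 \<le> p" "a \<in> Lq p" "\<And>s. s \<in> S \<Longrightarrow> f s \<in> Lp p"
  shows "pairing a (\<Sum>s\<in>S. f s) = (\<Sum>s\<in>S. pairing a (f s))"
  using assms(3)
proof (induction S rule: infinite_finite_induct)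
  case (insert x F)
  have "(\<Sum>s\<in>F. f s) \<in> Lp p" by (intro Lp_sum) (use assms insert in auto)
  then show ?case using insert assms(1,2) pairing_add
    by (smt (verit) insertCI sum.insert)
qed auto

section \<open>Bounded operators and closures\<close>


abbreviation bops :: "real \<Rightarrow> ('i, 'j) opr set" where
  "bops p \<equiv> bounded_ops (lp p) (lp p)"

abbreviation onorm_lp :: "real \<Rightarrow> ('i, 'j) opr \<Rightarrow> real" where
  "onorm_lp p \<equiv> op_norm (lp p) (lp p)"

abbreviation cl_lp :: "real \<Rightarrow> ('i, 'j) opr set \<Rightarrow> ('i, 'j) opr set" where
  "cl_lp p \<equiv> op_closure (lp p) (lp p)"

lemma bopsI:
  assumes "\<And>f. f \<notin> Lp p \<Longrightarrow> T f = 0"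
    and "\<And>f. f \<in> Lp p \<Longrightarrow> T f \<in> Lp p"
    and "\<And>f g. f \<in> Lp p \<Longrightarrow> g \<in> Lp p \<Longrightarrow> T (f + g) = T f + T g"
    and "\<And>c f. f \<in> Lp p \<Longrightarrow> T (fscale c f) = fscale c (T f)"
    and "\<And>f. f \<in> Lp p \<Longrightarrow> lp_norm p (T f) \<le> K * lp_norm p f"
  shows "T \<in> bops p"
  unfolding bounded_ops_def mem_Collect_eq snd_lp
  by (intro conjI allI impI ballI exI[of _ K] assms) auto

lemma bops_outside: "T \<in> bops p \<Longrightarrow> f \<notin> Lp p \<Longrightarrow> T f = 0"
  by (simp add: bounded_ops_def)

lemma bops_add:
  "T \<in> bops p \<Longrightarrow> f \<in> Lp p \<Longrightarrow> g \<in> Lp p \<Longrightarrow> T (f + g) = T f + T g"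
  by (simp add: bounded_ops_def)

lemma bops_scale: "T \<in> bops p \<Longrightarrow> f \<in> Lp p \<Longrightarrow> T (fscale c f) = fscale c (T f)"
  by (simp add: bounded_ops_def)

lemma bops_zero: "T \<in> bops p \<Longrightarrow> T 0 = 0"
  using bops_scale[of T p 0 0] by simp

text \<open>Off the carrier \<open>T f\<close> is 0 by convention, which saves a membership
  condition in every composition.\<close>

lemma bops_Lp: "T \<in> bops p \<Longrightarrow> T f \<in> Lp p"
  by (cases "f \<in> Lp p") (auto simp: bounded_ops_def)

lemma bops_uminus: "T \<in> bops p \<Longrightarrow> f \<in> Lp p \<Longrightarrow> T (- f) = - T f"
  by (metis bops_scale fscale_minus1)

lemma bops_diff:
  assumes "1 \<le> p" "T \<in> bops p" "f \<in> Lp p" "g \<in> Lp p"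
  shows "T (f - g) = T f - T g"
  unfolding diff_conv_add_uminus bops_uminus[OF assms(2,4), symmetric]
  by (rule bops_add[of T p f "- g"]) (use assms in auto)

lemma bops_sum:
  assumes "1 \<le> p" "T \<in> bops p" "\<And>s. s \<in> S \<Longrightarrow> f s \<in> Lp p"
  shows "T (\<Sum>s\<in>S. f s) = (\<Sum>s\<in>S. T (f s))"
  using assms(3)
proof (induction S rule: infinite_finite_induct)
  case (insert x F)
  have "(\<Sum>s\<in>F. f s) \<in> Lp p" by (intro Lp_sum) (use assms insert in auto)
  then have "T (f x + (\<Sum>s\<in>F. f s)) = T (f x) + T (\<Sum>s\<in>F. f s)"
    by (intro bops_add[OF assms(2)] insert(4)) auto
  moreover have "T (\<Sum>s\<in>F. f s) = (\<Sum>s\<in>F. T (f s))" by (rule insert(3)) (rule insert(4), simp)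
  ultimately show ?case unfolding sum.insert[OF insert(1,2)] by (simp only:)
qed (simp_all only: sum.empty sum.infinite bops_zero[OF assms(2)] not_False_eq_True)

lemma onorm_lp_le:
  "0 \<le> K \<Longrightarrow> (\<And>f. f \<in> Lp p \<Longrightarrow> lp_norm p (T f) \<le> K * lp_norm p f) \<Longrightarrow> onorm_lp p T \<le> K"
  unfolding op_norm_def by (rule cInf_lower) (auto intro: bdd_belowI[of _ 0])

text \<open>The infimum is attained: for f of positive norm every admissible K bounds the quotient
  of norms, so the infimum does; for f of norm 0 any bound forces \<open>T f\<close> to have norm
  0.\<close>

lemma
  assumes T: "T \<in> bops p"
  shows onorm_lp_nonneg [simp]: "0 \<le> onorm_lp p T"
    and onorm_lp_bound: "f \<in> Lp p \<Longrightarrow> lp_norm p (T f) \<le> onorm_lp p T * lp_norm p f"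
proof -
  let ?S = "{K. 0 \<le> K \<and> (\<forall>f\<in>Lp p. lp_norm p (T f) \<le> K * lp_norm p f)}"
  obtain K where K: "\<forall>f\<in>Lp p. lp_norm p (T f) \<le> K * lp_norm p f"
    using T by (auto simp: bounded_ops_def)
  \<comment> \<open>The bound in \<open>bounded_ops\<close> carries no sign, while the infimum
    ranges over nonnegative K.\<close>
  have "lp_norm p (T f) \<le> max 0 K * lp_norm p f" if "f \<in> Lp p" for f
    using K that by (meson lp_norm_nonneg max.cobounded2 mult_right_mono order_trans)
  then have ne: "max 0 K \<in> ?S" by auto
  have eq: "onorm_lp p T = Inf ?S" by (simp add: op_norm_def)
  show "0 \<le> onorm_lp p T"
    unfolding eq by (rule cInf_greatest) (use ne in blast, simp)
  assume f: "f \<in> Lp p"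
  show "lp_norm p (T f) \<le> onorm_lp p T * lp_norm p f"
  proof (cases "lp_norm p f = 0")
    case True
    then show ?thesis using K f by auto
  next
    case False
    then have pos: "0 < lp_norm p f" by (auto simp: less_le)
    have "lp_norm p (T f) / lp_norm p f \<le> Inf ?S"
      by (rule cInf_greatest) (use ne in blast, use pos f in \<open>simp add: divide_le_eq\<close>)
    then show ?thesis using pos by (simp add: eq divide_le_eq)
  qed
qed

lemma bops_0 [simp]: "0 \<in> bops p"
  by (rule bopsI[where K = 0]) auto

lemma onorm_lp_0 [simp]: "onorm_lp p 0 = 0"
proof (rule antisym)
  show "onorm_lp p 0 \<le> 0" by (rule onorm_lp_le[of 0]) auto
qed (rule onorm_lp_nonneg[OF bops_0])

lemma
  assumes p: "1 \<le> p" and S: "S \<in> bops p" and T: "T \<in> bops p"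
  shows bops_plus [simp]: "S + T \<in> bops p"
    and onorm_lp_triangle: "onorm_lp p (S + T) \<le> onorm_lp p S + onorm_lp p T"
proof -
  have *: "lp_norm p ((S + T) f) \<le> (onorm_lp p S + onorm_lp p T) * lp_norm p f" if f: "f \<in> Lp p" for f
    using lp_norm_triangle[OF p bops_Lp[OF S] bops_Lp[OF T], of f f]
      onorm_lp_bound[OF S f] onorm_lp_bound[OF T f]
    by (simp add: ring_distribs)
  show "S + T \<in> bops p"
  proof (rule bopsI[OF _ _ _ _ *])
    fix f g :: "'a fn" assume fg: "f \<in> Lp p" "g \<in> Lp p"
    show "(S + T) (f + g) = (S + T) f + (S + T) g"
      using bops_add[OF S fg] bops_add[OF T fg] by simp
  next
    fix c and f :: "'a fn" assume f: "f \<in> Lp p"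
    show "(S + T) (fscale c f) = fscale c ((S + T) f)"
      using bops_scale[OF S f] bops_scale[OF T f] by (simp add: cfun.scale_right_distrib)
  qed (use bops_outside[OF S] bops_outside[OF T] p bops_Lp[OF S] bops_Lp[OF T] in auto)
  show "onorm_lp p (S + T) \<le> onorm_lp p S + onorm_lp p T"
    by (rule onorm_lp_le[OF _ *]) (use S T in auto)
qed

lemma
  assumes p: "1 \<le> p" and T: "T \<in> bops p"
  shows bops_oscale [simp]: "oscale c T \<in> bops p"
    and onorm_lp_oscale_le: "onorm_lp p (oscale c T) \<le> cmod c * onorm_lp p T"
proof -
  have *: "lp_norm p (oscale c T f) \<le> (cmod c * onorm_lp p T) * lp_norm p f" if f: "f \<in> Lp p" for f
    using onorm_lp_bound[OF T f]
    by (simp add: oscale_def lp_norm_scale[OF p] mult_left_mono mult.assoc)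
  show "oscale c T \<in> bops p"
  proof (rule bopsI[OF _ _ _ _ *])
    fix f g :: "'a fn" assume fg: "f \<in> Lp p" "g \<in> Lp p"
    show "oscale c T (f + g) = oscale c T f + oscale c T g"
      using bops_add[OF T fg] by (simp add: oscale_def cfun.scale_right_distrib)
  next
    fix d and f :: "'a fn" assume f: "f \<in> Lp p"
    show "oscale c T (fscale d f) = fscale d (oscale c T f)"
      using bops_scale[OF T f] by (simp add: oscale_def mult.commute)
  qed (use bops_outside[OF T] p bops_Lp[OF T] in \<open>auto simp: oscale_def\<close>)
  show "onorm_lp p (oscale c T) \<le> cmod c * onorm_lp p T"
    by (rule onorm_lp_le[OF _ *]) (use T in auto)
qed

lemma oscale_minus1: "oscale (-1) T = - T"
  by (simp add: oscale_def fscale_def fun_eq_iff)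

lemma bops_minus [simp]: "1 \<le> p \<Longrightarrow> T \<in> bops p \<Longrightarrow> - T \<in> bops p"
  unfolding oscale_minus1[symmetric] by (rule bops_oscale)

lemma bops_minus_op [simp]: "1 \<le> p \<Longrightarrow> S \<in> bops p \<Longrightarrow> T \<in> bops p \<Longrightarrow> S - T \<in> bops p"
  by (simp only: diff_conv_add_uminus bops_plus bops_minus)

lemma
  assumes p: "1 \<le> p" and S: "S \<in> bops p" and T: "T \<in> bops p"
  shows bops_comp [simp]: "S \<circ> T \<in> bops p"
    and onorm_lp_comp: "onorm_lp p (S \<circ> T) \<le> onorm_lp p S * onorm_lp p T"
proof -
  have *: "lp_norm p ((S \<circ> T) f) \<le> (onorm_lp p S * onorm_lp p T) * lp_norm p f" if f: "f \<in> Lp p" for f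
  proof -
    have "lp_norm p (S (T f)) \<le> onorm_lp p S * lp_norm p (T f)"
      by (rule onorm_lp_bound[OF S bops_Lp[OF T]])
    also have "\<dots> \<le> onorm_lp p S * (onorm_lp p T * lp_norm p f)"
      by (intro mult_left_mono onorm_lp_bound T f onorm_lp_nonneg S)
    finally show ?thesis by (simp add: mult.assoc)
  qed
  show "S \<circ> T \<in> bops p"
  proof (rule bopsI[OF _ _ _ _ *])
    fix f g :: "'c fn" assume fg: "f \<in> Lp p" "g \<in> Lp p"
    show "(S \<circ> T) (f + g) = (S \<circ> T) f + (S \<circ> T) g"
      using bops_add[OF T fg] bops_add[OF S bops_Lp[OF T] bops_Lp[OF T]] by simp
  next
    fix c and f :: "'c fn" assume f: "f \<in> Lp p"
    show "(S \<circ> T) (fscale c f) = fscale c ((S \<circ> T) f)"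
      using bops_scale[OF T f] bops_scale[OF S bops_Lp[OF T]] by simp
  qed (use bops_outside[OF T] bops_zero[OF S] bops_Lp[OF S] in auto)
  show "onorm_lp p (S \<circ> T) \<le> onorm_lp p S * onorm_lp p T"
    by (rule onorm_lp_le[OF _ *]) (use S T in auto)
qed

lemma bops_subspace: "1 \<le> p \<Longrightarrow> cop.subspace (bops p)"
  by (simp add: cop.subspace_def)

lemma bops_finite_sum:
  "1 \<le> p \<Longrightarrow> (\<And>s. s \<in> A \<Longrightarrow> T s \<in> bops p) \<Longrightarrow> (\<Sum>s\<in>A. T s) \<in> bops p"
  by (rule cop.subspace_sum[OF bops_subspace])

lemma bops_comp_distrib_left:
  "1 \<le> p \<Longrightarrow> S \<in> bops p \<Longrightarrow> T \<in> bops p \<Longrightarrow> U \<in> bops p \<Longrightarrow> S \<circ> (T + U) = (S \<circ> T) + (S \<circ> U)"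
  by (rule ext) (simp add: bops_add[of S p] bops_Lp)

lemma bops_comp_diff_left:
  "1 \<le> p \<Longrightarrow> S \<in> bops p \<Longrightarrow> T \<in> bops p \<Longrightarrow> U \<in> bops p \<Longrightarrow> S \<circ> (T - U) = (S \<circ> T) - (S \<circ> U)"
  by (rule ext) (simp add: bops_diff[of p S] bops_Lp)

lemma bops_comp_oscale_left:
  "S \<in> bops p \<Longrightarrow> T \<in> bops p \<Longrightarrow> S \<circ> oscale c T = oscale c (S \<circ> T)"
  by (rule ext) (simp add: oscale_def bops_scale[of S p] bops_Lp)

lemma comp_oscale_right: "oscale c S \<circ> T = oscale c (S \<circ> T)"
  by (rule ext) (simp add: oscale_def)

lemma comp_distrib_right: "(S + T) \<circ> U = (S \<circ> U) + (T \<circ> U)"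
    "(S - T) \<circ> U = (S \<circ> U) - (T \<circ> U)" for S T :: "('j, 'k) opr"
  by (auto simp: fun_eq_iff)

lemma cl_lp_iff:
  "T \<in> cl_lp p S \<longleftrightarrow> T \<in> bops p \<and> (\<forall>e>0. \<exists>R\<in>S. onorm_lp p (T - R) < e)"
  by (simp add: op_closure_def)

lemma cl_lp_bops: "T \<in> cl_lp p S \<Longrightarrow> T \<in> bops p"
  by (simp add: cl_lp_iff)

lemma cl_lp_subset_bops: "cl_lp p S \<subseteq> bops p"
  by (auto simp: cl_lp_iff)

lemma cl_lp_approx: "T \<in> cl_lp p S \<Longrightarrow> 0 < e \<Longrightarrow> \<exists>R\<in>S. onorm_lp p (T - R) < e"
  by (simp add: cl_lp_iff)

lemma cl_lp_superset: "S \<subseteq> bops p \<Longrightarrow> S \<subseteq> cl_lp p S"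
  by (force simp: cl_lp_iff)

lemma cl_lp_mono: "S \<subseteq> T \<Longrightarrow> cl_lp p S \<subseteq> cl_lp p T"
  by (force simp: cl_lp_iff)

lemma cl_lp_idem:
  assumes p: "1 \<le> p" and S: "S \<subseteq> bops p"
  shows "cl_lp p (cl_lp p S) = cl_lp p S"
proof
  show "cl_lp p (cl_lp p S) \<subseteq> cl_lp p S"
  proof
    fix T assume T: "T \<in> cl_lp p (cl_lp p S)"
    have "\<exists>R\<in>S. onorm_lp p (T - R) < e" if e: "0 < e" for e
    proof -
      obtain U where U: "U \<in> cl_lp p S" "onorm_lp p (T - U) < e / 2"
        using cl_lp_approx[OF T, of "e / 2"] e by auto
      obtain R where R: "R \<in> S" "onorm_lp p (U - R) < e / 2"
        using cl_lp_approx[OF U(1), of "e / 2"] e by auto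
      have "onorm_lp p ((T - U) + (U - R)) \<le> onorm_lp p (T - U) + onorm_lp p (U - R)"
        by (intro onorm_lp_triangle bops_minus_op p cl_lp_bops[OF T] cl_lp_bops[OF U(1)])
          (use R S in auto)
      moreover have "(T - U) + (U - R) = T - R" by simp
      ultimately have "onorm_lp p (T - R) \<le> onorm_lp p (T - U) + onorm_lp p (U - R)"
        by (simp only:)
      then have "onorm_lp p (T - R) < e" using U(2) R(2) by linarith
      then show ?thesis using R(1) by blast
    qed
    then show "T \<in> cl_lp p S" using cl_lp_bops[OF T] by (simp add: cl_lp_iff)
  qed
qed (rule cl_lp_superset[OF cl_lp_subset_bops])

lemma cl_lp_minimal: "S \<subseteq> C \<Longrightarrow> cl_lp p C = C \<Longrightarrow> cl_lp p S \<subseteq> C"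
  using cl_lp_mono by blast

lemma cl_lp_subspace:
  assumes p: "1 \<le> p" and S: "S \<subseteq> bops p" and sub: "cop.subspace S"
  shows "cop.subspace (cl_lp p S)"
proof (rule cop.subspaceI)
  have "0 \<in> S" using sub by (rule cop.subspace_0)
  then show "0 \<in> cl_lp p S" using cl_lp_superset[OF S] by blast
next
  fix T U assume T: "T \<in> cl_lp p S" and U: "U \<in> cl_lp p S"
  have "\<exists>R\<in>S. onorm_lp p (T + U - R) < e" if e: "0 < e" for e
  proof -
    obtain T' where T': "T' \<in> S" "onorm_lp p (T - T') < e / 2"
      using cl_lp_approx[OF T, of "e / 2"] e by auto
    obtain U' where U': "U' \<in> S" "onorm_lp p (U - U') < e / 2"
      using cl_lp_approx[OF U, of "e / 2"] e by auto
    have "onorm_lp p ((T - T') + (U - U')) \<le> onorm_lp p (T - T') + onorm_lp p (U - U')"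
      by (intro onorm_lp_triangle bops_minus_op p cl_lp_bops[OF T] cl_lp_bops[OF U])
        (use T' U' S in auto)
    moreover have "(T - T') + (U - U') = T + U - (T' + U')" by simp
    moreover have "T' + U' \<in> S" using T' U' sub cop.subspace_add by blast
    ultimately have "onorm_lp p (T + U - (T' + U')) \<le> onorm_lp p (T - T') + onorm_lp p (U - U')"
      by (simp only:)
    then have "onorm_lp p (T + U - (T' + U')) < e" using T'(2) U'(2) by linarith
    then show ?thesis using \<open>T' + U' \<in> S\<close> by blast
  qed
  then show "T + U \<in> cl_lp p S"
    using bops_plus[OF p cl_lp_bops[OF T] cl_lp_bops[OF U]] by (simp add: cl_lp_iff)
next
  fix c T assume T: "T \<in> cl_lp p S"
  have "\<exists>R\<in>S. onorm_lp p (oscale c T - R) < e" if e: "0 < e" for e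
  proof -
    obtain T' where T': "T' \<in> S" "onorm_lp p (T - T') < e / (cmod c + 1)"
      using cl_lp_approx[OF T, of "e / (cmod c + 1)"] e by (auto simp: add_nonneg_pos)
    have b: "T - T' \<in> bops p" using T' S cl_lp_bops[OF T] p by auto
    have "onorm_lp p (oscale c (T - T')) \<le> cmod c * onorm_lp p (T - T')"
      by (rule onorm_lp_oscale_le[OF p b])
    also have "\<dots> \<le> (cmod c + 1) * onorm_lp p (T - T')"
      using onorm_lp_nonneg[OF b] by (simp add: algebra_simps)
    also have "\<dots> < e"
    proof -
      have "0 < cmod c + 1" by (simp add: add_nonneg_pos)
      then show ?thesis using T'(2) by (simp only: pos_less_divide_eq mult.commute)
    qed
    finally have "onorm_lp p (oscale c T - oscale c T') < e"
      by (simp only: cop.scale_right_diff_distrib)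
    moreover have "oscale c T' \<in> S" using T' sub cop.subspace_scale by blast
    ultimately show ?thesis by blast
  qed
  then show "oscale c T \<in> cl_lp p S"
    using bops_oscale[OF p cl_lp_bops[OF T]] by (simp add: cl_lp_iff)
qed

text \<open>Carries the product rules from the algebraic objects to their closures. First b is
  approximated, then a with an accuracy depending on the norm of that approximant; the error is a (b
  - b') + (a - a') b'. Adding 1 to the norms keeps the divisors positive.\<close>

lemma cl_lp_comp:
  assumes p: "1 \<le> p" and A: "A \<subseteq> bops p" and B: "B \<subseteq> bops p"
    and a: "a \<in> cl_lp p A" and b: "b \<in> cl_lp p B"
    and U: "\<And>a b. a \<in> A \<Longrightarrow> b \<in> B \<Longrightarrow> a \<circ> b \<in> U"
  shows "a \<circ> b \<in> cl_lp p U"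
proof -
  note ab = cl_lp_bops[OF a] cl_lp_bops[OF b]
  have "\<exists>R\<in>U. onorm_lp p ((a \<circ> b) - R) < e" if e: "0 < e" for e
  proof -
    define \<alpha> where "\<alpha> = onorm_lp p a + 1"
    have \<alpha>: "0 < \<alpha>" using onorm_lp_nonneg[OF ab(1)] by (simp add: \<alpha>_def)
    obtain b' where b': "b' \<in> B" "onorm_lp p (b - b') < e / (2 * \<alpha>)"
      using cl_lp_approx[OF b, of "e / (2 * \<alpha>)"] e \<alpha> by auto
    then have bb: "b' \<in> bops p" using B by auto
    define \<beta> where "\<beta> = onorm_lp p b' + 1"
    have \<beta>: "0 < \<beta>" using onorm_lp_nonneg[OF bb] by (simp add: \<beta>_def)
    obtain a' where a': "a' \<in> A" "onorm_lp p (a - a') < e / (2 * \<beta>)"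
      using cl_lp_approx[OF a, of "e / (2 * \<beta>)"] e \<beta> by auto
    then have aa: "a' \<in> bops p" using A by auto
    note d = bops_minus_op[OF p ab(1) aa] bops_minus_op[OF p ab(2) bb]
    have "onorm_lp p (a \<circ> (b - b')) \<le> onorm_lp p a * onorm_lp p (b - b')"
      by (rule onorm_lp_comp[OF p ab(1) d(2)])
    also have "\<dots> \<le> \<alpha> * onorm_lp p (b - b')"
      using onorm_lp_nonneg[OF d(2)] by (intro mult_right_mono) (auto simp: \<alpha>_def)
    also have "\<dots> < e / 2" using b'(2) \<alpha> by (simp add: field_simps)
    finally have 1: "onorm_lp p (a \<circ> (b - b')) < e / 2" .
    have "onorm_lp p ((a - a') \<circ> b') \<le> onorm_lp p (a - a') * onorm_lp p b'"
      by (rule onorm_lp_comp[OF p d(1) bb])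
    also have "\<dots> \<le> onorm_lp p (a - a') * \<beta>"
      using onorm_lp_nonneg[OF d(1)] by (intro mult_left_mono) (auto simp: \<beta>_def)
    also have "\<dots> < e / 2" using a'(2) \<beta> by (simp add: field_simps)
    finally have 2: "onorm_lp p ((a - a') \<circ> b') < e / 2" .
    have "(a \<circ> b) - (a' \<circ> b') = (a \<circ> (b - b')) + ((a - a') \<circ> b')"
      by (simp only: bops_comp_diff_left[OF p ab(1) ab(2) bb] comp_distrib_right) simp
    then have "onorm_lp p ((a \<circ> b) - (a' \<circ> b')) \<le> onorm_lp p (a \<circ> (b - b')) + onorm_lp p ((a - a') \<circ> b')"
      using onorm_lp_triangle[OF p bops_comp[OF p ab(1) d(2)] bops_comp[OF p d(1) bb]] by (simp only:)
    then show ?thesis using U[OF a'(1) b'(1)] 1 2 by (intro bexI[of _ "a' \<circ> b'"]) auto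
  qed
  then show ?thesis using bops_comp[OF p ab] by (simp add: cl_lp_iff)
qed

section \<open>Finite propagation\<close>


text \<open>
  The index sets are fibred over the metric space by \<open>\<pi>\<close> and \<open>\<sigma>\<close>, so that the three kinds of
  matrices (with entries in \<open>\<complex>\<close>, \<open>\<ell>\<^sup>p\<close>, \<open>\<ell>\<^sup>q\<close>) and the operators on \<open>\<ell>\<^sup>p(X, \<ell>\<^sup>p)\<close> are all covered.
\<close>

definition fprop :: "real \<Rightarrow> ('i \<Rightarrow> 'x::metric_space) \<Rightarrow> ('j \<Rightarrow> 'x) \<Rightarrow> real \<Rightarrow> ('i, 'j) opr set" where
  "fprop p \<pi> \<sigma> R = {S \<in> bops p.
     \<forall>g\<in>Lp p. \<forall>j. (\<forall>i. g i \<noteq> 0 \<longrightarrow> R < dist (\<sigma> j) (\<pi> i)) \<longrightarrow> S g j = 0}"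

lemma fprop_bops: "S \<in> fprop p \<pi> \<sigma> R \<Longrightarrow> S \<in> bops p"
  by (simp add: fprop_def)

lemma fprop_zero:
  "S \<in> fprop p \<pi> \<sigma> R \<Longrightarrow> g \<in> Lp p \<Longrightarrow> (\<And>i. g i \<noteq> 0 \<Longrightarrow> R < dist (\<sigma> j) (\<pi> i)) \<Longrightarrow> S g j = 0"
  by (simp add: fprop_def)

lemma fpropI:
  assumes "S \<in> bops p"
    and "\<And>g j. g \<in> Lp p \<Longrightarrow> (\<And>i. g i \<noteq> 0 \<Longrightarrow> R < dist (\<sigma> j) (\<pi> i)) \<Longrightarrow> S g j = 0"
  shows "S \<in> fprop p \<pi> \<sigma> R"
  unfolding fprop_def using assms by blast

lemma fprop_mono: "R \<le> R' \<Longrightarrow> fprop p \<pi> \<sigma> R \<subseteq> fprop p \<pi> \<sigma> R'"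
  by (intro subsetI fpropI) (auto intro: fprop_bops elim!: fprop_zero order_le_less_trans)

lemma fprop_comp:
  assumes p: "1 \<le> p" and S: "S \<in> fprop p \<pi> \<sigma> R" and T: "T \<in> fprop p \<sigma> \<tau> R'"
  shows "T \<circ> S \<in> fprop p \<pi> \<tau> (R + R')"
proof (rule fpropI[OF bops_comp[OF p fprop_bops[OF T] fprop_bops[OF S]]])
  fix g k assume g: "g \<in> Lp p" and far: "\<And>i. g i \<noteq> 0 \<Longrightarrow> R + R' < dist (\<tau> k) (\<pi> i)"
  have "T (S g) k = 0"
  proof (rule fprop_zero[OF T bops_Lp[OF fprop_bops[OF S]]])
    fix j assume "S g j \<noteq> 0"
    then obtain i where i: "g i \<noteq> 0" "dist (\<sigma> j) (\<pi> i) \<le> R"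
      using fprop_zero[OF S g, of j] by (metis not_less)
    then have "R + R' < dist (\<tau> k) (\<pi> i)" using far by blast
    also have "\<dots> \<le> dist (\<tau> k) (\<sigma> j) + dist (\<sigma> j) (\<pi> i)" by (rule dist_triangle)
    finally show "R' < dist (\<tau> k) (\<sigma> j)" using i by linarith
  qed
  then show "(T \<circ> S) g k = 0" by simp
qed

lemma fprop_subspace:
  assumes p: "1 \<le> p"
  shows "cop.subspace (fprop p \<pi> \<sigma> R)"
proof (rule cop.subspaceI)
  fix S T assume S: "S \<in> fprop p \<pi> \<sigma> R" and T: "T \<in> fprop p \<pi> \<sigma> R"
  show "S + T \<in> fprop p \<pi> \<sigma> R"
  proof (rule fpropI[OF bops_plus[OF p fprop_bops[OF S] fprop_bops[OF T]]])
    fix g j assume *: "g \<in> Lp p" "\<And>i. g i \<noteq> 0 \<Longrightarrow> R < dist (\<sigma> j) (\<pi> i)"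
    have "S g j = 0" "T g j = 0" by (rule fprop_zero[OF S *] fprop_zero[OF T *]; assumption)+
    then show "(S + T) g j = 0" by simp
  qed
next
  fix c S assume S: "S \<in> fprop p \<pi> \<sigma> R"
  show "oscale c S \<in> fprop p \<pi> \<sigma> R"
  proof (rule fpropI[OF bops_oscale[OF p fprop_bops[OF S]]])
    fix g j assume *: "g \<in> Lp p" "\<And>i. g i \<noteq> 0 \<Longrightarrow> R < dist (\<sigma> j) (\<pi> i)"
    have "S g j = 0" by (rule fprop_zero[OF S *])
    then show "oscale c S g j = 0" by (simp add: oscale_def fscale_def)
  qed
qed (rule fpropI[OF bops_0], simp only: zero_fun_apply)

lemma Union_fprop_subspace:
  assumes p: "1 \<le> p"
  shows "cop.subspace (\<Union>R. fprop p \<pi> \<sigma> R)"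
proof (rule cop.subspaceI)
  show "0 \<in> (\<Union>R. fprop p \<pi> \<sigma> R)"
    by (intro UN_I[of 0] UNIV_I cop.subspace_0 fprop_subspace p)
next
  fix S T assume "S \<in> (\<Union>R. fprop p \<pi> \<sigma> R)" "T \<in> (\<Union>R. fprop p \<pi> \<sigma> R)"
  then obtain R R' where "S \<in> fprop p \<pi> \<sigma> R" "T \<in> fprop p \<pi> \<sigma> R'" by blast
  then have "S \<in> fprop p \<pi> \<sigma> (max R R')" "T \<in> fprop p \<pi> \<sigma> (max R R')"
    using fprop_mono[of R "max R R'" p \<pi> \<sigma>] fprop_mono[of R' "max R R'" p \<pi> \<sigma>] by auto
  then show "S + T \<in> (\<Union>R. fprop p \<pi> \<sigma> R)"
    by (intro UN_I[of "max R R'"] UNIV_I cop.subspace_add fprop_subspace p)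
next
  fix c S assume "S \<in> (\<Union>R. fprop p \<pi> \<sigma> R)"
  then obtain R where "S \<in> fprop p \<pi> \<sigma> R" by blast
  then show "oscale c S \<in> (\<Union>R. fprop p \<pi> \<sigma> R)"
    by (intro UN_I[of R] UNIV_I cop.subspace_scale fprop_subspace p)
qed

lemma fprop_cong:
  assumes p: "1 \<le> p" and S: "S \<in> fprop p \<pi> \<sigma> R" and g: "g \<in> Lp p" and h: "h \<in> Lp p"
    and eq: "\<And>i. dist (\<sigma> j) (\<pi> i) \<le> R \<Longrightarrow> g i = h i"
  shows "S g j = S h j"
proof -
  have "S (g - h) j = 0"
  proof (rule fprop_zero[OF S Lp_diff[OF p g h]])
    fix i assume "(g - h) i \<noteq> 0"
    then show "R < dist (\<sigma> j) (\<pi> i)" using eq[of i] by (cases "dist (\<sigma> j) (\<pi> i) \<le> R") auto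
  qed
  then show ?thesis using bops_diff[OF p fprop_bops[OF S] g h] by simp
qed

text \<open>Only the fibres over the ball around \<open>\<sigma> j\<close> influence the value at
  \<open>j\<close>. They are finitely many even when each fibre is infinite, so finite additivity
  suffices.\<close>

lemma fprop_expand:
  assumes p: "1 \<le> p" and S: "S \<in> fprop p \<pi> \<sigma> R" and g: "g \<in> Lp p" and fin: "finite (cball (\<sigma> j) R)"
  shows "S g j = (\<Sum>y\<in>cball (\<sigma> j) R. S (restr (\<pi> -` {y}) g) j)"
proof -
  have "S g j = S (\<Sum>y\<in>cball (\<sigma> j) R. restr (\<pi> -` {y}) g) j"
  proof (rule fprop_cong[OF p S g])
    show "(\<Sum>y\<in>cball (\<sigma> j) R. restr (\<pi> -` {y}) g) \<in> Lp p"
      by (intro Lp_sum Lp_restr p g)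
    fix i assume "dist (\<sigma> j) (\<pi> i) \<le> R"
    then show "g i = (\<Sum>y\<in>cball (\<sigma> j) R. restr (\<pi> -` {y}) g) i"
      using fin by (simp add: sum_fn_apply restr_def)
  qed
  also have "\<dots> = (\<Sum>y\<in>cball (\<sigma> j) R. S (restr (\<pi> -` {y}) g) j)"
    by (subst bops_sum[OF p fprop_bops[OF S]]) (use p g in \<open>simp_all add: sum_fn_apply\<close>)
  finally show ?thesis .
qed

text \<open>The definition tests arbitrary vectors. On finitely supported ones linearity reduces it
  to matrix entries; boundedness and density cover the rest.\<close>

lemma fpropI_basis:
  assumes p: "1 \<le> p" and S: "S \<in> bops p"
    and zero: "\<And>i j. R < dist (\<sigma> j) (\<pi> i) \<Longrightarrow> S (basis_fn i) j = 0"
  shows "S \<in> fprop p \<pi> \<sigma> R"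
proof (rule fpropI[OF S])
  fix g j assume g: "g \<in> Lp p" and far: "\<And>i. g i \<noteq> 0 \<Longrightarrow> R < dist (\<sigma> j) (\<pi> i)"
  show "S g j = 0"
  proof (rule ccontr)
    assume ne: "S g j \<noteq> 0"
    define e where "e = cmod (S g j) / (onorm_lp p S + 1)"
    have e: "0 < e" using ne onorm_lp_nonneg[OF S] by (auto simp: e_def)
    obtain F where F: "finite F" "lp_norm p (g - restr F g) < e"
      using Lp_finite_approx[OF p g e] by blast
    have "S (restr F g) = (\<Sum>i\<in>F. S (fscale (g i) (basis_fn i)))"
      unfolding restr_finite_eq_sum[OF F(1)] by (rule bops_sum[OF p S]) (use p in auto)
    then have "S (restr F g) j = (\<Sum>i\<in>F. S (fscale (g i) (basis_fn i))) j" by (simp only:)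
    also have "\<dots> = (\<Sum>i\<in>F. g i * S (basis_fn i) j)"
      using bops_scale[OF S Lp_basis_fn[OF p]] by (simp add: sum_fn_apply fscale_def)
    also have "\<dots> = 0" using far zero by (intro sum.neutral) auto
    finally have "S (g - restr F g) j = S g j"
      using bops_diff[OF p S g Lp_restr[OF p g]] by simp
    then have "cmod (S g j) \<le> lp_norm p (S (g - restr F g))"
      using cmod_le_lp_norm[OF p bops_Lp[OF S]] by metis
    also have "\<dots> \<le> onorm_lp p S * lp_norm p (g - restr F g)"
      by (rule onorm_lp_bound[OF S]) (use p g in auto)
    also have "\<dots> \<le> onorm_lp p S * e"
      using F onorm_lp_nonneg[OF S] by (intro mult_left_mono) auto
    also have "\<dots> < (onorm_lp p S + 1) * e" using e by (simp add: algebra_simps)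
    also have "\<dots> = cmod (S g j)" using onorm_lp_nonneg[OF S] by (simp add: e_def)
    finally show False by simp
  qed
qed

abbreviation (input) ball_bound :: "real \<Rightarrow> nat \<Rightarrow> 'x::metric_space \<Rightarrow> bool" where
  "ball_bound R M x \<equiv> finite (cball x R) \<and> card (cball x R) \<le> M"

text \<open>Every term is at most the largest one, whose power is already among the summands on the
  right.\<close>

lemma sum_powr_le_card:
  fixes b :: "'a \<Rightarrow> real"
  assumes p: "1 \<le> p" and B: "finite B" "card B \<le> M" and b: "\<And>y. 0 \<le> b y"
  shows "(\<Sum>y\<in>B. b y) powr p \<le> real M powr p * (\<Sum>y\<in>B. b y powr p)"
proof (cases "B = {}")
  case False
  define m where "m = Max (b ` B)"
  have m: "b y \<le> m" if "y \<in> B" for y using B that by (simp add: m_def)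
  obtain z where z: "z \<in> B" "m = b z"
    using Max_in[of "b ` B"] B False unfolding m_def by blast
  have "(\<Sum>y\<in>B. b y) \<le> real (card B) * m"
    using sum_bounded_above[of B b m] m by auto
  also have "\<dots> \<le> real M * m" using B z b by (intro mult_right_mono) auto
  finally have "(\<Sum>y\<in>B. b y) powr p \<le> (real M * m) powr p"
    using p b by (intro powr_mono2) (auto intro: sum_nonneg)
  also have "\<dots> = real M powr p * b z powr p" using z b by (simp add: powr_mult)
  also have "\<dots> \<le> real M powr p * (\<Sum>y\<in>B. b y powr p)"
    using z B by (intro mult_left_mono member_le_sum) auto
  finally show ?thesis .
qed (use p in simp)

text \<open>A Schur test on fibres. One factor M comes from the power of a sum over a ball, the
  other from double counting: each y lies in at most M of the balls.\<close>

lemma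
  fixes \<pi> :: "'i \<Rightarrow> 'x::metric_space" and \<sigma> :: "'j \<Rightarrow> 'x"
  assumes p: "1 \<le> p" and ball: "\<And>x :: 'x. ball_bound R M x"
    and f: "f \<in> Lp p" and C: "0 \<le> C"
    and loc: "\<And>x. restr (\<sigma> -` {x}) g \<in> Lp p"
      "\<And>x. lp_norm p (restr (\<sigma> -` {x}) g) \<le> C * (\<Sum>y\<in>cball x R. lp_norm p (restr (\<pi> -` {y}) f))"
  shows Schur_Lp: "g \<in> Lp p" and Schur_lp_norm_le: "lp_norm p g \<le> C * real M ^ 2 * lp_norm p f"
proof -
  define b where "b y = lp_norm p (restr (\<pi> -` {y}) f)" for y
  have b0: "0 \<le> b y" for y by (simp add: b_def)
  have *: "(\<Sum>j\<in>F. cmod (g j) powr p) \<le> (C * real M ^ 2 * lp_norm p f) powr p" if F: "finite F" for F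
  proof -
    define G where "G = (\<Union>x\<in>\<sigma> ` F. cball x R)"
    have G: "finite G" using F ball by (auto simp: G_def)
    have "(\<Sum>j\<in>F. cmod (g j) powr p) = (\<Sum>x\<in>\<sigma> ` F. \<Sum>j\<in>{j\<in>F. \<sigma> j = x}. cmod (g j) powr p)"
      by (rule sum.image_gen[OF F])
    also have "\<dots> \<le> (\<Sum>x\<in>\<sigma> ` F. lp_norm p (restr (\<sigma> -` {x}) g) powr p)"
    proof (rule sum_mono)
      fix x
      have "(\<Sum>j\<in>{j\<in>F. \<sigma> j = x}. cmod (g j) powr p)
          = (\<Sum>j\<in>{j\<in>F. \<sigma> j = x}. cmod (restr (\<sigma> -` {x}) g j) powr p)"
        by (rule sum.cong) (auto simp: restr_def)
      also have "\<dots> \<le> lp_norm p (restr (\<sigma> -` {x}) g) powr p"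
        by (rule sum_powr_le_lp_norm[OF p loc(1)]) (use F in auto)
      finally show "(\<Sum>j\<in>{j\<in>F. \<sigma> j = x}. cmod (g j) powr p) \<le> lp_norm p (restr (\<sigma> -` {x}) g) powr p" .
    qed
    also have "\<dots> \<le> (\<Sum>x\<in>\<sigma> ` F. (C * (\<Sum>y\<in>cball x R. b y)) powr p)"
      using loc(2) p by (intro sum_mono powr_mono2) (auto simp: b_def)
    also have "\<dots> \<le> (\<Sum>x\<in>\<sigma> ` F. C powr p * (real M powr p * (\<Sum>y\<in>cball x R. b y powr p)))"
    proof (rule sum_mono)
      fix x
      have "(C * (\<Sum>y\<in>cball x R. b y)) powr p = C powr p * (\<Sum>y\<in>cball x R. b y) powr p"
        using C b0 by (simp add: powr_mult sum_nonneg)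
      also have "\<dots> \<le> C powr p * (real M powr p * (\<Sum>y\<in>cball x R. b y powr p))"
        by (intro mult_left_mono sum_powr_le_card) (use ball p b0 in auto)
      finally show "(C * (\<Sum>y\<in>cball x R. b y)) powr p
          \<le> C powr p * (real M powr p * (\<Sum>y\<in>cball x R. b y powr p))" .
    qed
    also have "\<dots> = C powr p * real M powr p * (\<Sum>x\<in>\<sigma> ` F. \<Sum>y\<in>cball x R. b y powr p)"
      by (simp add: sum_distrib_left mult.assoc)
    \<comment> \<open>The finite set G contains all the balls that occur, so the double sum runs
      over a finite relation and its order can be exchanged.\<close>
    also have "(\<Sum>x\<in>\<sigma> ` F. \<Sum>y\<in>cball x R. b y powr p) = (\<Sum>x\<in>\<sigma> ` F. \<Sum>y\<in>{y\<in>G. dist x y \<le> R}. b y powr p)"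
      by (intro sum.cong) (auto simp: G_def)
    also have "\<dots> = (\<Sum>y\<in>G. \<Sum>x\<in>{x\<in>\<sigma> ` F. dist x y \<le> R}. b y powr p)"
      by (rule sum.swap_restrict) (use F G in auto)
    also have "\<dots> \<le> (\<Sum>y\<in>G. real M * b y powr p)"
    proof (rule sum_mono)
      fix y
      have "card {x\<in>\<sigma> ` F. dist x y \<le> R} \<le> card (cball y R)"
        by (rule card_mono) (use ball in \<open>auto simp: dist_commute\<close>)
      then have "card {x\<in>\<sigma> ` F. dist x y \<le> R} \<le> M" using ball[of y] by linarith
      then show "(\<Sum>x\<in>{x\<in>\<sigma> ` F. dist x y \<le> R}. b y powr p) \<le> real M * b y powr p"
        by (auto intro!: mult_right_mono)
    qed
    also have "\<dots> = real M * (\<Sum>y\<in>G. b y powr p)" by (simp add: sum_distrib_left)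
    also have "\<dots> \<le> real M * lp_norm p f powr p"
      unfolding b_def
      by (intro mult_left_mono lp_norm_disjoint_le[OF p f G]) (auto simp: disjoint_family_on_def)
    finally have "(\<Sum>j\<in>F. cmod (g j) powr p)
        \<le> C powr p * real M powr p * (real M * lp_norm p f powr p)"
      by (simp add: mult_left_mono)
    \<comment> \<open>A natural number satisfies M <= M^p, also when it is 0; this brings the
      counting factor under the p-th power.\<close>
    also have "\<dots> \<le> C powr p * real M powr p * (real M powr p * lp_norm p f powr p)"
    proof (intro mult_left_mono mult_right_mono)
      show "real M \<le> real M powr p"
        using powr_mono[of 1 p "real M"] p by (cases "M = 0") auto
    qed auto
    also have "\<dots> = (C * real M ^ 2 * lp_norm p f) powr p"
      using C by (simp add: powr_mult power2_eq_square mult_ac)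
    finally show ?thesis .
  qed
  have K: "0 \<le> C * real M ^ 2 * lp_norm p f" using C by simp
  show "g \<in> Lp p" "lp_norm p g \<le> C * real M ^ 2 * lp_norm p f"
    by (rule LpI[OF p K *] lp_norm_leI[OF p K *]; assumption)+
qed

lemma bounded_geometryD:
  assumes "bounded_geometry TYPE('x::metric_space)"
  obtains M where "\<And>x :: 'x. ball_bound R M x"
proof (cases "0 \<le> R")
  case True
  then obtain M where "\<forall>x::'x. card (cball x R) \<le> M"
    using assms by (auto simp: bounded_geometry_def bdd_above_def)
  then show ?thesis using that[of M] assms True by (auto simp: bounded_geometry_def)
next
  case False
  \<comment> \<open>Balls of negative radius are empty.\<close>
  then show ?thesis using that[of 0] by simp
qed

section \<open>Fibres of X x N, and the vector-valued space as l^p(X x N)\<close>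

definition emb :: "'x \<Rightarrow> nat fn \<Rightarrow> ('x \<times> nat) fn" where
  "emb x v = (\<lambda>(z, m). if z = x then v m else 0)"

definition slice :: "'x \<Rightarrow> ('x \<times> nat) fn \<Rightarrow> nat fn" where
  "slice x f = (\<lambda>n. f (x, n))"

lemma emb_has_sum_iff:
  "((\<lambda>i. cmod (emb x v i) powr p) has_sum s) UNIV \<longleftrightarrow> ((\<lambda>n. cmod (v n) powr p) has_sum s) UNIV"
proof -
  have "((\<lambda>i. cmod (emb x v i) powr p) has_sum s) UNIV
      \<longleftrightarrow> ((\<lambda>i. cmod (emb x v i) powr p) has_sum s) (range (Pair x))"
    by (rule has_sum_cong_neutral) (auto simp: emb_def)
  also have "\<dots> \<longleftrightarrow> (((\<lambda>i. cmod (emb x v i) powr p) \<circ> Pair x) has_sum s) UNIV"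
    by (rule has_sum_reindex) (simp add: inj_on_def)
  also have "((\<lambda>i. cmod (emb x v i) powr p) \<circ> Pair x) = (\<lambda>n. cmod (v n) powr p)"
    by (auto simp: emb_def)
  finally show ?thesis .
qed

lemma emb_Lp_iff [simp]: "emb x v \<in> Lp p \<longleftrightarrow> v \<in> Lp p"
  by (simp add: Lp_iff summable_on_def emb_has_sum_iff)

lemma lp_norm_emb [simp]: "lp_norm p (emb x v) = lp_norm p v"
proof -
  have "(\<Sum>\<^sub>\<infinity>i. cmod (emb x v i) powr p) = (\<Sum>\<^sub>\<infinity>n. cmod (v n) powr p)"
  proof (cases "v \<in> Lp p")
    case True
    then have "((\<lambda>n. cmod (v n) powr p) has_sum (\<Sum>\<^sub>\<infinity>n. cmod (v n) powr p)) UNIV"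
      unfolding Lp_iff by (rule has_sum_infsum)
    then show ?thesis by (intro infsumI emb_has_sum_iff[THEN iffD2])
  next
    case False
    moreover have "emb x v \<notin> Lp p" using False by simp
    ultimately show ?thesis unfolding Lp_iff by (simp add: infsum_not_exists)
  qed
  then show ?thesis by (simp add: lp_norm_def)
qed

lemma restr_eq_emb_slice: "restr (fst -` {x}) f = emb x (slice x f)"
  by (auto simp: restr_def emb_def slice_def fun_eq_iff)

lemma slice_emb [simp]: "slice x (emb x v) = v"
  by (auto simp: emb_def slice_def)

lemma slice_Lp: "1 \<le> p \<Longrightarrow> f \<in> Lp p \<Longrightarrow> slice x f \<in> Lp p"
  by (metis Lp_restr emb_Lp_iff restr_eq_emb_slice)

lemma lp_norm_slice_le: "1 \<le> p \<Longrightarrow> f \<in> Lp p \<Longrightarrow> lp_norm p (slice x f) \<le> lp_norm p f"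
  by (metis lp_norm_emb lp_norm_restr restr_eq_emb_slice)

lemma slice_add: "slice x (f + g) = slice x f + slice x g"
  and slice_scale: "slice x (fscale c f) = fscale c (slice x f)"
  and emb_add: "emb x (v + w) = emb x v + emb x w"
  and emb_scale: "emb x (fscale c v) = fscale c (emb x v)"
  and emb_0 [simp]: "emb x 0 = 0"
  and emb_basis_fn: "emb x (basis_fn n) = basis_fn (x, n)"
  by (auto simp: slice_def emb_def fscale_def basis_fn_def fun_eq_iff)

text \<open>Fubini for nonnegative double series. The norms are compared on the carrier only: off
  it, a divergent slice counts as 0 in \<open>lp_sum_norm\<close> while the other slices still
  contribute, whereas \<open>lp_norm\<close> is 0.\<close>

lemma
  assumes p: "1 \<le> p"
  shows fst_lp_sum: "fst (lp_sum p) = (Lp p :: ('x \<times> nat) fn set)"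
    and snd_lp_sum: "\<And>f :: ('x \<times> nat) fn. f \<in> Lp p \<Longrightarrow> snd (lp_sum p) f = lp_norm p f"
proof -
  have sl: "lp_norm p (\<lambda>n. f (x, n)) powr p = (\<Sum>\<^sub>\<infinity>n. cmod (f (x, n)) powr p)" for f :: "('x \<times> nat) fn" and x
    by (rule lp_norm_powr[OF p])
  show car: "fst (lp_sum p) = (Lp p :: ('x \<times> nat) fn set)"
  proof (intro set_eqI iffI)
    fix f :: "('x \<times> nat) fn" assume L: "f \<in> Lp p"
    then have "(\<lambda>(x, n). cmod (f (x, n)) powr p) summable_on UNIV \<times> UNIV"
      by (simp add: Lp_iff case_prod_unfold)
    from summable_on_Sigma_banach[OF this] show "f \<in> fst (lp_sum p)"
      using slice_Lp[OF p L] by (simp add: sl slice_def lp_sum_def)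
  next
    fix f :: "('x \<times> nat) fn" assume R: "f \<in> fst (lp_sum p)"
    have "(\<lambda>i. cmod (f i) powr p) summable_on UNIV \<times> UNIV"
      by (rule summable_on_SigmaI[where g = "\<lambda>x. lp_norm p (\<lambda>n. f (x, n)) powr p"])
        (use R in \<open>auto simp: sl Lp_iff lp_sum_def intro: has_sum_infsum\<close>)
    then show "f \<in> Lp p" by (simp add: Lp_iff)
  qed
  fix f :: "('x \<times> nat) fn" assume "f \<in> Lp p"
  then have "(\<lambda>(x, n). cmod (f (x, n)) powr p) summable_on UNIV \<times> UNIV"
    by (simp add: Lp_iff case_prod_unfold)
  from infsum_Sigma'_banach[OF this] show "snd (lp_sum p) f = lp_norm p f"
    by (simp add: lp_sum_def lp_sum_norm_def sl lp_norm_def[of p f] case_prod_unfold)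
qed

lemma bounded_ops_cong:
  assumes "fst E = fst E'" "fst F = fst F'"
    and "\<And>f. f \<in> fst E' \<Longrightarrow> snd E f = snd E' f" "\<And>f. f \<in> fst F' \<Longrightarrow> snd F f = snd F' f"
  shows "bounded_ops E F = bounded_ops E' F'"
  unfolding bounded_ops_def using assms by (simp cong: conj_cong)

lemma op_norm_cong:
  assumes "fst E = fst E'" "fst F = fst F'"
    and "\<And>f. f \<in> fst E' \<Longrightarrow> snd E f = snd E' f" "\<And>f. f \<in> fst F' \<Longrightarrow> snd F f = snd F' f"
    and "\<And>f. f \<in> fst E' \<Longrightarrow> T f \<in> fst F'"
  shows "op_norm E F T = op_norm E' F' T"
  unfolding op_norm_def using assms by simp

section \<open>Matrices as operators of finite propagation\<close>


text \<open>The common frame for scalar, column and row matrices. For x and y within distance R the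
  piece \<open>K x y\<close> depends only on the fibre over y, by \<open>bound\<close> and
  linearity, and it is read only at points over x. Boundedness is the Schur test; finite propagation
  holds because a piece vanishes with its fibre.\<close>

lemma kernel_fprop:
  fixes \<pi> :: "'i \<Rightarrow> 'x::metric_space" and \<sigma> :: "'j \<Rightarrow> 'x" and T :: "('i, 'j) opr"
  assumes p: "1 \<le> p" and ball: "\<And>x :: 'x. ball_bound R M x"
    and C: "0 \<le> C"
    and outside: "\<And>f. f \<notin> Lp p \<Longrightarrow> T f = 0"
    and T: "\<And>f j. f \<in> Lp p \<Longrightarrow> T f j = (\<Sum>y\<in>cball (\<sigma> j) R. K (\<sigma> j) y f j)"
    and add: "\<And>x y f g. f \<in> Lp p \<Longrightarrow> g \<in> Lp p \<Longrightarrow> K x y (f + g) = K x y f + K x y g"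
    and scale: "\<And>x y c f. f \<in> Lp p \<Longrightarrow> K x y (fscale c f) = fscale c (K x y f)"
    and K: "\<And>x y f. f \<in> Lp p \<Longrightarrow> K x y f \<in> Lp p"
    and bound: "\<And>x y f. f \<in> Lp p \<Longrightarrow> dist x y \<le> R \<Longrightarrow>
      lp_norm p (K x y f) \<le> C * lp_norm p (restr (\<pi> -` {y}) f)"
  shows "T \<in> fprop p \<pi> \<sigma> R"
proof -
  have re: "restr (\<sigma> -` {x}) (T f) = (\<Sum>y\<in>cball x R. restr (\<sigma> -` {x}) (K x y f))" if "f \<in> Lp p" for f x
    using T[OF that] by (auto simp: fun_eq_iff restr_def sum_fn_apply)
  have r1: "restr (\<sigma> -` {x}) (T f) \<in> Lp p" if f: "f \<in> Lp p" for f x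
    unfolding re[OF f] by (intro Lp_sum Lp_restr p K f)
  have r2: "lp_norm p (restr (\<sigma> -` {x}) (T f)) \<le> C * (\<Sum>y\<in>cball x R. lp_norm p (restr (\<pi> -` {y}) f))"
    if f: "f \<in> Lp p" for f x
  proof -
    have "lp_norm p (restr (\<sigma> -` {x}) (T f)) \<le> (\<Sum>y\<in>cball x R. lp_norm p (restr (\<sigma> -` {x}) (K x y f)))"
      unfolding re[OF f] by (intro lp_norm_sum Lp_restr p K f)
    also have "\<dots> \<le> (\<Sum>y\<in>cball x R. C * lp_norm p (restr (\<pi> -` {y}) f))"
      by (intro sum_mono order_trans[OF lp_norm_restr[OF p K[OF f]] bound[OF f]]) auto
    finally show ?thesis by (simp add: sum_distrib_left)
  qed
  note 1 = Schur_Lp[OF p ball _ C r1 r2] and 2 = Schur_lp_norm_le[OF p ball _ C r1 r2]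
  have b: "T \<in> bops p"
  proof (rule bopsI[OF outside 1 _ _ 2])
    fix f g :: "'i fn" assume f: "f \<in> Lp p" and g: "g \<in> Lp p"
    show "T (f + g) = T f + T g"
      using T[OF f] T[OF g] T[OF Lp_add[OF p f g]] add[OF f g] by (simp add: fun_eq_iff sum.distrib)
  next
    fix c and f :: "'i fn" assume f: "f \<in> Lp p"
    show "T (fscale c f) = fscale c (T f)"
      using T[OF f] T[OF Lp_scale[OF p f]] scale[OF f]
      by (simp add: fun_eq_iff fscale_def sum_distrib_left)
  qed
  show "T \<in> fprop p \<pi> \<sigma> R"
  proof (rule fpropI[OF b])
    fix g j assume g: "g \<in> Lp p" and far: "\<And>i. g i \<noteq> 0 \<Longrightarrow> R < dist (\<sigma> j) (\<pi> i)"
    have "K (\<sigma> j) y g j = 0" if y: "y \<in> cball (\<sigma> j) R" for y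
    proof -
      have "g i = 0" if "\<pi> i = y" for i
        using far[of i] that y by (cases "g i = 0") auto
      then have "restr (\<pi> -` {y}) g = 0" by (simp add: restr_def fun_eq_iff)
      then have "lp_norm p (K (\<sigma> j) y g) \<le> 0" using bound[OF g, of "\<sigma> j" y] y by simp
      then show ?thesis
        using cmod_le_lp_norm[OF p K[OF g, of "\<sigma> j" y], of j] by (simp add: norm_le_zero_iff[symmetric] del: norm_le_zero_iff)
    qed
    then show "T g j = 0" by (simp add: T[OF g])
  qed
qed

lemma restr_singleton: "restr {y} f = fscale (f y) (basis_fn y)"
  by (auto simp: restr_def fscale_def basis_fn_def)

lemma restr_id: "restr (id -` {y}) f = fscale (f y) (basis_fn y)"
  by (simp add: restr_singleton)

lemma lp_norm_restr_id: "1 \<le> p \<Longrightarrow> lp_norm p (restr (id -` {y}) f) = cmod (f y)"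
  by (simp only: restr_id lp_norm_scale lp_norm_basis_fn mult_1_right)

lemma infsum_eq_sum_cball:
  fixes h :: "'x::metric_space \<Rightarrow> complex"
  assumes "finite (cball x R)" "\<And>y. R < dist x y \<Longrightarrow> h y = 0"
  shows "(\<Sum>\<^sub>\<infinity>y. h y) = (\<Sum>y\<in>cball x R. h y)"
proof -
  have "(\<Sum>\<^sub>\<infinity>y. h y) = (\<Sum>\<^sub>\<infinity>y\<in>cball x R. h y)"
    by (rule infsum_cong_neutral) (use assms in auto)
  then show ?thesis using assms by simp
qed

lemma finite_propagationE:
  fixes k :: "'x::metric_space \<Rightarrow> 'x \<Rightarrow> 'v::zero"
  assumes "finite_propagation k"
  obtains R where "\<And>x y. R < dist x y \<Longrightarrow> k x y = 0"
proof -
  obtain R where "\<And>d. d \<in> {dist x y | x y. k x y \<noteq> 0} \<Longrightarrow> d \<le> R"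
    using assms by (auto simp: finite_propagation_def bdd_above_def)
  then have *: "dist x y \<le> R" if "k x y \<noteq> 0" for x y using that by blast
  show ?thesis
  proof (rule that[of R])
    fix x y :: 'x assume "R < dist x y"
    then show "k x y = 0" using *[of x y] by (cases "k x y = 0") auto
  qed
qed

lemma finite_propagationI:
  assumes "\<And>x y. R < dist x y \<Longrightarrow> k x y = 0"
  shows "finite_propagation k"
  unfolding finite_propagation_def
proof (rule bdd_aboveI[of _ R])
  fix d assume "d \<in> {dist x y | x y. k x y \<noteq> 0}"
  then obtain x y where "d = dist x y" "k x y \<noteq> 0" by blast
  then show "d \<le> R" using assms[of x y] by (cases "d \<le> R") auto
qed

lemma scalar_op_fprop:
  fixes k :: "'x::metric_space \<Rightarrow> 'x \<Rightarrow> complex"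
  assumes p: "1 \<le> p" and ball: "\<And>x :: 'x. ball_bound R M x"
    and k: "\<And>x y. R < dist x y \<Longrightarrow> k x y = 0" "\<And>x y. cmod (k x y) \<le> C"
  shows "scalar_op p k \<in> fprop p id id R"
proof -
  have C: "0 \<le> C" using k(2) norm_ge_zero order_trans by blast
  have 1: "scalar_op p k f = 0" if "f \<notin> Lp p" for f
    using that by (simp add: scalar_op_def)
  have 2: "scalar_op p k f j = (\<Sum>y\<in>cball (id j) R. fscale (k (id j) y * f y) (basis_fn (id j)) j)"
    if f: "f \<in> Lp p" for f :: "'x fn" and j
  proof -
    have "scalar_op p k f j = (\<Sum>y\<in>cball j R. k j y * f y)"
      using f ball k(1) by (simp add: scalar_op_def infsum_eq_sum_cball)
    then show ?thesis by (simp add: fscale_def basis_fn_def)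
  qed
  have 3: "fscale (k x y * (f + g) y) (basis_fn x) = fscale (k x y * f y) (basis_fn x) + fscale (k x y * g y) (basis_fn x)"
    for f g and x y by (simp add: fscale_def fun_eq_iff algebra_simps)
  have 4: "fscale (k x y * fscale c f y) (basis_fn x) = fscale c (fscale (k x y * f y) (basis_fn x))"
    for c f and x y by (simp add: fscale_def fun_eq_iff)
  have 5: "fscale (k x y * f y) (basis_fn x) \<in> Lp p" for f x y
    by (intro Lp_scale Lp_basis_fn p)
  have 6: "lp_norm p (fscale (k x y * f y) (basis_fn x)) \<le> C * lp_norm p (restr (id -` {y}) f)"
    for f and x y
  proof -
    have "cmod (k x y * f y) \<le> C * cmod (f y)"
      using k(2) by (simp add: norm_mult mult_right_mono)
    then show ?thesis
      by (simp only: lp_norm_scale[OF p] lp_norm_restr_id[OF p] lp_norm_basis_fn[OF p] mult_1_right)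
  qed
  show ?thesis by (rule kernel_fprop[where T = "scalar_op p k" and C = C and M = M and R = R and \<pi> = id and \<sigma> = id and K = "\<lambda>x y f. fscale (k x y * f y) (basis_fn x)"])
      (assumption | rule p ball C 1 2 3 4 5 6)+
qed

lemma
  fixes k :: "'x::metric_space \<Rightarrow> 'x \<Rightarrow> nat fn"
  assumes p: "1 \<le> p" and ball: "\<And>x :: 'x. ball_bound R M x"
    and k: "\<And>x y. R < dist x y \<Longrightarrow> k x y = 0" "\<And>x y. k x y \<in> Lp p" "\<And>x y. lp_norm p (k x y) \<le> C"
  shows column_op_fprop: "column_op p k \<in> fprop p id fst R"
    and column_op_apply: "\<And>f x. f \<in> Lp p \<Longrightarrow>
      slice x (column_op p k f) = (\<Sum>y\<in>cball x R. fscale (f y) (k x y))"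
proof -
  have C: "0 \<le> C" using k(3) lp_norm_nonneg order_trans by blast
  have ap: "column_op p k f (x, n) = (\<Sum>y\<in>cball x R. k x y n * f y)" if "f \<in> Lp p" for f :: "'x fn" and x n
    using that ball k(1) by (simp add: column_op_def infsum_eq_sum_cball[of x R "\<lambda>y. k x y n * f y"])
  have 1: "column_op p k f = 0" if "f \<notin> Lp p" for f
    using that by (simp add: column_op_def)
  have 2: "column_op p k f j = (\<Sum>y\<in>cball (fst j) R. fscale (f y) (emb (fst j) (k (fst j) y)) j)"
    if "f \<in> Lp p" for f :: "'x fn" and j
    using ap[OF that] by (cases j) (simp add: fscale_def emb_def mult.commute)
  have 3: "fscale ((f + g) y) (emb x (k x y)) = fscale (f y) (emb x (k x y)) + fscale (g y) (emb x (k x y))"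
    for f g and x y by (simp add: fscale_def fun_eq_iff algebra_simps)
  have 4: "fscale (fscale c f y) (emb x (k x y)) = fscale c (fscale (f y) (emb x (k x y)))"
    for c f and x y by (simp add: fscale_def fun_eq_iff)
  have 5: "fscale (f y) (emb x (k x y)) \<in> Lp p" for f x y
    by (intro Lp_scale p) (simp add: k)
  have 6: "lp_norm p (fscale (f y) (emb x (k x y))) \<le> C * lp_norm p (restr (id -` {y}) f)" for f x y
    unfolding lp_norm_scale[OF p] lp_norm_restr_id[OF p] lp_norm_emb mult.commute[of C]
    by (intro mult_left_mono k(3)) simp
  show "column_op p k \<in> fprop p id fst R"
    by (rule kernel_fprop[where T = "column_op p k" and C = C and M = M and R = R and \<pi> = id and \<sigma> = fst and K = "\<lambda>x y f. fscale (f y) (emb x (k x y))"])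
      (assumption | rule p ball C 1 2 3 4 5 6)+
  fix f :: "'x fn" and x assume "f \<in> Lp p"
  then show "slice x (column_op p k f) = (\<Sum>y\<in>cball x R. fscale (f y) (k x y))"
    using ap by (simp add: fun_eq_iff slice_def sum_fn_apply fscale_def mult.commute)
qed

lemma
  fixes k :: "'x::metric_space \<Rightarrow> 'x \<Rightarrow> nat fn"
  assumes p: "1 \<le> p" and ball: "\<And>x :: 'x. ball_bound R M x"
    and k: "\<And>x y. R < dist x y \<Longrightarrow> k x y = 0" "\<And>x y. k x y \<in> Lq p" "\<And>x y. lq_norm p (k x y) \<le> C"
  shows row_op_fprop: "row_op p k \<in> fprop p fst id R"
    and row_op_apply: "\<And>f x. f \<in> Lp p \<Longrightarrow>
      row_op p k f x = (\<Sum>y\<in>cball x R. pairing (k x y) (slice y f))"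
proof -
  have C: "0 \<le> C" using k(2,3) lq_norm_nonneg[OF p] order_trans by blast
  have ap: "row_op p k f x = (\<Sum>y\<in>cball x R. pairing (k x y) (slice y f))"
    if "f \<in> Lp p" for f :: "('x \<times> nat) fn" and x
  proof -
    have "row_op p k f x = (\<Sum>\<^sub>\<infinity>y. pairing (k x y) (slice y f))"
      using that by (simp add: row_op_def pairing_def slice_def fst_lp_sum[OF p])
    also have "\<dots> = (\<Sum>y\<in>cball x R. pairing (k x y) (slice y f))"
      by (rule infsum_eq_sum_cball) (use ball k(1) in \<open>auto simp: pairing_def\<close>)
    finally show ?thesis .
  qed
  then show "\<And>f x. f \<in> Lp p \<Longrightarrow>
      row_op p k f x = (\<Sum>y\<in>cball x R. pairing (k x y) (slice y f))" .
  have 1: "row_op p k f = 0" if "f \<notin> Lp p" for f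
    using that by (simp add: row_op_def fst_lp_sum[OF p])
  have 2: "row_op p k f j = (\<Sum>y\<in>cball (id j) R. fscale (pairing (k (id j) y) (slice y f)) (basis_fn (id j)) j)"
    if "f \<in> Lp p" for f :: "('x \<times> nat) fn" and j
    using ap[OF that] by (simp add: fscale_def basis_fn_def)
  have 3: "fscale (pairing (k x y) (slice y (f + g))) (basis_fn x)
      = fscale (pairing (k x y) (slice y f)) (basis_fn x) + fscale (pairing (k x y) (slice y g)) (basis_fn x)"
    if "f \<in> Lp p" "g \<in> Lp p" for f g and x y
    using pairing_add[OF p k(2) slice_Lp[OF p that(1)] slice_Lp[OF p that(2)]]
    by (simp add: slice_add cfun.scale_left_distrib)
  have 4: "fscale (pairing (k x y) (slice y (fscale c f))) (basis_fn x)
      = fscale c (fscale (pairing (k x y) (slice y f)) (basis_fn x))" for c f and x y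
    by (simp add: slice_scale pairing_scale)
  have 5: "fscale (pairing (k x y) (slice y f)) (basis_fn x) \<in> Lp p" for f x y
    by (intro Lp_scale Lp_basis_fn p)
  have 6: "lp_norm p (fscale (pairing (k x y) (slice y f)) (basis_fn x)) \<le> C * lp_norm p (restr (fst -` {y}) f)"
    if f: "f \<in> Lp p" for f x y
  proof -
    have "cmod (pairing (k x y) (slice y f)) \<le> lq_norm p (k x y) * lp_norm p (slice y f)"
      by (rule norm_pairing_le[OF p k(2) slice_Lp[OF p f]])
    also have "\<dots> \<le> C * lp_norm p (slice y f)"
      by (intro mult_right_mono k(3)) simp
    finally show ?thesis
      by (simp only: lp_norm_scale[OF p] lp_norm_basis_fn[OF p] restr_eq_emb_slice lp_norm_emb mult_1_right)
  qed
  show "row_op p k \<in> fprop p fst id R"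
    by (rule kernel_fprop[where T = "row_op p k" and C = C and M = M and R = R and \<pi> = fst and \<sigma> = id and K = "\<lambda>x y f. fscale (pairing (k x y) (slice y f)) (basis_fn x)"])
      (assumption | rule p ball C 1 2 3 4 5 6)+
qed

text \<open>Trades entries for propagation, which composes by the triangle inequality alone.
  Conversely, the matrix is read off the basis vectors, and its entries are bounded by the norm of
  the operator.\<close>

lemma Cu_eq:
  assumes bg: "bounded_geometry TYPE('x::metric_space)" and p: "1 \<le> p"
  shows "(Cu p :: ('x, 'x) opr set) = (\<Union>R. fprop p id id R)"
proof (intro set_eqI iffI)
  fix T :: "('x, 'x) opr" assume "T \<in> Cu p"
  then obtain k where T: "T = scalar_op p k" and fp: "finite_propagation k"
    and "bdd_above (range (\<lambda>(x, y). cmod (k x y)))" by (auto simp: Cu_def)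
  then obtain C where C: "\<And>x y. cmod (k x y) \<le> C" by (auto simp: bdd_above_def)
  obtain R where R: "\<And>x y. R < dist x y \<Longrightarrow> k x y = 0" using finite_propagationE[OF fp] by blast
  obtain M where M: "\<And>x :: 'x. ball_bound R M x"
    using bounded_geometryD[OF bg] by blast
  show "T \<in> (\<Union>R. fprop p id id R)"
    unfolding T by (intro UN_I[of R] UNIV_I scalar_op_fprop[OF p M R C])
next
  fix T :: "('x, 'x) opr" assume "T \<in> (\<Union>R. fprop p id id R)"
  then obtain R where T: "T \<in> fprop p id id R" by blast
  define k where "k x y = T (basis_fn y) x" for x y
  have fp: "finite_propagation k"
    by (rule finite_propagationI[of R], unfold k_def, rule fprop_zero[OF T Lp_basis_fn[OF p]])
      (auto simp: basis_fn_def split: if_splits)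
  have "cmod (k x y) \<le> onorm_lp p T" for x y
    unfolding k_def
    using cmod_le_lp_norm[OF p bops_Lp[OF fprop_bops[OF T]], of "basis_fn y" x]
      onorm_lp_bound[OF fprop_bops[OF T], of "basis_fn y"] p by simp
  then have bd: "bdd_above (range (\<lambda>(x, y). cmod (k x y)))"
    by (auto intro!: bdd_aboveI[where M = "onorm_lp p T"])
  have fin: "finite (cball x R)" for x :: 'x using bounded_geometryD[OF bg] by metis
  have "T f x = scalar_op p k f x" for f x
  proof (cases "f \<in> Lp p")
    case True
    have "T f x = (\<Sum>y\<in>cball x R. T (restr (id -` {y}) f) x)"
      using fprop_expand[OF p T True, of x] fin by simp
    also have "\<dots> = (\<Sum>y\<in>cball x R. k x y * f y)"
      by (simp add: restr_singleton bops_scale[OF fprop_bops[OF T] Lp_basis_fn[OF p]])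
        (simp add: k_def fscale_def mult.commute)
    also have "\<dots> = (\<Sum>\<^sub>\<infinity>y. k x y * f y)"
    proof (rule infsum_eq_sum_cball[symmetric, OF fin])
      fix y assume "R < dist x y"
      then have "k x y = 0"
        unfolding k_def by (intro fprop_zero[OF T Lp_basis_fn[OF p]]) (auto simp: basis_fn_def split: if_splits)
      then show "k x y * f y = 0" by simp
    qed
    finally show ?thesis using True by (simp add: scalar_op_def)
  qed (use bops_outside[OF fprop_bops[OF T]] in \<open>auto simp: scalar_op_def\<close>)
  then have "T = scalar_op p k" by (simp add: fun_eq_iff)
  then show "T \<in> Cu p" using fp bd by (auto simp: Cu_def)
qed

lemma Egt_algE:
  fixes T :: "('x::metric_space, 'x \<times> nat) opr"
  assumes bg: "bounded_geometry TYPE('x)" and T: "T \<in> Egt_alg p"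
  obtains k R M C where "T = column_op p k" "\<And>x :: 'x. ball_bound R M x"
    "\<And>x y. R < dist x y \<Longrightarrow> k x y = 0" "\<And>x y. k x y \<in> Lp p" "\<And>x y. lp_norm p (k x y) \<le> C"
proof -
  obtain k where k: "T = column_op p k" "finite_propagation k" and be: "bounded_entries (lp p) k"
    using T by (auto simp: Egt_alg_def)
  then obtain C where "\<And>x y. lp_norm p (k x y) \<le> C"
    by (auto simp: bounded_entries_def bdd_above_def)
  moreover have "\<And>x y. k x y \<in> Lp p" using be by (simp add: bounded_entries_def)
  moreover obtain R where "\<And>x y. R < dist x y \<Longrightarrow> k x y = 0" using finite_propagationE[OF k(2)] by blast
  moreover obtain M where "\<And>x :: 'x. ball_bound R M x"
    using bounded_geometryD[OF bg] by blast
  ultimately show ?thesis using that[of k R M C] k(1) by blast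
qed

lemma Egt_alg_eq:
  assumes bg: "bounded_geometry TYPE('x::metric_space)" and p: "1 \<le> p"
  shows "(Egt_alg p :: ('x, 'x \<times> nat) opr set) = (\<Union>R. fprop p id fst R)"
proof (intro set_eqI iffI)
  fix T :: "('x, 'x \<times> nat) opr" assume "T \<in> Egt_alg p"
  then obtain k R M C where T: "T = column_op p k"
    and M: "\<And>x :: 'x. ball_bound R M x"
    and R: "\<And>x y. R < dist x y \<Longrightarrow> k x y = 0" and k: "\<And>x y. k x y \<in> Lp p" and C: "\<And>x y. lp_norm p (k x y) \<le> C"
    using Egt_algE[OF bg] by blast
  show "T \<in> (\<Union>R. fprop p id fst R)"
    unfolding T by (intro UN_I[of R] UNIV_I column_op_fprop[OF p M R k C])
next
  fix T :: "('x, 'x \<times> nat) opr" assume "T \<in> (\<Union>R. fprop p id fst R)"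
  then obtain R where T: "T \<in> fprop p id fst R" by blast
  note Tb = fprop_bops[OF T]
  define k where "k x y = slice x (T (basis_fn y))" for x y
  have k0: "k x y = 0" if "R < dist x y" for x y
  proof
    fix n
    show "k x y n = 0 n" unfolding k_def slice_def zero_fun_apply
      by (rule fprop_zero[OF T Lp_basis_fn[OF p]]) (use that in \<open>auto simp: basis_fn_def split: if_splits\<close>)
  qed
  have fp: "finite_propagation k" by (rule finite_propagationI[OF k0])
  have kL: "k x y \<in> Lp p" for x y unfolding k_def by (intro slice_Lp p bops_Lp[OF Tb])
  have "lp_norm p (k x y) \<le> onorm_lp p T" for x y
    unfolding k_def
    using lp_norm_slice_le[OF p bops_Lp[OF Tb], of x "basis_fn y"]
      onorm_lp_bound[OF Tb, of "basis_fn y"] p by simp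
  then have be: "bounded_entries (lp p) k"
    using kL by (auto simp: bounded_entries_def intro!: bdd_aboveI[where M = "onorm_lp p T"])
  have fin: "finite (cball x R)" for x :: 'x using bounded_geometryD[OF bg] by metis
  have "T f (x, n) = column_op p k f (x, n)" for f x n
  proof (cases "f \<in> Lp p")
    case True
    have "T f (x, n) = (\<Sum>y\<in>cball x R. T (restr (id -` {y}) f) (x, n))"
      using fprop_expand[OF p T True, of "(x, n)"] fin by simp
    also have "\<dots> = (\<Sum>y\<in>cball x R. k x y n * f y)"
      by (simp add: restr_singleton bops_scale[OF Tb Lp_basis_fn[OF p]])
        (simp add: k_def slice_def fscale_def mult.commute)
    also have "\<dots> = (\<Sum>\<^sub>\<infinity>y. k x y n * f y)"
      by (rule infsum_eq_sum_cball[symmetric, OF fin]) (simp add: k0)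
    finally show ?thesis using True by (simp add: column_op_def)
  qed (use bops_outside[OF Tb] in \<open>auto simp: column_op_def\<close>)
  then have "T = column_op p k" by (simp add: fun_eq_iff split_paired_all)
  then show "T \<in> Egt_alg p" using fp be by (auto simp: Egt_alg_def)
qed

text \<open>An entry of a row operator is at first only a functional on l^p; \<open>Riesz_lp\<close>
  turns it into an l^q vector of norm at most that of the operator, which is the uniform
  bound.\<close>

lemma Elt_alg_eq:
  assumes bg: "bounded_geometry TYPE('x::metric_space)" and p: "1 \<le> p"
  shows "(Elt_alg p :: ('x \<times> nat, 'x) opr set) = (\<Union>R. fprop p fst id R)"
proof (intro set_eqI iffI)
  fix T :: "('x \<times> nat, 'x) opr" assume "T \<in> Elt_alg p"
  then obtain k where T: "T = row_op p k" and fp: "finite_propagation k"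
    and be: "bounded_entries (lp_conj p) k" by (auto simp: Elt_alg_def)
  then obtain C where C: "\<And>x y. lq_norm p (k x y) \<le> C"
    by (auto simp: bounded_entries_def bdd_above_def)
  have k: "\<And>x y. k x y \<in> Lq p" using be by (simp add: bounded_entries_def)
  obtain R where R: "\<And>x y. R < dist x y \<Longrightarrow> k x y = 0" using finite_propagationE[OF fp] by blast
  obtain M where M: "\<And>x :: 'x. ball_bound R M x"
    using bounded_geometryD[OF bg] by blast
  show "T \<in> (\<Union>R. fprop p fst id R)"
    unfolding T by (intro UN_I[of R] UNIV_I row_op_fprop[OF p M R k C])
next
  fix T :: "('x \<times> nat, 'x) opr" assume "T \<in> (\<Union>R. fprop p fst id R)"
  then obtain R where T: "T \<in> fprop p fst id R" by blast
  note Tb = fprop_bops[OF T]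
  define k where "k x y = (\<lambda>n. T (emb y (basis_fn n)) x)" for x y
  have k0: "k x y = 0" if "R < dist x y" for x y
  proof
    fix n
    show "k x y n = 0 n" unfolding k_def zero_fun_apply
      by (rule fprop_zero[OF T emb_Lp_iff[THEN iffD2, OF Lp_basis_fn[OF p]]])
        (use that in \<open>auto simp: emb_def split: if_splits\<close>)
  qed
  have fp: "finite_propagation k" by (rule finite_propagationI[OF k0])
  have 1: "T (emb y (f + g)) x = T (emb y f) x + T (emb y g) x" if "f \<in> Lp p" "g \<in> Lp p" for f g x y
    using bops_add[OF Tb, of "emb y f" "emb y g"] that by (simp add: emb_add)
  have 2: "T (emb y (fscale c f)) x = c * T (emb y f) x" if "f \<in> Lp p" for c f x y
    unfolding emb_scale bops_scale[OF Tb emb_Lp_iff[THEN iffD2, OF that]] by (simp add: fscale_def)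
  have 3: "cmod (T (emb y f) x) \<le> onorm_lp p T * lp_norm p f" if "f \<in> Lp p" for f x y
    using cmod_le_lp_norm[OF p bops_Lp[OF Tb], of "emb y f" x]
      onorm_lp_bound[OF Tb, of "emb y f"] that by simp
  have kL: "k x y \<in> Lq p" for x y
    unfolding k_def by (rule Riesz_lp(1)[OF p 1 2 3])
  have kn: "lq_norm p (k x y) \<le> onorm_lp p T" for x y
    unfolding k_def by (rule Riesz_lp(2)[OF p 1 2 3])
  have kp: "T (emb y f) x = pairing (k x y) f" if "f \<in> Lp p" for f x y
    unfolding k_def by (rule Riesz_lp(3)[OF p 1 2 3 that])
  have be: "bounded_entries (lp_conj p) k"
    using kL kn by (auto simp: bounded_entries_def intro!: bdd_aboveI[where M = "onorm_lp p T"])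
  obtain M where M: "\<And>x :: 'x. ball_bound R M x"
    using bounded_geometryD[OF bg] by blast
  have "T f x = row_op p k f x" for f x
  proof (cases "f \<in> Lp p")
    case True
    have "T f x = (\<Sum>y\<in>cball x R. T (restr (fst -` {y}) f) x)"
      using fprop_expand[OF p T True, of x] M by simp
    also have "\<dots> = row_op p k f x"
      by (simp add: restr_eq_emb_slice kp slice_Lp[OF p True] row_op_apply[OF p M k0 kL kn True])
    finally show ?thesis .
  qed (use bops_outside[OF Tb] in \<open>auto simp: row_op_def fst_lp_sum[OF p]\<close>)
  then have "T = row_op p k" by (simp add: fun_eq_iff)
  then show "T \<in> Elt_alg p" using fp be by (auto simp: Elt_alg_def)
qed

lemma block_eq: "block T x y v = slice x (T (emb y v))"
  by (simp add: block_def slice_def emb_def)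

text \<open>Spanning sets of bounded size can be united and mapped without returning to dimensions.
  A basis inside the range is finite, being independent in a finitely spanned space.\<close>

lemma op_rank_le_iff:
  "op_rank A \<le> enat N \<longleftrightarrow> (\<exists>V. finite V \<and> card V \<le> N \<and> range A \<subseteq> cfun.span V)"
proof
  assume L: "op_rank A \<le> enat N"
  then obtain W where W: "finite W" "range A \<subseteq> cfun.span W" and d: "cfun.dim (range A) \<le> N"
    by (auto simp: op_rank_def split: if_splits)
  obtain B where B: "B \<subseteq> range A" "cfun.independent B" "range A \<subseteq> cfun.span B" "card B = cfun.dim (range A)"
    using cfun.basis_exists by blast
  have "finite B" using cfun.independent_span_bound[OF W(1) B(2)] B(1) W(2) by blast
  then show "\<exists>V. finite V \<and> card V \<le> N \<and> range A \<subseteq> cfun.span V" using B d by auto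
next
  assume "\<exists>V. finite V \<and> card V \<le> N \<and> range A \<subseteq> cfun.span V"
  then obtain V where V: "finite V" "card V \<le> N" "range A \<subseteq> cfun.span V" by blast
  then have "cfun.dim (range A) \<le> N" using cfun.dim_le_card[OF V(3,1)] by linarith
  then show "op_rank A \<le> enat N" using V by (auto simp: op_rank_def)
qed

lemma UC_iff:
  fixes T :: "('x::metric_space \<times> nat, 'x \<times> nat) opr"
  assumes p: "1 \<le> p"
  shows "T \<in> UC p \<longleftrightarrow> (\<exists>R. T \<in> fprop p fst fst R) \<and>
    (\<exists>N. \<forall>x y. \<exists>V. finite V \<and> card V \<le> N \<and> range (block T x y) \<subseteq> cfun.span V)"
proof -
  have bo: "bounded_ops (lp_sum p) (lp_sum p) = (bops p :: ('x \<times> nat, 'x \<times> nat) opr set)"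
    by (rule bounded_ops_cong) (auto simp: fst_lp_sum[OF p] snd_lp_sum[OF p])
  have 1: "T \<in> bops p \<and> finite_propagation (block T) \<longleftrightarrow> (\<exists>R. T \<in> fprop p fst fst R)"
  proof
    assume L: "T \<in> bops p \<and> finite_propagation (block T)"
    then obtain R where R: "\<And>x y. R < dist x y \<Longrightarrow> block T x y = 0"
      using finite_propagationE by blast
    have "T \<in> fprop p fst fst R"
    proof (rule fpropI_basis[OF p])
      fix i j :: "'x \<times> nat" assume "R < dist (fst j) (fst i)"
      then have "block T (fst j) (fst i) (basis_fn (snd i)) (snd j) = 0" by (simp add: R)
      then show "T (basis_fn i) j = 0" by (simp add: block_eq slice_def emb_basis_fn)
    qed (use L in blast)
    then show "\<exists>R. T \<in> fprop p fst fst R" by blast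
  next
    assume "\<exists>R. T \<in> fprop p fst fst R"
    then obtain R where T: "T \<in> fprop p fst fst R" by blast
    have "block T x y = 0" if "R < dist x y" for x y
    proof (intro ext)
      fix v n
      have "T (emb y v) (x, n) = 0"
      \<comment> \<open>Equality of blocks as functions also concerns v outside l^p, where T takes
        its default value 0.\<close>
      proof (cases "emb y v \<in> Lp p")
        case True
        then show ?thesis
          by (rule fprop_zero[OF T]) (use that in \<open>auto simp: emb_def split: if_splits\<close>)
      qed (use bops_outside[OF fprop_bops[OF T]] in auto)
      then show "block T x y v n = 0 v n" by (simp add: block_eq slice_def)
    qed
    then show "T \<in> bops p \<and> finite_propagation (block T)"
      using fprop_bops[OF T] finite_propagationI[of R "block T"] by blast
  qed
  have 2: "(SUP (x, y). op_rank (block T x y)) < \<infinity> \<longleftrightarrow> (\<exists>N. \<forall>x y. op_rank (block T x y) \<le> enat N)"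
  proof
    assume "(SUP (x, y). op_rank (block T x y)) < \<infinity>"
    then obtain N where N: "(SUP (x, y). op_rank (block T x y)) = enat N" by auto
    have "op_rank (block T x y) \<le> enat N" for x y
      unfolding N[symmetric] by (rule SUP_upper2[of "(x, y)"]) auto
    then show "\<exists>N. \<forall>x y. op_rank (block T x y) \<le> enat N" by blast
  next
    assume "\<exists>N. \<forall>x y. op_rank (block T x y) \<le> enat N"
    then obtain N where N: "\<And>x y. op_rank (block T x y) \<le> enat N" by blast
    have "(SUP (x, y). op_rank (block T x y)) \<le> enat N"
      by (rule SUP_least) (use N in auto)
    then show "(SUP (x, y). op_rank (block T x y)) < \<infinity>"
      using order_le_less_trans by fastforce
  qed
  show ?thesis unfolding UC_def bo using 1 2 by (simp add: op_rank_le_iff) blast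
qed

section \<open>Uniform approximation in \<open>\<ell>\<^sup>p\<close>\<close>


definition rank_one_sum :: "nat \<Rightarrow> (nat \<Rightarrow> 'i fn) \<Rightarrow> (nat \<Rightarrow> 'i fn) \<Rightarrow> 'i fn \<Rightarrow> 'i fn" where
  "rank_one_sum r a w f = (\<Sum>s<r. fscale (pairing (a s) f) (w s))"

lemma rank_one_sum_Lp:
  assumes "1 \<le> p" "\<And>s. s < r \<Longrightarrow> w s \<in> Lp p"
  shows "rank_one_sum r a w f \<in> Lp p"
  unfolding rank_one_sum_def by (intro Lp_sum Lp_scale) (use assms in auto)

lemma rank_one_sum_add:
  assumes p: "1 \<le> p" and a: "\<And>s. s < r \<Longrightarrow> a s \<in> Lq p" and f: "f \<in> Lp p" and g: "g \<in> Lp p"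
  shows "rank_one_sum r a w (f + g) = rank_one_sum r a w f + rank_one_sum r a w g"
  unfolding rank_one_sum_def sum.distrib[symmetric] cfun.scale_left_distrib[symmetric]
  by (intro sum.cong refl arg_cong2[where f = fscale] pairing_add[OF p a f g]) auto

lemma rank_one_sum_scale: "rank_one_sum r a w (fscale c f) = fscale c (rank_one_sum r a w f)"
  unfolding rank_one_sum_def cfun.scale_sum_right by (simp add: pairing_scale)

lemma rank_one_sum_finite_sum:
  assumes p: "1 \<le> p" and a: "\<And>s. s < r \<Longrightarrow> a s \<in> Lq p" and f: "\<And>t. t \<in> A \<Longrightarrow> f t \<in> Lp p"
  shows "rank_one_sum r a w (\<Sum>t\<in>A. f t) = (\<Sum>t\<in>A. rank_one_sum r a w (f t))"
proof -
  have "rank_one_sum r a w (\<Sum>t\<in>A. f t) = (\<Sum>s<r. \<Sum>t\<in>A. fscale (pairing (a s) (f t)) (w s))"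
    unfolding rank_one_sum_def
    by (intro sum.cong refl) (simp add: pairing_finite_sum[OF p a f] cfun.scale_sum_left)
  also have "\<dots> = (\<Sum>t\<in>A. rank_one_sum r a w (f t))"
    unfolding rank_one_sum_def by (rule sum.swap)
  finally show ?thesis .
qed

text \<open>The images have disjoint supports, so the p-th powers of their norms add up, and each
  coefficient sees only the part of f on its own set \<open>S s\<close>.\<close>

lemma rank_one_sum_contractive:
  fixes w :: "nat \<Rightarrow> 'i fn"
  assumes p: "1 \<le> p"
    and w: "\<And>s. s < r \<Longrightarrow> w s \<in> Lp p" "\<And>s. s < r \<Longrightarrow> lp_norm p (w s) \<le> 1"
    and a: "\<And>s. s < r \<Longrightarrow> a s \<in> Lq p" "\<And>s. s < r \<Longrightarrow> lq_norm p (a s) \<le> 1"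
    and disj: "disjoint_family_on S {..<r}"
    and supp: "\<And>s i. s < r \<Longrightarrow> w s i \<noteq> 0 \<Longrightarrow> i \<in> S s" "\<And>s i. s < r \<Longrightarrow> a s i \<noteq> 0 \<Longrightarrow> i \<in> S s"
    and f: "f \<in> Lp p"
  shows "lp_norm p (rank_one_sum r a w f) \<le> lp_norm p f"
proof (rule lp_norm_leI[OF p])
  fix F :: "'i set" assume F: "finite F"
  let ?t = "\<lambda>s. pairing (a s) f"
  have single: "cmod (rank_one_sum r a w f i) powr p = (\<Sum>s<r. cmod (?t s) powr p * cmod (w s i) powr p)" for i
  proof (cases "\<exists>s<r. i \<in> S s")
    case True
    then obtain t where t: "t < r" "i \<in> S t" by blast
    have z: "w s i = 0" if "s < r" "s \<noteq> t" for s
      using supp(1)[OF that(1), of i] disj t that by (auto simp: disjoint_family_on_def)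
    have "rank_one_sum r a w f i = (\<Sum>s<r. if s = t then ?t t * w t i else 0)"
      unfolding rank_one_sum_def sum_fn_apply fscale_def by (intro sum.cong refl) (use z in auto)
    moreover have "(\<Sum>s<r. cmod (?t s) powr p * cmod (w s i) powr p)
        = (\<Sum>s<r. if s = t then cmod (?t t) powr p * cmod (w t i) powr p else 0)"
      by (intro sum.cong refl) (use z in auto)
    ultimately show ?thesis using t by (simp add: norm_mult powr_mult)
  next
    case False
    then have "w s i = 0" if "s < r" for s using supp(1)[OF that, of i] that by blast
    then show ?thesis by (simp add: rank_one_sum_def sum_fn_apply fscale_def)
  qed
  have tb: "cmod (?t s) \<le> lp_norm p (restr (S s) f)" if s: "s < r" for s
  proof -
    have "?t s = pairing (a s) (restr (S s) f)"
      by (rule pairing_cong) (use supp(2)[OF s] in \<open>auto simp: restr_def\<close>)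
    then have "cmod (?t s) \<le> lq_norm p (a s) * lp_norm p (restr (S s) f)"
      using norm_pairing_le[OF p a(1)[OF s] Lp_restr[OF p f]] by simp
    also have "\<dots> \<le> 1 * lp_norm p (restr (S s) f)"
      by (intro mult_right_mono a(2) s) simp
    finally show ?thesis by simp
  qed
  have "(\<Sum>i\<in>F. cmod (rank_one_sum r a w f i) powr p)
      = (\<Sum>s<r. cmod (?t s) powr p * (\<Sum>i\<in>F. cmod (w s i) powr p))"
    unfolding single sum_distrib_left by (rule sum.swap)
  also have "\<dots> \<le> (\<Sum>s<r. lp_norm p (restr (S s) f) powr p * 1)"
  proof (intro sum_mono mult_mono)
    fix s assume "s \<in> {..<r}"
    then have s: "s < r" by simp
    show "cmod (?t s) powr p \<le> lp_norm p (restr (S s) f) powr p"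
      using tb[OF s] p by (intro powr_mono2) auto
    have "(\<Sum>i\<in>F. cmod (w s i) powr p) \<le> lp_norm p (w s) powr p"
      by (rule sum_powr_le_lp_norm[OF p w(1)[OF s] F])
    also have "\<dots> \<le> 1 powr p" using w(2)[OF s] p by (intro powr_mono2) auto
    finally show "(\<Sum>i\<in>F. cmod (w s i) powr p) \<le> 1" by simp
  qed (auto intro: sum_nonneg)
  also have "\<dots> \<le> lp_norm p f powr p"
    using lp_norm_disjoint_le[OF p f _ disj] by simp
  finally show "(\<Sum>i\<in>F. cmod (rank_one_sum r a w f i) powr p) \<le> lp_norm p f powr p" .
qed simp

text \<open>Total boundedness of the disc: \<open>\<gamma> u\<close> is a centre from a finite net
  whose ball contains u.\<close>

lemma complex_disc_rounding:
  fixes e :: real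
  assumes "0 < e"
  obtains Z :: "complex set" and \<gamma> where "finite Z"
    "\<And>u. cmod u \<le> 1 \<Longrightarrow> \<gamma> u \<in> Z" "\<And>u. cmod u \<le> 1 \<Longrightarrow> cmod (u - \<gamma> u) \<le> e"
proof -
  obtain Z where Z: "finite Z" "cball (0::complex) 1 \<subseteq> (\<Union>z\<in>Z. ball z e)"
    using compact_cball[of "0::complex" 1] assms unfolding compact_eq_totally_bounded by metis
  have "\<exists>z. z \<in> Z \<and> cmod (u - z) \<le> e" if "cmod u \<le> 1" for u
  proof -
    have "u \<in> cball 0 1" using that by simp
    then obtain z where "z \<in> Z" "u \<in> ball z e" using Z(2) by blast
    then show ?thesis by (intro exI[of _ z]) (auto simp: dist_norm norm_minus_commute)
  qed
  then obtain \<gamma> where "\<And>u. cmod u \<le> 1 \<Longrightarrow> \<gamma> u \<in> Z \<and> cmod (u - \<gamma> u) \<le> e" by metis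
  then show ?thesis using that[of Z \<gamma>] Z(1) by blast
qed

text \<open>
  The vectors \<open>v\<^sub>i = W c\<^sub>i\<close>, with \<open>W = \<Sum>\<bar>v\<^sub>i\<bar>\<close>,
  are replaced by vectors \<open>W c'\<^sub>i\<close> for which \<open>c'\<^sub>i\<close> takes finitely many prescribed values.
\<close>

lemma uniform_approximation_property:
  fixes n :: nat and C e :: real
  assumes p: "1 \<le> p" and C: "0 \<le> C" and e: "0 < e"
  obtains r where "\<And>v :: nat \<Rightarrow> 'i fn. (\<And>i. i < n \<Longrightarrow> v i \<in> Lp p) \<Longrightarrow> (\<And>i. i < n \<Longrightarrow> lp_norm p (v i) \<le> C) \<Longrightarrow>
    \<exists>a w. (\<forall>s<r. a s \<in> Lq p \<and> lq_norm p (a s) \<le> 1 \<and> w s \<in> Lp p \<and> lp_norm p (w s) \<le> 1) \<and>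
      (\<forall>f\<in>Lp p. lp_norm p (rank_one_sum r a w f) \<le> lp_norm p f) \<and>
      (\<forall>i<n. lp_norm p (rank_one_sum r a w (v i) - v i) \<le> e)"
proof -
  \<comment> \<open>The final error is at most 2 d n C; the added 1 covers n C = 0.\<close>
  define d where "d = e / (2 * (real n * C) + 1)"
  have den: "0 < 2 * (real n * C) + 1" using C by (simp add: add_nonneg_pos)
  then have d: "0 < d" using e by (simp add: d_def)
  obtain Z and \<gamma> :: "complex \<Rightarrow> complex" where Z: "finite Z"
    and \<gamma>: "\<And>u. cmod u \<le> 1 \<Longrightarrow> \<gamma> u \<in> Z" "\<And>u. cmod u \<le> 1 \<Longrightarrow> cmod (u - \<gamma> u) \<le> d"
    using complex_disc_rounding[OF d] by metis
  \<comment> \<open>A code assigns a net point to each of the n indices. The number r of codes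
    depends on n, C and e only and is fixed before the vectors are given, so that later one r serves
    all points of X.\<close>
  define D where "D = PiE {..<n} (\<lambda>_. Z)"
  have D: "finite D" unfolding D_def by (intro finite_PiE Z) auto
  obtain h where h: "bij_betw h {0..<card D} D" using ex_bij_betw_nat_finite[OF D] by blast
  define r where "r = card D"
  show ?thesis
  proof (rule that[of r])
    fix v :: "nat \<Rightarrow> 'i fn"
    assume v: "\<And>i. i < n \<Longrightarrow> v i \<in> Lp p" "\<And>i. i < n \<Longrightarrow> lp_norm p (v i) \<le> C"
    define W :: "'i fn" where "W = (\<Sum>i<n. (\<lambda>k. of_real (cmod (v i k))))"
    have av: "(\<lambda>k. complex_of_real (cmod (v i k))) \<in> Lp p" "lp_norm p (\<lambda>k. complex_of_real (cmod (v i k))) \<le> C"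
      if "i < n" for i
      using Lp_dominated[OF p v(1)[OF that], of 1 "\<lambda>k. complex_of_real (cmod (v i k))"]
        lp_norm_dominated[OF p v(1)[OF that], of 1 "\<lambda>k. complex_of_real (cmod (v i k))"] v(2)[OF that]
      by auto
    have W: "W \<in> Lp p" unfolding W_def by (intro Lp_sum p av) auto
    have "lp_norm p W \<le> (\<Sum>i<n. lp_norm p (\<lambda>k. complex_of_real (cmod (v i k))))"
      unfolding W_def by (intro lp_norm_sum p av) auto
    also have "\<dots> \<le> (\<Sum>i<n. C)" by (intro sum_mono av) auto
    finally have nW: "lp_norm p W \<le> real n * C" by simp
    have Wk: "W k = of_real (\<Sum>i<n. cmod (v i k))" for k by (simp add: W_def sum_fn_apply)
    have cW: "cmod (W k) = (\<Sum>i<n. cmod (v i k))" for k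
      unfolding Wk norm_of_real by (intro abs_of_nonneg sum_nonneg) auto
    have vW: "cmod (v i k) \<le> cmod (W k)" if "i < n" for i k
      unfolding cW using that by (intro member_le_sum) auto
    \<comment> \<open>Where W vanishes so do all the vectors, and division by 0 gives 0.\<close>
    define c where "c i k = v i k / W k" for i k
    have c1: "cmod (c i k) \<le> 1" if "i < n" for i k
      using vW[OF that, of k] by (simp add: c_def norm_divide divide_le_eq_1)
    have vc: "v i k = W k * c i k" if "i < n" for i k
      using vW[OF that, of k] by (cases "W k = 0") (auto simp: c_def)
    \<comment> \<open>The sets \<open>S s\<close> collect the points with the same code; on each of
      them the rounded quotients are constant.\<close>
    define \<kappa> where "\<kappa> k = (\<lambda>i\<in>{..<n}. \<gamma> (c i k))" for k
    have \<kappa>: "\<kappa> k \<in> D" for k unfolding D_def \<kappa>_def using \<gamma>(1) c1 by auto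
    define S where "S s = {k. \<kappa> k = h s}" for s
    have disj: "disjoint_family_on S {..<r}"
      using h by (auto simp: disjoint_family_on_def S_def r_def bij_betw_def inj_on_def atLeast0LessThan)
    have cover: "\<exists>s<r. k \<in> S s" for k
    proof -
      have "\<kappa> k \<in> h ` {0..<card D}" using \<kappa> h by (simp add: bij_betw_def)
      then show ?thesis by (auto simp: S_def r_def)
    qed
    define N where "N s = lp_norm p (restr (S s) W)" for s
    \<comment> \<open>Normalised restrictions of W; for \<open>N s = 0\<close> the inverse is 0, and
      so is \<open>w s\<close>.\<close>
    define w where "w s = fscale (of_real (inverse (N s))) (restr (S s) W)" for s
    have rW: "restr (S s) W \<in> Lp p" for s using p W by simp
    have N0: "0 \<le> N s" for s by (simp add: N_def)
    have w1: "w s \<in> Lp p" for s unfolding w_def by (intro Lp_scale p rW)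
    have nw: "lp_norm p (w s) = (if N s = 0 then 0 else 1)" for s
      unfolding w_def lp_norm_scale[OF p] N_def[symmetric] norm_of_real using N0[of s] by simp
    have wN: "restr (S s) W = fscale (of_real (N s)) (w s)" for s
    proof (cases "N s = 0")
      case True
      then show ?thesis using lp_norm_eq_0_iff[OF p rW] by (simp add: N_def)
    next
      case False
      then have "complex_of_real (N s) * complex_of_real (inverse (N s)) = 1"
        by (simp flip: of_real_mult)
      then show ?thesis by (simp only: w_def cfun.scale_scale fscale_simps)
    qed
    have "\<forall>s. \<exists>b. b \<in> Lq p \<and> lq_norm p b \<le> 1 \<and> pairing b (w s) = lp_norm p (w s) \<and> (\<forall>i. w s i = 0 \<longrightarrow> b i = 0)"
      using norming_functional[OF p w1] by metis
    then obtain a where a: "\<And>s. a s \<in> Lq p" "\<And>s. lq_norm p (a s) \<le> 1"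
      "\<And>s. pairing (a s) (w s) = lp_norm p (w s)" "\<And>s i. w s i = 0 \<Longrightarrow> a s i = 0"
      by metis
    have supp: "i \<in> S s" if "w s i \<noteq> 0" for s i
      using that by (auto simp: w_def fscale_def restr_def split: if_splits)
    have supp': "i \<in> S s" if "a s i \<noteq> 0" for s i using that a(4) supp by blast
    let ?P = "rank_one_sum r a w"
    have contr: "lp_norm p (?P f) \<le> lp_norm p f" if "f \<in> Lp p" for f
      by (rule rank_one_sum_contractive[OF p w1 _ a(1,2) disj supp supp' that]) (simp add: nw)
    \<comment> \<open>The norming functional of a block recovers the norm of W there, and those of
      the other blocks vanish on it by disjointness.\<close>
    have PW: "?P (restr (S t) W) = restr (S t) W" if t: "t < r" for t
    proof -
      have "pairing (a s) (restr (S t) W) = 0" if "s < r" "s \<noteq> t" for s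
      proof -
        have "pairing (a s) (restr (S t) W) = pairing (a s) 0"
          by (rule pairing_cong) (use supp'[of s] disj t that in \<open>fastforce simp: restr_def disjoint_family_on_def\<close>)
        then show ?thesis by simp
      qed
      then have "?P (restr (S t) W) = (\<Sum>s<r. if s = t then fscale (pairing (a t) (restr (S t) W)) (w t) else 0)"
        unfolding rank_one_sum_def by (intro sum.cong refl) auto
      also have "\<dots> = fscale (pairing (a t) (restr (S t) W)) (w t)"
        using t by simp
      also have "pairing (a t) (restr (S t) W) = of_real (N t)"
        unfolding wN pairing_scale a(3) nw by simp
      finally show ?thesis by (simp only: wN)
    qed
    have "lp_norm p (?P (v i) - v i) \<le> e" if i: "i < n" for i
    proof -
      \<comment> \<open>The rounded vector is a combination of the restrictions of W, which P fixes.
        Hence P v - v = P g - g for g = v - u, of norm at most twice that of g.\<close>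
      define u where "u = (\<Sum>s<r. fscale (h s i) (restr (S s) W))"
      have u: "u \<in> Lp p" unfolding u_def by (intro Lp_sum Lp_scale p rW)
      have uk: "u k = W k * \<gamma> (c i k)" for k
      proof -
        obtain t where t: "t < r" "k \<in> S t" using cover by blast
        have "u k = (\<Sum>s<r. if s = t then h t i * W k else 0)"
          unfolding u_def sum_fn_apply
        proof (intro sum.cong refl)
          fix s assume "s \<in> {..<r}"
          then have "k \<notin> S s" if "s \<noteq> t" using that t disj by (auto simp: disjoint_family_on_def)
          then show "fscale (h s i) (restr (S s) W) k = (if s = t then h t i * W k else 0)"
            using t by (auto simp: fscale_def restr_def)
        qed
        also have "\<dots> = h t i * W k" using t by simp
        also have "h t i = \<gamma> (c i k)" using t(2) i by (auto simp: S_def \<kappa>_def dest: fun_cong[of _ _ i])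
        finally show ?thesis by (simp add: mult.commute)
      qed
      have Pu: "?P u = u"
      proof -
        have "?P u = (\<Sum>s<r. ?P (fscale (h s i) (restr (S s) W)))"
          unfolding u_def by (rule rank_one_sum_finite_sum[OF p a(1)]) (intro Lp_scale p rW)
        also have "\<dots> = u" unfolding u_def by (intro sum.cong refl) (simp add: rank_one_sum_scale PW)
        finally show ?thesis .
      qed
      define g where "g = v i - u"
      have g: "g \<in> Lp p" unfolding g_def by (rule Lp_diff[OF p v(1)[OF i] u])
      have "lp_norm p g \<le> d * lp_norm p W"
      proof (rule lp_norm_dominated[OF p W])
        show "cmod (g k) \<le> d * cmod (W k)" for k
        proof -
          have "g k = W k * (c i k - \<gamma> (c i k))"
            by (simp add: g_def uk vc[OF i] algebra_simps)
          then show ?thesis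
            using mult_left_mono[OF \<gamma>(2)[OF c1[OF i, of k]], of "cmod (W k)"]
            by (simp add: norm_mult mult.commute)
        qed
      qed (use d in simp)
      also have "\<dots> \<le> d * (real n * C)" using nW d by (intro mult_left_mono) auto
      finally have ng: "lp_norm p g \<le> d * (real n * C)" .
      have "v i = g + u" by (simp add: g_def)
      then have "?P (v i) = ?P g + u"
        using rank_one_sum_add[where r = r and w = w and a = a, OF p a(1) g u] Pu by simp
      then have "?P (v i) - v i = ?P g - g" by (simp add: g_def)
      then have "lp_norm p (?P (v i) - v i) \<le> lp_norm p (?P g) + lp_norm p g"
        using lp_norm_triangle_diff[OF p rank_one_sum_Lp[where r = r and w = w and a = a and f = g, OF p w1] g] by simp
      also have "\<dots> \<le> 2 * (d * (real n * C))" using contr[OF g] ng by simp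
      also have "\<dots> \<le> d * (2 * (real n * C) + 1)" using d by (simp add: algebra_simps)
      also have "\<dots> = e" using den by (simp add: d_def)
      finally show ?thesis .
    qed
    then show "\<exists>a w. (\<forall>s<r. a s \<in> Lq p \<and> lq_norm p (a s) \<le> 1 \<and> w s \<in> Lp p \<and> lp_norm p (w s) \<le> 1) \<and>
      (\<forall>f\<in>Lp p. lp_norm p (rank_one_sum r a w f) \<le> lp_norm p f) \<and>
      (\<forall>i<n. lp_norm p (rank_one_sum r a w (v i) - v i) \<le> e)"
      using a w1 nw contr by (intro exI[of _ a] exI[of _ w]) auto
  qed
qed

section \<open>Approximate units and rank reduction\<close>


lemma Lq_0 [simp]: "1 \<le> p \<Longrightarrow> 0 \<in> Lq p" and lq_norm_0 [simp]: "1 \<le> p \<Longrightarrow> lq_norm p 0 = 0"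
  by (cases "p = 1"; simp add: lq_gt_1)+

section \<open>Diagonal columns and rows\<close>

definition diag_kernel :: "('x \<Rightarrow> nat fn) \<Rightarrow> 'x \<Rightarrow> 'x \<Rightarrow> nat fn" where
  "diag_kernel w x y = (if x = y then w x else 0)"

text \<open>With radius 0 and M = 1 the Schur test loses no constant on diagonal operators.\<close>

lemma ball_0:
  fixes x :: "'x::metric_space"
  shows "finite (cball x 0) \<and> card (cball x 0) \<le> 1"
  by simp

lemma
  fixes w :: "'x::metric_space \<Rightarrow> nat fn"
  assumes p: "1 \<le> p" and w: "\<And>x. w x \<in> Lp p" "\<And>x. lp_norm p (w x) \<le> C"
  shows diag_column_fprop: "column_op p (diag_kernel w) \<in> fprop p id fst 0"
    and diag_column_apply: "f \<in> Lp p \<Longrightarrow>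
      slice x (column_op p (diag_kernel w) f) = fscale (f x) (w x)"
proof -
  have k: "diag_kernel w x y = 0" if "0 < dist x y" for x y
    using that by (auto simp: diag_kernel_def)
  have kL: "diag_kernel w x y \<in> Lp p" for x y using w by (simp add: diag_kernel_def)
  have "0 \<le> C" using w(2) lp_norm_nonneg order_trans by blast
  then have kn: "lp_norm p (diag_kernel w x y) \<le> C" for x y using w by (simp add: diag_kernel_def)
  show "column_op p (diag_kernel w) \<in> fprop p id fst 0"
    by (rule column_op_fprop[where k = "diag_kernel w" and M = 1 and C = C, OF p ball_0 k kL kn])
  assume f: "f \<in> Lp p"
  show "slice x (column_op p (diag_kernel w) f) = fscale (f x) (w x)"
  proof -
    have "slice x (column_op p (diag_kernel w) f) = (\<Sum>y\<in>cball x 0. fscale (f y) (diag_kernel w x y))"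
      by (rule column_op_apply[where k = "diag_kernel w" and M = 1 and C = C, OF p ball_0 k kL kn f])
    then show ?thesis by (simp add: diag_kernel_def)
  qed
qed

lemma
  fixes a :: "'x::metric_space \<Rightarrow> nat fn"
  assumes p: "1 \<le> p" and a: "\<And>x. a x \<in> Lq p" "\<And>x. lq_norm p (a x) \<le> C"
  shows diag_row_fprop: "row_op p (diag_kernel a) \<in> fprop p fst id 0"
    and diag_row_apply: "f \<in> Lp p \<Longrightarrow>
      row_op p (diag_kernel a) f x = pairing (a x) (slice x f)"
proof -
  have k: "diag_kernel a x y = 0" if "0 < dist x y" for x y
    using that by (auto simp: diag_kernel_def)
  have kL: "diag_kernel a x y \<in> Lq p" for x y using a p by (simp add: diag_kernel_def)
  have "0 \<le> C" using a lq_norm_nonneg[OF p] order_trans by blast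
  then have kn: "lq_norm p (diag_kernel a x y) \<le> C" for x y using a p by (simp add: diag_kernel_def)
  show "row_op p (diag_kernel a) \<in> fprop p fst id 0"
    by (rule row_op_fprop[where k = "diag_kernel a" and M = 1 and C = C, OF p ball_0 k kL kn])
  assume f: "f \<in> Lp p"
  show "row_op p (diag_kernel a) f x = pairing (a x) (slice x f)"
  proof -
    have "row_op p (diag_kernel a) f x = (\<Sum>y\<in>cball x 0. pairing (diag_kernel a x y) (slice y f))"
      by (rule row_op_apply[where k = "diag_kernel a" and M = 1 and C = C, OF p ball_0 k kL kn f])
    then show ?thesis by (simp add: diag_kernel_def)
  qed
qed

lemma fn_slice_eqI:
  assumes "\<And>x. slice x f = slice x g"
  shows "f = g"
proof
  fix i show "f i = g i" using fun_cong[OF assms[of "fst i"], of "snd i"] by (simp add: slice_def)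
qed

text \<open>
  Any \<open>\<xi>\<close> in the algebraic module is fixed by an idempotent, but the norm of that idempotent grows
  with the propagation of \<open>\<xi>\<close>. The bound 1 is what allows a passage to the completed module.
\<close>

lemma left_approximate_unit:
  fixes \<xi> :: "('x::metric_space, 'x \<times> nat) opr"
  assumes bg: "bounded_geometry TYPE('x)" and p: "1 \<le> p" and \<xi>: "\<xi> \<in> Egt_alg p" and e: "0 < e"
  obtains r and \<zeta> :: "nat \<Rightarrow> ('x, 'x \<times> nat) opr" and \<eta> :: "nat \<Rightarrow> ('x \<times> nat, 'x) opr"
  where "\<And>s. s < r \<Longrightarrow> \<zeta> s \<in> Egt_alg p" "\<And>s. s < r \<Longrightarrow> \<eta> s \<in> Elt_alg p"
    "onorm_lp p (\<Sum>s<r. \<zeta> s \<circ> \<eta> s) \<le> 1" "onorm_lp p (((\<Sum>s<r. \<zeta> s \<circ> \<eta> s) \<circ> \<xi>) - \<xi>) \<le> e"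
proof -
  obtain k R M C where \<xi>_eq: "\<xi> = column_op p k"
    and M: "\<And>x :: 'x. ball_bound R M x"
    and R: "\<And>x y. R < dist x y \<Longrightarrow> k x y = 0" and k: "\<And>x y. k x y \<in> Lp p" and C: "\<And>x y. lp_norm p (k x y) \<le> C"
    using Egt_algE[OF bg \<xi>] by blast
  have C0: "0 \<le> C" using C lp_norm_nonneg order_trans by blast
  have \<xi>b: "\<xi> \<in> bops p" unfolding \<xi>_eq by (rule fprop_bops[OF column_op_fprop[OF p M R k C]])
  \<comment> \<open>The Schur test on balls of size M costs M^2; the added 1 keeps the divisor
    positive.\<close>
  define d where "d = e / (real M ^ 2 + 1)"
  have den: "0 < real M ^ 2 + 1" by (simp add: add_nonneg_pos)
  have d: "0 < d" using e den by (simp add: d_def)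
  \<comment> \<open>As r is common to all points of X, the approximants at the single points
    assemble into r diagonal columns and r diagonal rows.\<close>
  obtain r where r: "\<And>v :: nat \<Rightarrow> nat fn. (\<And>i. i < M \<Longrightarrow> v i \<in> Lp p) \<Longrightarrow> (\<And>i. i < M \<Longrightarrow> lp_norm p (v i) \<le> C) \<Longrightarrow>
    \<exists>a w. (\<forall>s<r. a s \<in> Lq p \<and> lq_norm p (a s) \<le> 1 \<and> w s \<in> Lp p \<and> lp_norm p (w s) \<le> 1) \<and>
      (\<forall>f\<in>Lp p. lp_norm p (rank_one_sum r a w f) \<le> lp_norm p f) \<and>
      (\<forall>i<M. lp_norm p (rank_one_sum r a w (v i) - v i) \<le> d)"
    using uniform_approximation_property[OF p C0 d] by blast
  \<comment> \<open>Balls are enumerated by exactly M indices, with repetitions and surplus points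
    allowed, so that the uniform statement applies with n = M everywhere.\<close>
  have "\<exists>idx :: nat \<Rightarrow> 'x. cball x R \<subseteq> idx ` {..<M}" for x
  proof -
    obtain g where "bij_betw g {0..<card (cball x R)} (cball x R)"
      using ex_bij_betw_nat_finite[of "cball x R"] M by blast
    then have "cball x R \<subseteq> g ` {0..<card (cball x R)}" by (simp add: bij_betw_def)
    also have "\<dots> \<subseteq> g ` {..<M}" using M[of x] by (intro image_mono) auto
    finally show ?thesis by blast
  qed
  then obtain idx :: "'x \<Rightarrow> nat \<Rightarrow> 'x" where idx: "\<And>x. cball x R \<subseteq> idx x ` {..<M}" by metis
  have "\<forall>x. \<exists>a w. (\<forall>s<r. a s \<in> Lq p \<and> lq_norm p (a s) \<le> 1 \<and> w s \<in> Lp p \<and> lp_norm p (w s) \<le> 1) \<and>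
      (\<forall>f\<in>Lp p. lp_norm p (rank_one_sum r a w f) \<le> lp_norm p f) \<and>
      (\<forall>i<M. lp_norm p (rank_one_sum r a w (k x (idx x i)) - k x (idx x i)) \<le> d)"
    by (intro allI r k C)
  then obtain a w :: "'x \<Rightarrow> nat \<Rightarrow> nat fn" where
    aw: "\<And>x s. s < r \<Longrightarrow> a x s \<in> Lq p \<and> lq_norm p (a x s) \<le> 1 \<and> w x s \<in> Lp p \<and> lp_norm p (w x s) \<le> 1"
    and contr: "\<And>x f. f \<in> Lp p \<Longrightarrow> lp_norm p (rank_one_sum r (a x) (w x) f) \<le> lp_norm p f"
    and close: "\<And>x i. i < M \<Longrightarrow> lp_norm p (rank_one_sum r (a x) (w x) (k x (idx x i)) - k x (idx x i)) \<le> d"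
    by metis
  have kd: "lp_norm p (rank_one_sum r (a x) (w x) (k x y) - k x y) \<le> d" if "y \<in> cball x R" for x y
  proof -
    obtain i where "i < M" "y = idx x i" using idx[of x] \<open>y \<in> cball x R\<close> by auto
    then show ?thesis using close[of i x] by simp
  qed
  define \<zeta> where "\<zeta> s = column_op p (diag_kernel (\<lambda>x. w x s))" for s
  define \<eta> where "\<eta> s = row_op p (diag_kernel (\<lambda>x. a x s))" for s
  have \<zeta>f: "\<zeta> s \<in> fprop p id fst 0" if "s < r" for s
    unfolding \<zeta>_def by (rule diag_column_fprop[OF p]) (use aw that in auto)
  have \<eta>f: "\<eta> s \<in> fprop p fst id 0" if "s < r" for s
    unfolding \<eta>_def by (rule diag_row_fprop[OF p]) (use aw that in auto)
  define P where "P = (\<Sum>s<r. \<zeta> s \<circ> \<eta> s)"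
  have Pb: "P \<in> bops p" unfolding P_def
    by (intro bops_finite_sum p bops_comp) (auto intro: fprop_bops \<zeta>f \<eta>f)
  have slP: "slice x (P f) = rank_one_sum r (a x) (w x) (slice x f)" if f: "f \<in> Lp p" for x f
  proof -
    have "slice x (P f) = (\<Sum>s<r. slice x (\<zeta> s (\<eta> s f)))"
      by (simp add: P_def slice_def fun_eq_iff sum_fn_apply)
    also have "\<dots> = (\<Sum>s<r. fscale (pairing (a x s) (slice x f)) (w x s))"
    proof (intro sum.cong refl)
      fix s assume "s \<in> {..<r}"
      then have s: "s < r" by simp
      have "slice x (\<zeta> s (\<eta> s f)) = fscale (\<eta> s f x) (w x s)"
        unfolding \<zeta>_def
        by (rule diag_column_apply[OF p _ _ bops_Lp[OF fprop_bops[OF \<eta>f[OF s]]]]) (use aw s in auto)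
      also have "\<eta> s f x = pairing (a x s) (slice x f)"
        unfolding \<eta>_def by (rule diag_row_apply[OF p _ _ f]) (use aw s in auto)
      finally show "slice x (\<zeta> s (\<eta> s f)) = fscale (pairing (a x s) (slice x f)) (w x s)" .
    qed
    finally show ?thesis by (simp add: rank_one_sum_def)
  qed
  show ?thesis
  proof (rule that[of r \<zeta> \<eta>])
    show "\<zeta> s \<in> Egt_alg p" if "s < r" for s unfolding Egt_alg_eq[OF bg p] using \<zeta>f[OF that] by blast
    show "\<eta> s \<in> Elt_alg p" if "s < r" for s unfolding Elt_alg_eq[OF bg p] using \<eta>f[OF that] by blast
    show "onorm_lp p (\<Sum>s<r. \<zeta> s \<circ> \<eta> s) \<le> 1"
      unfolding P_def[symmetric]
    proof (rule onorm_lp_le)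
      fix f :: "('x \<times> nat) fn" assume f: "f \<in> Lp p"
      \<comment> \<open>P acts fibrewise by contractions, so the Schur test with radius 0 and C = M
        = 1 keeps the bound 1.\<close>
      have "lp_norm p (P f) \<le> 1 * real 1 ^ 2 * lp_norm p f"
      proof (rule Schur_lp_norm_le[OF p ball_0 f, where \<sigma> = fst and \<pi> = fst])
        fix x
        show "restr (fst -` {x}) (P f) \<in> Lp p" by (rule Lp_restr[OF p bops_Lp[OF Pb]])
        show "lp_norm p (restr (fst -` {x}) (P f)) \<le> 1 * (\<Sum>y\<in>cball x 0. lp_norm p (restr (fst -` {y}) f))"
          using contr[OF slice_Lp[OF p f]] by (simp add: restr_eq_emb_slice slP[OF f])
      qed simp
      then show "lp_norm p (P f) \<le> 1 * lp_norm p f" by simp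
    qed simp
    show "onorm_lp p (((\<Sum>s<r. \<zeta> s \<circ> \<eta> s) \<circ> \<xi>) - \<xi>) \<le> e"
      unfolding P_def[symmetric]
    proof (rule onorm_lp_le)
      fix f :: "'x fn" assume f: "f \<in> Lp p"
      define g where "g = ((P \<circ> \<xi>) - \<xi>) f"
      have Q: "(P \<circ> \<xi>) - \<xi> \<in> bops p" by (intro bops_minus_op bops_comp p Pb \<xi>b)
      have g: "g \<in> Lp p" unfolding g_def by (rule bops_Lp[OF Q, of f])
      let ?D = "\<lambda>x u. rank_one_sum r (a x) (w x) u - u"
      have sg: "slice x g = (\<Sum>y\<in>cball x R. fscale (f y) (?D x (k x y)))" for x
      proof -
        have "slice x g = ?D x (slice x (\<xi> f))"
          using slP[OF bops_Lp[OF \<xi>b], of x f] by (simp add: g_def slice_def fun_eq_iff)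
        also have "slice x (\<xi> f) = (\<Sum>y\<in>cball x R. fscale (f y) (k x y))"
          unfolding \<xi>_eq by (rule column_op_apply[OF p M R k C f])
        also have "rank_one_sum r (a x) (w x) \<dots> = (\<Sum>y\<in>cball x R. rank_one_sum r (a x) (w x) (fscale (f y) (k x y)))"
          by (rule rank_one_sum_finite_sum[OF p]) (use aw in \<open>auto intro: Lp_scale[OF p k]\<close>)
        finally show ?thesis
          by (simp only: rank_one_sum_scale sum_subtractf cfun.scale_right_diff_distrib)
      qed
      \<comment> \<open>The error is again given by a matrix supported on the same balls, with
        entries \<open>?D x (k x y)\<close> of norm at most d.\<close>
      have "lp_norm p g \<le> d * real M ^ 2 * lp_norm p f"
      proof (rule Schur_lp_norm_le[OF p M f, where \<sigma> = fst and \<pi> = id])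
        fix x
        show "restr (fst -` {x}) g \<in> Lp p" by (intro Lp_restr p g)
        have DL: "?D x (k x y) \<in> Lp p" for y
          by (intro Lp_diff rank_one_sum_Lp p k) (use aw in auto)
        have "lp_norm p (restr (fst -` {x}) g) \<le> (\<Sum>y\<in>cball x R. lp_norm p (fscale (f y) (?D x (k x y))))"
          unfolding restr_eq_emb_slice lp_norm_emb sg by (intro lp_norm_sum Lp_scale p DL)
        also have "\<dots> \<le> (\<Sum>y\<in>cball x R. cmod (f y) * d)"
          unfolding lp_norm_scale[OF p] by (intro sum_mono mult_left_mono kd) auto
        finally show "lp_norm p (restr (fst -` {x}) g) \<le> d * (\<Sum>y\<in>cball x R. lp_norm p (restr (id -` {y}) f))"
          unfolding lp_norm_restr_id[OF p] by (simp add: sum_distrib_left mult.commute)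
      qed (use d in simp)
      also have "\<dots> \<le> (d * (real M ^ 2 + 1)) * lp_norm p f"
        using d by (intro mult_right_mono) (auto simp: algebra_simps)
      also have "d * (real M ^ 2 + 1) = e" using den by (simp add: d_def)
      finally show "lp_norm p (((P \<circ> \<xi>) - \<xi>) f) \<le> e * lp_norm p f" by (simp only: g_def)
    qed (use e in simp)
  qed
qed

text \<open>
  With \<open>\<parallel>S u\<parallel> > \<parallel>S\<parallel>/2\<close> and \<open>\<psi>\<close> norming \<open>S u\<close>, take \<open>a = \<psi> \<circ> S / \<parallel>S u\<parallel>\<close>: the
  range of the difference lies in the kernel of \<open>\<psi>\<close>, which misses \<open>S u\<close>.
\<close>

lemma rank_drop_functional:
  fixes S :: "('i, 'j) opr"
  assumes p: "1 \<le> p" and S: "S \<in> bops p"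
    and V: "finite V" "card V \<le> Suc n" "\<And>v. v \<in> Lp p \<Longrightarrow> S v \<in> cfun.span V"
  shows "\<exists>u a V'. u \<in> Lp p \<and> lp_norm p u \<le> 1 \<and> a \<in> Lq p \<and> lq_norm p a \<le> 2 \<and> finite V' \<and> card V' \<le> n \<and>
    (\<forall>v\<in>Lp p. S v - fscale (pairing a v) (S u) \<in> cfun.span V')"
proof (cases "\<forall>v\<in>Lp p. S v = 0")
  case True
  then show ?thesis
    using p by (intro exI[of _ 0] exI[of _ "{}"]) auto
next
  case False
  then obtain v\<^sub>0 where v\<^sub>0: "v\<^sub>0 \<in> Lp p" "S v\<^sub>0 \<noteq> 0" by blast
  define c where "c = onorm_lp p S"
  have "lp_norm p (S v\<^sub>0) \<noteq> 0" using v\<^sub>0 lp_norm_eq_0_iff[OF p bops_Lp[OF S]] by blast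
  then have "0 < lp_norm p (S v\<^sub>0)" by (simp add: less_le)
  then have "c \<noteq> 0" using onorm_lp_bound[OF S v\<^sub>0(1)] by (auto simp: c_def)
  then have c: "0 < c" using onorm_lp_nonneg[OF S] by (auto simp: c_def)
  \<comment> \<open>The operator norm need not be attained, but half of it can be exceeded; this
    factor becomes the bound 2 on the functional.\<close>
  have "\<exists>u\<^sub>0\<in>Lp p. c / 2 * lp_norm p u\<^sub>0 < lp_norm p (S u\<^sub>0)"
  proof (rule ccontr)
    assume "\<not> ?thesis"
    then have "onorm_lp p S \<le> c / 2"
      using c by (intro onorm_lp_le) (auto simp: not_less)
    then show False using c by (simp add: c_def)
  qed
  then obtain u\<^sub>0 where u\<^sub>0: "u\<^sub>0 \<in> Lp p" "c / 2 * lp_norm p u\<^sub>0 < lp_norm p (S u\<^sub>0)" by blast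
  have "lp_norm p u\<^sub>0 \<noteq> 0"
  proof
    assume "lp_norm p u\<^sub>0 = 0"
    then have "S u\<^sub>0 = 0" using lp_norm_eq_0_iff[OF p u\<^sub>0(1)] bops_zero[OF S] by simp
    then show False using u\<^sub>0(2) c \<open>lp_norm p u\<^sub>0 = 0\<close> by simp
  qed
  then have nu: "0 < lp_norm p u\<^sub>0" by (simp add: less_le)
  define u where "u = fscale (of_real (inverse (lp_norm p u\<^sub>0))) u\<^sub>0"
  have u: "u \<in> Lp p" unfolding u_def by (intro Lp_scale p u\<^sub>0)
  have nu1: "lp_norm p u = 1"
    unfolding u_def lp_norm_scale[OF p] norm_of_real using nu by simp
  define t where "t = lp_norm p (S u)"
  have "t = lp_norm p (S u\<^sub>0) / lp_norm p u\<^sub>0"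
    unfolding t_def u_def bops_scale[OF S u\<^sub>0(1)] lp_norm_scale[OF p] norm_of_real
    using nu by (simp add: divide_inverse mult.commute)
  then have t: "c / 2 < t" using u\<^sub>0(2) nu by (simp add: pos_less_divide_eq)
  then have t0: "0 < t" using c by linarith
  obtain \<psi> where \<psi>: "\<psi> \<in> Lq p" "lq_norm p \<psi> \<le> 1" "pairing \<psi> (S u) = t"
    using norming_functional[OF p bops_Lp[OF S]] unfolding t_def by metis
  define \<phi> where "\<phi> v = pairing \<psi> (S v) / of_real t" for v
  have 1: "\<phi> (f + g) = \<phi> f + \<phi> g" if "f \<in> Lp p" "g \<in> Lp p" for f g
    unfolding \<phi>_def bops_add[OF S that] pairing_add[OF p \<psi>(1) bops_Lp[OF S] bops_Lp[OF S]]
    by (rule add_divide_distrib)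
  have 2: "\<phi> (fscale d f) = d * \<phi> f" if "f \<in> Lp p" for d f
    unfolding \<phi>_def bops_scale[OF S that] pairing_scale by simp
  have 3: "cmod (\<phi> f) \<le> 2 * lp_norm p f" if f: "f \<in> Lp p" for f
  proof -
    have "cmod (pairing \<psi> (S f)) \<le> lq_norm p \<psi> * lp_norm p (S f)"
      by (rule norm_pairing_le[OF p \<psi>(1) bops_Lp[OF S]])
    also have "\<dots> \<le> 1 * (c * lp_norm p f)"
      unfolding c_def by (intro mult_mono \<psi>(2) onorm_lp_bound[OF S f]) auto
    also have "\<dots> \<le> (2 * t) * lp_norm p f"
      using t by (simp add: mult_right_mono)
    finally show ?thesis using t0 by (simp add: \<phi>_def norm_divide divide_le_eq mult_ac)
  qed
  define a where "a = (\<lambda>i. \<phi> (basis_fn i))"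
  have a: "a \<in> Lq p" "lq_norm p a \<le> 2" and \<phi>a: "\<And>f. f \<in> Lp p \<Longrightarrow> \<phi> f = pairing a f"
    unfolding a_def by (rule Riesz_lp[OF p 1 2 3]; assumption)+
  let ?S' = "\<lambda>v. S v - fscale (pairing a v) (S u)"
  have Ls: "cfun.subspace {y \<in> Lp p. pairing \<psi> y = 0}"
    using p by (intro cfun.subspaceI) (auto simp: pairing_add[OF p \<psi>(1)] pairing_scale)
  have ker: "?S' v \<in> {y \<in> Lp p. pairing \<psi> y = 0}" if v: "v \<in> Lp p" for v
  proof -
    have L: "fscale (pairing a v) (S u) \<in> Lp p" by (intro Lp_scale p bops_Lp[OF S])
    have "pairing \<psi> (?S' v + fscale (pairing a v) (S u)) = pairing \<psi> (?S' v) + pairing a v * t"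
      using pairing_add[OF p \<psi>(1) Lp_diff[OF p bops_Lp[OF S] L] L] by (simp only: pairing_scale \<psi>(3))
    moreover have "?S' v + fscale (pairing a v) (S u) = S v" by simp
    moreover have "pairing \<psi> (S v) = pairing a v * t"
      using \<phi>a[OF v] t0 by (simp add: \<phi>_def field_simps)
    ultimately have "pairing \<psi> (?S' v) = 0" by simp
    then show ?thesis using Lp_diff[OF p bops_Lp[OF S] L] by blast
  qed
  \<comment> \<open>B is a basis of the range of the difference and lies in the kernel of
    \<open>\<psi>\<close>, whereas \<open>\<psi>\<close> takes the nonzero value t at
    \<open>S u\<close>. So \<open>S u\<close> enlarges B to an independent set in the span of V,
    whence card B + 1 <= card V <= n + 1.\<close>
  obtain B where B: "B \<subseteq> ?S' ` Lp p" "cfun.independent B" "?S' ` Lp p \<subseteq> cfun.span B"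
    using cfun.maximal_independent_subset[of "?S' ` Lp p"] by blast
  have "cfun.span B \<subseteq> {y \<in> Lp p. pairing \<psi> y = 0}"
    by (rule cfun.span_minimal[OF _ Ls]) (use B(1) ker in blast)
  then have Su: "S u \<notin> cfun.span B" using \<psi>(3) t0 by auto
  have ind: "cfun.independent (insert (S u) B)"
    using B(2) Su by (simp add: cfun.independent_insert)
  have "insert (S u) B \<subseteq> cfun.span V"
    using B(1) V(3) u by (auto intro!: cfun.span_diff cfun.span_scale)
  then have fin: "finite (insert (S u) B) \<and> card (insert (S u) B) \<le> card V"
    by (rule cfun.independent_span_bound[OF V(1) ind])
  have "S u \<notin> B" using Su cfun.span_base by blast
  moreover have "finite B" using fin unfolding finite_insert by (rule conjunct1)
  ultimately have "card (insert (S u) B) = Suc (card B)" by (intro card_insert_disjoint)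
  then have "card B \<le> n" using fin V(2) by linarith
  then show ?thesis
    using u nu1 a B(3) fin by (intro exI[of _ u] exI[of _ a] exI[of _ B]) auto
qed

text \<open>Whole columns instead of single blocks: a diagonal operator on the right changes each
  column through that column alone, so the ranks of all columns can be lowered by one
  subtraction.\<close>

definition column_rank_le :: "real \<Rightarrow> nat \<Rightarrow> ('x \<times> nat, 'x \<times> nat) opr \<Rightarrow> bool" where
  "column_rank_le p n T \<longleftrightarrow>
     (\<forall>z. \<exists>V. finite V \<and> card V \<le> n \<and> (\<forall>v\<in>Lp p. T (emb z v) \<in> cfun.span V))"

text \<open>\<open>rank_drop_functional\<close> is used on each column. Its bounds 1 and 2 do not
  depend on the column, so the chosen vectors and functionals form an admissible diagonal column and
  diagonal row.\<close>

lemma column_rank_drop: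
  fixes T :: "('x::metric_space \<times> nat, 'x \<times> nat) opr"
  assumes bg: "bounded_geometry TYPE('x)" and p: "1 \<le> p" and T: "T \<in> bops p"
    and rank: "column_rank_le p (Suc n) T"
  obtains U \<Phi> where "U \<in> Egt_alg p" "\<Phi> \<in> Elt_alg p" "column_rank_le p n (T - ((T \<circ> U) \<circ> \<Phi>))"
proof -
  have "\<exists>u a V'. u \<in> Lp p \<and> lp_norm p u \<le> 1 \<and> a \<in> Lq p \<and> lq_norm p a \<le> 2 \<and> finite V' \<and> card V' \<le> n \<and>
    (\<forall>v\<in>Lp p. T (emb z v) - fscale (pairing a v) (T (emb z u)) \<in> cfun.span V')" for z
  proof -
    obtain V where V: "finite V" "card V \<le> Suc n" "\<And>v. v \<in> Lp p \<Longrightarrow> T (emb z v) \<in> cfun.span V"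
      using rank unfolding column_rank_le_def by blast
    have S: "(\<lambda>v. T (emb z v)) \<in> bops p"
    proof (rule bopsI[where K = "onorm_lp p T"])
      fix f g :: "nat fn" assume f: "f \<in> Lp p" and g: "g \<in> Lp p"
      show "T (emb z (f + g)) = T (emb z f) + T (emb z g)"
        using bops_add[OF T, of "emb z f" "emb z g"] f g by (simp add: emb_add)
    next
      fix c and f :: "nat fn" assume f: "f \<in> Lp p"
      show "T (emb z (fscale c f)) = fscale c (T (emb z f))"
        using bops_scale[OF T, of "emb z f"] f by (simp add: emb_scale)
      show "lp_norm p (T (emb z f)) \<le> onorm_lp p T * lp_norm p f"
        using onorm_lp_bound[OF T, of "emb z f"] f by simp
    qed (use bops_Lp[OF T] bops_outside[OF T] in auto)
    show ?thesis by (rule rank_drop_functional[OF p S V])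
  qed
  then obtain u a where u: "\<And>z. u z \<in> Lp p" "\<And>z. lp_norm p (u z) \<le> 1"
    and a: "\<And>z. a z \<in> Lq p" "\<And>z. lq_norm p (a z) \<le> 2"
    and V: "\<And>z. \<exists>V'. finite V' \<and> card V' \<le> n \<and>
      (\<forall>v\<in>Lp p. T (emb z v) - fscale (pairing (a z) v) (T (emb z (u z))) \<in> cfun.span V')"
    by metis
  define U where "U = column_op p (diag_kernel u)"
  define \<Phi> where "\<Phi> = row_op p (diag_kernel a)"
  have Uf: "U \<in> fprop p id fst 0" unfolding U_def by (rule diag_column_fprop[OF p u])
  have \<Phi>f: "\<Phi> \<in> fprop p fst id 0" unfolding \<Phi>_def by (rule diag_row_fprop[OF p a])
  have *: "(T - ((T \<circ> U) \<circ> \<Phi>)) (emb z v) = T (emb z v) - fscale (pairing (a z) v) (T (emb z (u z)))"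
    if v: "v \<in> Lp p" for z v
  proof -
    have ev: "emb z v \<in> Lp p" using v by simp
    have "\<Phi> (emb z v) x = fscale (pairing (a z) v) (basis_fn z) x" for x
    proof -
      have "\<Phi> (emb z v) x = pairing (a x) (slice x (emb z v))"
        unfolding \<Phi>_def by (rule diag_row_apply[OF p a ev])
      moreover have "slice x (emb z v) = (if x = z then v else 0)"
        by (auto simp: slice_def emb_def)
      ultimately show ?thesis by (simp add: fscale_def basis_fn_def)
    qed
    then have "\<Phi> (emb z v) = fscale (pairing (a z) v) (basis_fn z)" by blast
    moreover have "U (basis_fn z) = emb z (u z)"
    proof (rule fn_slice_eqI)
      fix x
      have "slice x (U (basis_fn z)) = fscale (basis_fn z x) (u x)"
        unfolding U_def by (rule diag_column_apply[OF p u Lp_basis_fn[OF p]])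
      also have "\<dots> = slice x (emb z (u z))"
        by (auto simp: slice_def emb_def fscale_def basis_fn_def)
      finally show "slice x (U (basis_fn z)) = slice x (emb z (u z))" .
    qed
    ultimately have "U (\<Phi> (emb z v)) = fscale (pairing (a z) v) (emb z (u z))"
      using bops_scale[OF fprop_bops[OF Uf] Lp_basis_fn[OF p]] by simp
    then have "T (U (\<Phi> (emb z v))) = fscale (pairing (a z) v) (T (emb z (u z)))"
      using bops_scale[OF T, of "emb z (u z)"] u by simp
    then show ?thesis by simp
  qed
  show ?thesis
  proof (rule that[of U \<Phi>])
    show "U \<in> Egt_alg p" unfolding Egt_alg_eq[OF bg p] using Uf by blast
    show "\<Phi> \<in> Elt_alg p" unfolding Elt_alg_eq[OF bg p] using \<Phi>f by blast
    show "column_rank_le p n (T - ((T \<circ> U) \<circ> \<Phi>))"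
      unfolding column_rank_le_def
    proof
      fix z
      obtain V' where "finite V'" "card V' \<le> n"
        "\<And>v. v \<in> Lp p \<Longrightarrow> T (emb z v) - fscale (pairing (a z) v) (T (emb z (u z))) \<in> cfun.span V'"
        using V by blast
      then show "\<exists>V. finite V \<and> card V \<le> n \<and> (\<forall>v\<in>Lp p. (T - ((T \<circ> U) \<circ> \<Phi>)) (emb z v) \<in> cfun.span V)"
        by (intro exI[of _ V'] conjI ballI) (simp_all only: *)
    qed
  qed
qed

lemma column_rank_0:
  fixes T :: "('x::metric_space \<times> nat, 'x \<times> nat) opr"
  assumes bg: "bounded_geometry TYPE('x)" and p: "1 \<le> p" and T: "T \<in> fprop p fst fst R"
    and rank: "column_rank_le p 0 T"
  shows "T = 0"
proof (intro ext)
  fix f and j :: "'x \<times> nat"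
  have z: "T (emb z v) = 0" if "v \<in> Lp p" for z v
    using rank that unfolding column_rank_le_def by fastforce
  have fin: "finite (cball x R)" for x :: 'x using bounded_geometryD[OF bg] by metis
  show "T f j = 0 f j"
  proof (cases "f \<in> Lp p")
    case True
    have "T f j = (\<Sum>y\<in>cball (fst j) R. T (restr (fst -` {y}) f) j)"
      by (rule fprop_expand[OF p T True fin])
    also have "\<dots> = 0"
      by (intro sum.neutral ballI) (simp add: restr_eq_emb_slice z slice_Lp[OF p True])
    finally show ?thesis by simp
  qed (use bops_outside[OF fprop_bops[OF T]] in auto)
qed

lemma span_emb_image:
  assumes "v \<in> cfun.span V"
  shows "emb x v \<in> cfun.span (emb x ` V)"
proof -
  have "cfun.span V \<subseteq> {v. emb x v \<in> cfun.span (emb x ` V)}"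
  proof (rule cfun.span_minimal)
    show "V \<subseteq> {v. emb x v \<in> cfun.span (emb x ` V)}" by (auto intro: cfun.span_base)
    show "cfun.subspace {v. emb x v \<in> cfun.span (emb x ` V)}"
      by (intro cfun.subspaceI)
        (auto simp: emb_add emb_scale cfun.span_zero intro: cfun.span_add cfun.span_scale)
  qed
  then show ?thesis using assms by blast
qed

text \<open>By finite propagation a column meets at most M nonzero blocks, each of rank at most
  N.\<close>

lemma UC_column_rank:
  fixes T :: "('x::metric_space \<times> nat, 'x \<times> nat) opr"
  assumes bg: "bounded_geometry TYPE('x)" and p: "1 \<le> p" and T: "T \<in> UC p"
  obtains n where "column_rank_le p n T"
proof -
  obtain R N where R: "T \<in> fprop p fst fst R"
    and N: "\<And>x y. \<exists>V. finite V \<and> card V \<le> N \<and> range (block T x y) \<subseteq> cfun.span V"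
    using T unfolding UC_iff[OF p] by blast
  obtain M where M: "\<And>x :: 'x. ball_bound R M x"
    using bounded_geometryD[OF bg] by blast
  obtain V where V: "\<And>x y. finite (V x y)" "\<And>x y. card (V x y) \<le> N"
    "\<And>x y. range (block T x y) \<subseteq> cfun.span (V x y)"
    using N by metis
  have "column_rank_le p (M * N) T"
    unfolding column_rank_le_def
  proof (intro allI exI conjI ballI)
    fix z :: 'x
    let ?W = "\<Union>x\<in>cball z R. emb x ` V x z"
    show "finite ?W" using M V by auto
    have "card ?W \<le> (\<Sum>x\<in>cball z R. card (emb x ` V x z))"
      by (rule card_UN_le) (use M in auto)
    also have "\<dots> \<le> (\<Sum>x\<in>cball z R. N)"
      by (intro sum_mono order_trans[OF card_image_le V(2)] V(1))
    also have "\<dots> \<le> M * N" using M by simp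
    finally show "card ?W \<le> M * N" .
    fix v :: "nat fn" assume v: "v \<in> Lp p"
    have "T (emb z v) = (\<Sum>x\<in>cball z R. emb x (slice x (T (emb z v))))"
    proof (rule fn_slice_eqI)
      fix x
      have "slice x (\<Sum>x\<in>cball z R. emb x (slice x (T (emb z v))))
          = (\<Sum>y\<in>cball z R. if y = x then slice x (T (emb z v)) else 0)"
        by (auto simp: slice_def emb_def fun_eq_iff sum_fn_apply intro!: sum.cong)
      also have "\<dots> = slice x (T (emb z v))"
      proof (cases "x \<in> cball z R")
        case False
        have "T (emb z v) (x, n) = 0" for n
          by (rule fprop_zero[OF R emb_Lp_iff[THEN iffD2, OF v]]) (use False in \<open>auto simp: emb_def dist_commute split: if_splits\<close>)
        then have "slice x (T (emb z v)) = 0" by (simp add: slice_def fun_eq_iff)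
        then show ?thesis by (intro trans[OF sum.neutral]) auto
      qed (use M in simp)
      finally show "slice x (T (emb z v)) = slice x (\<Sum>x\<in>cball z R. emb x (slice x (T (emb z v))))" by simp
    qed
    also have "\<dots> \<in> cfun.span ?W"
    proof (rule cfun.span_sum)
      fix x assume x: "x \<in> cball z R"
      have "slice x (T (emb z v)) \<in> cfun.span (V x z)"
        using V(3)[of x z] by (auto simp flip: block_eq)
      then have "emb x (slice x (T (emb z v))) \<in> cfun.span (emb x ` V x z)" by (rule span_emb_image)
      then show "emb x (slice x (T (emb z v))) \<in> cfun.span ?W"
        using cfun.span_mono[of "emb x ` V x z" ?W] x by blast
    qed
    finally show "T (emb z v) \<in> cfun.span ?W" .
  qed
  then show ?thesis by (rule that)
qed

lemma UC_subspace:
  assumes p: "1 \<le> p"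
  shows "cop.subspace (UC p :: ('x::metric_space \<times> nat, 'x \<times> nat) opr set)"
proof (rule cop.subspaceI)
  show "0 \<in> (UC p :: ('x \<times> nat, 'x \<times> nat) opr set)"
    unfolding UC_iff[OF p]
  proof (intro conjI exI allI)
    show "0 \<in> fprop p fst fst 0" by (rule cop.subspace_0[OF fprop_subspace[OF p]])
  next
    fix x y :: 'x
    show "range (block 0 x y) \<subseteq> cfun.span {}"
      by (auto simp: block_def fun_eq_iff)
  qed auto
next
  fix S T :: "('x \<times> nat, 'x \<times> nat) opr" assume S: "S \<in> UC p" and T: "T \<in> UC p"
  obtain N where N: "\<And>x y. \<exists>V. finite V \<and> card V \<le> N \<and> range (block S x y) \<subseteq> cfun.span V"
    using S unfolding UC_iff[OF p] by blast
  obtain N' where N': "\<And>x y. \<exists>V. finite V \<and> card V \<le> N' \<and> range (block T x y) \<subseteq> cfun.span V"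
    using T unfolding UC_iff[OF p] by blast
  have "\<exists>V. finite V \<and> card V \<le> N + N' \<and> range (block (S + T) x y) \<subseteq> cfun.span V" for x y
  proof -
    obtain V V' where V: "finite V" "card V \<le> N" "range (block S x y) \<subseteq> cfun.span V"
      and V': "finite V'" "card V' \<le> N'" "range (block T x y) \<subseteq> cfun.span V'"
      using N N' by metis
    have "block (S + T) x y v = block S x y v + block T x y v" for v
      by (simp add: block_def fun_eq_iff)
    moreover have "block S x y v \<in> cfun.span (V \<union> V')" "block T x y v \<in> cfun.span (V \<union> V')" for v
      using V(3) V'(3) cfun.span_mono[of V "V \<union> V'"] cfun.span_mono[of V' "V \<union> V'"] by blast+
    ultimately have "block (S + T) x y v \<in> cfun.span (V \<union> V')" for v
      by (simp only: cfun.span_add)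
    then have "range (block (S + T) x y) \<subseteq> cfun.span (V \<union> V')" by blast
    then show ?thesis using V V' card_Un_le[of V V'] by (intro exI[of _ "V \<union> V'"]) auto
  qed
  moreover have "\<exists>R. S + T \<in> fprop p fst fst R"
    using cop.subspace_add[OF Union_fprop_subspace[OF p], of S fst fst T] S T
    unfolding UC_iff[OF p] by blast
  ultimately show "S + T \<in> UC p" unfolding UC_iff[OF p] by blast
next
  fix c and T :: "('x \<times> nat, 'x \<times> nat) opr" assume T: "T \<in> UC p"
  obtain N where N: "\<And>x y. \<exists>V. finite V \<and> card V \<le> N \<and> range (block T x y) \<subseteq> cfun.span V"
    using T unfolding UC_iff[OF p] by blast
  have "block (oscale c T) x y v = fscale c (block T x y v)" for x y v
    by (simp add: block_def oscale_def fscale_def fun_eq_iff)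
  moreover have "fscale c (block T x y v) \<in> cfun.span V"
    if "range (block T x y) \<subseteq> cfun.span V" for x y v V
    using that by (intro cfun.span_scale) blast
  ultimately have "\<exists>V. finite V \<and> card V \<le> N \<and> range (block (oscale c T) x y) \<subseteq> cfun.span V" for x y
    using N[of x y] by (metis image_subsetI)
  moreover have "\<exists>R. oscale c T \<in> fprop p fst fst R"
    using cop.subspace_scale[OF Union_fprop_subspace[OF p], of T fst fst c] T
    unfolding UC_iff[OF p] by blast
  ultimately show "oscale c T \<in> UC p" unfolding UC_iff[OF p] by blast
qed

text \<open>The rank bound comes from the column operator: the range of the block at x, y lies in
  the span of the entries \<open>k x z\<close> with z in the ball around x, at most M
  vectors.\<close>

lemma Egt_Elt_UC:
  fixes \<xi> :: "('x::metric_space, 'x \<times> nat) opr"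
  assumes bg: "bounded_geometry TYPE('x)" and p: "1 \<le> p" and \<xi>: "\<xi> \<in> Egt_alg p" and \<eta>: "\<eta> \<in> Elt_alg p"
  shows "\<xi> \<circ> \<eta> \<in> UC p"
proof -
  obtain k R M C where \<xi>_eq: "\<xi> = column_op p k"
    and M: "\<And>x :: 'x. ball_bound R M x"
    and R: "\<And>x y. R < dist x y \<Longrightarrow> k x y = 0" and k: "\<And>x y. k x y \<in> Lp p" and C: "\<And>x y. lp_norm p (k x y) \<le> C"
    using Egt_algE[OF bg \<xi>] by blast
  obtain R' where R': "\<eta> \<in> fprop p fst id R'" using \<eta> unfolding Elt_alg_eq[OF bg p] by blast
  have "\<xi> \<circ> \<eta> \<in> fprop p fst fst (R' + R)"
    unfolding \<xi>_eq by (rule fprop_comp[OF p R' column_op_fprop[OF p M R k C]])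
  moreover have "\<exists>V. finite V \<and> card V \<le> M \<and> range (block (\<xi> \<circ> \<eta>) x y) \<subseteq> cfun.span V" for x y
  proof (intro exI[of _ "k x ` cball x R"] conjI)
    show "finite (k x ` cball x R)" using M by blast
    show "card (k x ` cball x R) \<le> M" using card_image_le[of "cball x R" "k x"] M[of x] by linarith
    have "block (\<xi> \<circ> \<eta>) x y v \<in> cfun.span (k x ` cball x R)" for v
    proof -
      have "block (\<xi> \<circ> \<eta>) x y v = slice x (\<xi> (\<eta> (emb y v)))" by (simp add: block_eq)
      also have "\<dots> = (\<Sum>z\<in>cball x R. fscale (\<eta> (emb y v) z) (k x z))"
        unfolding \<xi>_eq by (rule column_op_apply[OF p M R k C bops_Lp[OF fprop_bops[OF R']]])
      also have "\<dots> \<in> cfun.span (k x ` cball x R)"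
        by (intro cfun.span_sum cfun.span_scale cfun.span_base) simp
      finally show ?thesis .
    qed
    then show "range (block (\<xi> \<circ> \<eta>) x y) \<subseteq> cfun.span (k x ` cball x R)" by blast
  qed
  ultimately show ?thesis unfolding UC_iff[OF p] by blast
qed

section \<open>The ideal correspondence\<close>


lemma Lq_basis_fn:
  assumes p: "1 \<le> p"
  shows "basis_fn i \<in> Lq p" and "lq_norm p (basis_fn i) \<le> 1"
proof -
  have "basis_fn i \<in> Lq p \<and> lq_norm p (basis_fn i) \<le> 1"
  proof (cases "p = 1")
    case True
    have "cmod (basis_fn i j) \<le> 1" for j by (simp add: basis_fn_def)
    then show ?thesis using True by (auto intro!: cSUP_least bdd_aboveI2[where M = 1])
  next
    case False
    then have "1 < p" using p by simp
    then show ?thesis using conj_exponent(1)[of p] by (simp add: lq_gt_1)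
  qed
  then show "basis_fn i \<in> Lq p" "lq_norm p (basis_fn i) \<le> 1" by auto
qed

section \<open>Transfer from \<open>lp_sum p\<close> to \<open>lp p\<close>; composition with spans
  and closures\<close>

lemma op_closure_cong:
  assumes "fst E = fst E'" "fst F = Lp p"
    and "\<And>f. f \<in> fst E' \<Longrightarrow> snd E f = snd E' f" "\<And>f. f \<in> Lp p \<Longrightarrow> snd F f = lp_norm p f"
    and p: "1 \<le> p" and S: "S \<subseteq> bounded_ops E' (lp p)"
  shows "op_closure E F S = op_closure E' (lp p) S"
proof -
  have b: "bounded_ops E F = bounded_ops E' (lp p)"
    by (rule bounded_ops_cong) (use assms in auto)
  have n: "op_norm E F (T - R) = op_norm E' (lp p) (T - R)"
    if "T \<in> bounded_ops E' (lp p)" "R \<in> S" for T R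
  proof (rule op_norm_cong)
    fix f assume f: "f \<in> fst E'"
    have "T f \<in> Lp p" "R f \<in> Lp p" using that S f by (auto simp: bounded_ops_def)
    then show "(T - R) f \<in> fst (lp p)" using Lp_diff[OF p, of "T f" "R f"] by simp
  qed (use assms in auto)
  show ?thesis
    unfolding op_closure_def b using n by (auto cong: conj_cong bex_cong)
qed

lemma op_closure_lp_sum:
  fixes S :: "('x \<times> nat, 'x \<times> nat) opr set"
  assumes p: "1 \<le> p" and S: "S \<subseteq> bops p"
  shows "op_closure (lp_sum p) (lp_sum p) S = cl_lp p S"
proof -
  have "op_closure (lp_sum p) (lp_sum p) S = op_closure (lp p) (lp p) S"
    by (rule op_closure_cong[OF _ _ _ _ p S]) (simp_all add: fst_lp_sum[OF p] snd_lp_sum[OF p])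
  then show ?thesis .
qed

lemma closed_ideal_lp_sum_iff:
  fixes J :: "('x \<times> nat, 'x \<times> nat) opr set"
  assumes p: "1 \<le> p" and A: "A \<subseteq> bops p"
  shows "closed_ideal (lp_sum p) A J \<longleftrightarrow> closed_ideal (lp p) A J"
  unfolding closed_ideal_def using op_closure_lp_sum[OF p, of J] A by auto

lemma geometric_lp_sum_iff:
  fixes J :: "('x \<times> nat, 'x \<times> nat) opr set"
  assumes p: "1 \<le> p" and A: "A\<^sub>0 \<subseteq> bops p"
  shows "geometric (lp_sum p) A\<^sub>0 J \<longleftrightarrow> geometric (lp p) A\<^sub>0 J"
  unfolding geometric_def using op_closure_lp_sum[OF p, of "J \<inter> A\<^sub>0"] A by auto

lemma closed_idealD:
  assumes "closed_ideal (lp p) A J"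
  shows "J \<subseteq> A" "cop.subspace J" "\<And>a j. a \<in> A \<Longrightarrow> j \<in> J \<Longrightarrow> a \<circ> j \<in> J"
    "\<And>a j. a \<in> A \<Longrightarrow> j \<in> J \<Longrightarrow> j \<circ> a \<in> J" "cl_lp p J = J"
  using assms by (auto simp: closed_ideal_def)

text \<open>Composition with \<open>a\<close> on the left is additive on operators into the carrier,
  so the subspace in question is cut down to \<open>bops p\<close>. In
  \<open>span_comp_right\<close> additivity is pointwise and holds for all functions.\<close>

lemma span_comp_left:
  fixes a :: "('j, 'k) opr" and G :: "('i, 'j) opr set"
  assumes p: "1 \<le> p" and a: "a \<in> bops p" and G: "G \<subseteq> bops p" and U: "cop.subspace U"
    and mem: "\<And>g. g \<in> G \<Longrightarrow> a \<circ> g \<in> U" and s: "s \<in> cop.span G"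
  shows "a \<circ> s \<in> U"
proof -
  have "cop.span G \<subseteq> {s \<in> bops p. a \<circ> s \<in> U}"
  proof (rule cop.span_minimal)
    show "cop.subspace {s \<in> bops p. a \<circ> s \<in> U}"
    proof (rule cop.subspaceI)
      have "a \<circ> (0 :: ('i, 'j) opr) = 0" using bops_zero[OF a] by (simp add: fun_eq_iff)
      then show "0 \<in> {s \<in> bops p. a \<circ> s \<in> U}" using cop.subspace_0[OF U] bops_0 by auto
    next
      fix s t assume "s \<in> {s \<in> bops p. a \<circ> s \<in> U}" "t \<in> {s \<in> bops p. a \<circ> s \<in> U}"
      then have st: "s \<in> bops p" "t \<in> bops p" "a \<circ> s \<in> U" "a \<circ> t \<in> U" by auto
      have "a \<circ> (s + t) \<in> U"
        unfolding bops_comp_distrib_left[OF p a st(1,2)] by (rule cop.subspace_add[OF U st(3,4)])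
      then show "s + t \<in> {s \<in> bops p. a \<circ> s \<in> U}" using bops_plus[OF p st(1,2)] by blast
    next
      fix c s assume "s \<in> {s \<in> bops p. a \<circ> s \<in> U}"
      then have s: "s \<in> bops p" "a \<circ> s \<in> U" by auto
      have "a \<circ> oscale c s \<in> U"
        unfolding bops_comp_oscale_left[OF a s(1)] by (rule cop.subspace_scale[OF U s(2)])
      then show "oscale c s \<in> {s \<in> bops p. a \<circ> s \<in> U}" using bops_oscale[OF p s(1)] by blast
    qed
  qed (use G mem in blast)
  then show ?thesis using s by blast
qed

lemma span_comp_right:
  fixes a :: "('i, 'j) opr" and G :: "('j, 'k) opr set"
  assumes U: "cop.subspace U" and mem: "\<And>g. g \<in> G \<Longrightarrow> g \<circ> a \<in> U" and s: "s \<in> cop.span G"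
  shows "s \<circ> a \<in> U"
proof -
  have "cop.span G \<subseteq> {s. s \<circ> a \<in> U}"
  proof (rule cop.span_minimal)
    show "cop.subspace {s. s \<circ> a \<in> U}"
    proof (rule cop.subspaceI)
      have "0 \<circ> a = (0 :: ('i, 'k) opr)" by (simp add: fun_eq_iff)
      then show "0 \<in> {s. s \<circ> a \<in> U}" using cop.subspace_0[OF U] by (simp del: o_apply)
    next
      fix s t assume "s \<in> {s. s \<circ> a \<in> U}" "t \<in> {s. s \<circ> a \<in> U}"
      then show "s + t \<in> {s. s \<circ> a \<in> U}"
        unfolding mem_Collect_eq comp_distrib_right(1) by (rule cop.subspace_add[OF U])
    next
      fix c s assume "s \<in> {s. s \<circ> a \<in> U}"
      then show "oscale c s \<in> {s. s \<circ> a \<in> U}"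
        unfolding mem_Collect_eq comp_oscale_right by (rule cop.subspace_scale[OF U])
    qed
  qed (use mem in blast)
  then show ?thesis using s by blast
qed

lemma cl_comp_left:
  assumes p: "1 \<le> p" and a: "a \<in> bops p" and S: "S \<subseteq> bops p" and s: "s \<in> cl_lp p S"
    and U: "\<And>s. s \<in> S \<Longrightarrow> a \<circ> s \<in> U"
  shows "a \<circ> s \<in> cl_lp p U"
proof (rule cl_lp_comp[OF p _ S _ s])
  show "{a} \<subseteq> bops p" using a by blast
  then show "a \<in> cl_lp p {a}" using cl_lp_superset by blast
  show "b \<circ> t \<in> U" if "b \<in> {a}" "t \<in> S" for b t using that U[of t] by blast
qed

lemma cl_comp_right:
  assumes p: "1 \<le> p" and a: "a \<in> bops p" and S: "S \<subseteq> bops p" and s: "s \<in> cl_lp p S"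
    and U: "\<And>s. s \<in> S \<Longrightarrow> s \<circ> a \<in> U"
  shows "s \<circ> a \<in> cl_lp p U"
proof (rule cl_lp_comp[OF p S _ s])
  show "{a} \<subseteq> bops p" using a by blast
  then show "a \<in> cl_lp p {a}" using cl_lp_superset by blast
  show "t \<circ> b \<in> U" if "t \<in> S" "b \<in> {a}" for b t using that U[of t] by blast
qed

section \<open>Algebras and modules over a fixed space of bounded geometry\<close>

context
  fixes p :: real
  assumes bg: "bounded_geometry TYPE('x::metric_space)" and p: "1 \<le> p"
begin

abbreviation (input) "CU \<equiv> Cu p :: ('x, 'x) opr set"
abbreviation (input) "BU \<equiv> Bu p :: ('x, 'x) opr set"
abbreviation (input) "UCX \<equiv> UC p :: ('x \<times> nat, 'x \<times> nat) opr set"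
abbreviation (input) "UBX \<equiv> UB p :: ('x \<times> nat, 'x \<times> nat) opr set"
abbreviation (input) "Gt0 \<equiv> Egt_alg p :: ('x, 'x \<times> nat) opr set"
abbreviation (input) "Gt \<equiv> Egt p :: ('x, 'x \<times> nat) opr set"
abbreviation (input) "Lt0 \<equiv> Elt_alg p :: ('x \<times> nat, 'x) opr set"
abbreviation (input) "Lt \<equiv> Elt p :: ('x \<times> nat, 'x) opr set"

lemma UC_fprop: "T \<in> UCX \<Longrightarrow> T \<in> (\<Union>R. fprop p fst fst R)"
  unfolding UC_iff[OF p] by blast

lemma alg_bops: "CU \<subseteq> bops p" "UCX \<subseteq> bops p" "Gt0 \<subseteq> bops p" "Lt0 \<subseteq> bops p"
  unfolding Cu_eq[OF bg p] Egt_alg_eq[OF bg p] Elt_alg_eq[OF bg p]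
  by (auto dest!: UC_fprop intro: fprop_bops)

lemma Bu_eq: "BU = cl_lp p CU"
  by (simp add: Bu_def)

lemma UB_eq: "UBX = cl_lp p UCX"
  unfolding UB_def by (rule op_closure_lp_sum[OF p alg_bops(2)])

lemma Egt_eq: "Gt = cl_lp p Gt0"
  unfolding Egt_def
  by (rule op_closure_cong[OF _ _ _ _ p alg_bops(3)]) (simp_all add: fst_lp_sum[OF p] snd_lp_sum[OF p])

lemma Elt_eq: "Lt = cl_lp p Lt0"
  unfolding Elt_def
  by (rule op_closure_cong[OF _ _ _ _ p alg_bops(4)]) (simp_all add: fst_lp_sum[OF p] snd_lp_sum[OF p])

lemma cl_bops: "BU \<subseteq> bops p" "UBX \<subseteq> bops p" "Gt \<subseteq> bops p" "Lt \<subseteq> bops p"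
  unfolding Bu_eq UB_eq Egt_eq Elt_eq by (rule cl_lp_subset_bops)+

lemma alg_subset: "CU \<subseteq> BU" "UCX \<subseteq> UBX" "Gt0 \<subseteq> Gt" "Lt0 \<subseteq> Lt"
  unfolding Bu_eq UB_eq Egt_eq Elt_eq by (rule cl_lp_superset, rule alg_bops)+

lemma cl_closed: "cl_lp p BU = BU" "cl_lp p UBX = UBX" "cl_lp p Gt = Gt"
  unfolding Bu_eq UB_eq Egt_eq by (rule cl_lp_idem[OF p], rule alg_bops)+

lemma Union_fprop_comp:
  assumes "S \<in> (\<Union>R. fprop p \<pi> \<sigma> R)" "T \<in> (\<Union>R. fprop p \<sigma> \<tau> R)"
  shows "T \<circ> S \<in> (\<Union>R. fprop p \<pi> \<tau> R)"
proof -
  obtain R R' where "S \<in> fprop p \<pi> \<sigma> R" "T \<in> fprop p \<sigma> \<tau> R'" using assms by blast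
  then have "T \<circ> S \<in> fprop p \<pi> \<tau> (R + R')" by (rule fprop_comp[OF p])
  then show ?thesis by blast
qed

text \<open>Propagations add under composition; for \<open>\<xi> \<circ> \<eta>\<close> the rank
  bound of \<open>Egt_Elt_UC\<close> comes on top.\<close>

lemma alg_comp:
  "\<eta> \<in> Lt0 \<Longrightarrow> \<xi> \<in> Gt0 \<Longrightarrow> \<eta> \<circ> \<xi> \<in> CU"
  "\<xi> \<in> Gt0 \<Longrightarrow> \<eta> \<in> Lt0 \<Longrightarrow> \<xi> \<circ> \<eta> \<in> UCX"
  "T \<in> UCX \<Longrightarrow> \<xi> \<in> Gt0 \<Longrightarrow> T \<circ> \<xi> \<in> Gt0"
  "\<eta> \<in> Lt0 \<Longrightarrow> T \<in> UCX \<Longrightarrow> \<eta> \<circ> T \<in> Lt0"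
  "b \<in> CU \<Longrightarrow> \<eta> \<in> Lt0 \<Longrightarrow> b \<circ> \<eta> \<in> Lt0"
  "\<xi> \<in> Gt0 \<Longrightarrow> b \<in> CU \<Longrightarrow> \<xi> \<circ> b \<in> Gt0"
  "b \<in> CU \<Longrightarrow> c \<in> CU \<Longrightarrow> b \<circ> c \<in> CU"
proof -
  note eqs = Cu_eq[OF bg p] Egt_alg_eq[OF bg p] Elt_alg_eq[OF bg p]
  show "\<eta> \<in> Lt0 \<Longrightarrow> \<xi> \<in> Gt0 \<Longrightarrow> \<eta> \<circ> \<xi> \<in> CU" "b \<in> CU \<Longrightarrow> \<eta> \<in> Lt0 \<Longrightarrow> b \<circ> \<eta> \<in> Lt0"
    "\<xi> \<in> Gt0 \<Longrightarrow> b \<in> CU \<Longrightarrow> \<xi> \<circ> b \<in> Gt0" "b \<in> CU \<Longrightarrow> c \<in> CU \<Longrightarrow> b \<circ> c \<in> CU"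
    unfolding eqs by (rule Union_fprop_comp; assumption)+
  show "\<xi> \<in> Gt0 \<Longrightarrow> \<eta> \<in> Lt0 \<Longrightarrow> \<xi> \<circ> \<eta> \<in> UCX" by (rule Egt_Elt_UC[OF bg p])
  show "T \<in> UCX \<Longrightarrow> \<xi> \<in> Gt0 \<Longrightarrow> T \<circ> \<xi> \<in> Gt0"
    unfolding eqs by (rule Union_fprop_comp[OF _ UC_fprop]; assumption)
  show "\<eta> \<in> Lt0 \<Longrightarrow> T \<in> UCX \<Longrightarrow> \<eta> \<circ> T \<in> Lt0"
    unfolding eqs by (rule Union_fprop_comp[OF UC_fprop]; assumption)
qed

lemma cl_comp:
  "\<eta> \<in> Lt \<Longrightarrow> \<xi> \<in> Gt \<Longrightarrow> \<eta> \<circ> \<xi> \<in> BU"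
  "\<xi> \<in> Gt \<Longrightarrow> \<eta> \<in> Lt \<Longrightarrow> \<xi> \<circ> \<eta> \<in> UBX"
  "T \<in> UBX \<Longrightarrow> \<xi> \<in> Gt \<Longrightarrow> T \<circ> \<xi> \<in> Gt"
  "\<eta> \<in> Lt \<Longrightarrow> T \<in> UBX \<Longrightarrow> \<eta> \<circ> T \<in> Lt"
  "b \<in> BU \<Longrightarrow> \<eta> \<in> Lt \<Longrightarrow> b \<circ> \<eta> \<in> Lt"
  "\<xi> \<in> Gt \<Longrightarrow> b \<in> BU \<Longrightarrow> \<xi> \<circ> b \<in> Gt"
  "b \<in> BU \<Longrightarrow> c \<in> BU \<Longrightarrow> b \<circ> c \<in> BU"
proof -
  note eqs = Bu_eq UB_eq Egt_eq Elt_eq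
  show "\<eta> \<in> Lt \<Longrightarrow> \<xi> \<in> Gt \<Longrightarrow> \<eta> \<circ> \<xi> \<in> BU"
    unfolding eqs by (rule cl_lp_comp[OF p alg_bops(4) alg_bops(3) _ _ alg_comp(1)])
  show "\<xi> \<in> Gt \<Longrightarrow> \<eta> \<in> Lt \<Longrightarrow> \<xi> \<circ> \<eta> \<in> UBX"
    unfolding eqs by (rule cl_lp_comp[OF p alg_bops(3) alg_bops(4) _ _ alg_comp(2)])
  show "T \<in> UBX \<Longrightarrow> \<xi> \<in> Gt \<Longrightarrow> T \<circ> \<xi> \<in> Gt"
    unfolding eqs by (rule cl_lp_comp[OF p alg_bops(2) alg_bops(3) _ _ alg_comp(3)])
  show "\<eta> \<in> Lt \<Longrightarrow> T \<in> UBX \<Longrightarrow> \<eta> \<circ> T \<in> Lt"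
    unfolding eqs by (rule cl_lp_comp[OF p alg_bops(4) alg_bops(2) _ _ alg_comp(4)])
  show "b \<in> BU \<Longrightarrow> \<eta> \<in> Lt \<Longrightarrow> b \<circ> \<eta> \<in> Lt"
    unfolding eqs by (rule cl_lp_comp[OF p alg_bops(1) alg_bops(4) _ _ alg_comp(5)])
  show "\<xi> \<in> Gt \<Longrightarrow> b \<in> BU \<Longrightarrow> \<xi> \<circ> b \<in> Gt"
    unfolding eqs by (rule cl_lp_comp[OF p alg_bops(3) alg_bops(1) _ _ alg_comp(6)])
  show "b \<in> BU \<Longrightarrow> c \<in> BU \<Longrightarrow> b \<circ> c \<in> BU"
    unfolding eqs by (rule cl_lp_comp[OF p alg_bops(1) alg_bops(1) _ _ alg_comp(7)])
qed

lemma UC_sub: "cop.subspace UCX"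
  by (rule UC_subspace[OF p])

lemma cl_sub: "cop.subspace BU" "cop.subspace UBX"
proof -
  show "cop.subspace BU"
    unfolding Bu_eq by (rule cl_lp_subspace[OF p alg_bops(1)]) (unfold Cu_eq[OF bg p], rule Union_fprop_subspace[OF p])
  show "cop.subspace UBX"
    unfolding UB_eq by (rule cl_lp_subspace[OF p alg_bops(2) UC_sub])
qed

section \<open>The copy of \<open>Bu p\<close> as a corner of \<open>UB p\<close>\<close>

definition \<xi>\<^sub>0 :: "('x, 'x \<times> nat) opr" where
  "\<xi>\<^sub>0 = column_op p (diag_kernel (\<lambda>_. basis_fn 0))"

definition \<eta>\<^sub>0 :: "('x \<times> nat, 'x) opr" where
  "\<eta>\<^sub>0 = row_op p (diag_kernel (\<lambda>_. basis_fn 0))"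

lemma unit_mem0: "\<xi>\<^sub>0 \<in> Gt0" "\<eta>\<^sub>0 \<in> Lt0"
proof -
  have "\<xi>\<^sub>0 \<in> fprop p id fst 0"
    unfolding \<xi>\<^sub>0_def by (rule diag_column_fprop[OF p, where C = 1]) (use p in auto)
  then show "\<xi>\<^sub>0 \<in> Gt0" unfolding Egt_alg_eq[OF bg p] by blast
  have "\<eta>\<^sub>0 \<in> fprop p fst id 0"
    unfolding \<eta>\<^sub>0_def by (rule diag_row_fprop[OF p, where C = 1]) (rule Lq_basis_fn[OF p])+
  then show "\<eta>\<^sub>0 \<in> Lt0" unfolding Elt_alg_eq[OF bg p] by blast
qed

lemma unit_mem: "\<xi>\<^sub>0 \<in> Gt" "\<eta>\<^sub>0 \<in> Lt"
  using unit_mem0 alg_subset by blast+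

lemma unit_bops: "\<xi>\<^sub>0 \<in> bops p" "\<eta>\<^sub>0 \<in> bops p"
  using unit_mem cl_bops by blast+

text \<open>The unit vector pairs with itself to 1 at each x. The identity holds on the carrier
  only, since off it the composite is 0; hence it is used through \<open>unit_left\<close> and
  \<open>unit_right\<close>, next to an operator.\<close>

lemma unit_apply:
  assumes f: "f \<in> Lp p"
  shows "\<eta>\<^sub>0 (\<xi>\<^sub>0 f) = f"
proof
  fix x
  have "\<eta>\<^sub>0 (\<xi>\<^sub>0 f) x = pairing (basis_fn 0) (slice x (\<xi>\<^sub>0 f))"
    unfolding \<eta>\<^sub>0_def
    by (rule diag_row_apply[OF p, where C = 1]) (rule Lq_basis_fn[OF p] bops_Lp[OF unit_bops(1)])+
  also have "slice x (\<xi>\<^sub>0 f) = fscale (f x) (basis_fn 0)"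
    unfolding \<xi>\<^sub>0_def by (rule diag_column_apply[OF p, where C = 1]) (use p f in auto)
  finally show "\<eta>\<^sub>0 (\<xi>\<^sub>0 f) x = f x"
    unfolding pairing_scale pairing_basis_fn by (simp add: basis_fn_def)
qed

lemma unit_left: "b \<in> bops p \<Longrightarrow> \<eta>\<^sub>0 \<circ> (\<xi>\<^sub>0 \<circ> b) = b"
  by (rule ext) (simp add: unit_apply bops_Lp)

lemma unit_right:
  assumes b: "b \<in> bops p"
  shows "b \<circ> (\<eta>\<^sub>0 \<circ> \<xi>\<^sub>0) = b"
proof
  fix f show "(b \<circ> (\<eta>\<^sub>0 \<circ> \<xi>\<^sub>0)) f = b f"
    using bops_outside[OF b, of f] bops_outside[OF unit_bops(1), of f] bops_zero[OF unit_bops(2)] bops_zero[OF b]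
    by (cases "f \<in> Lp p") (simp_all add: unit_apply)
qed

lemma corner:
  assumes b: "b \<in> bops p"
  shows "\<eta>\<^sub>0 \<circ> (\<xi>\<^sub>0 \<circ> b \<circ> \<eta>\<^sub>0) \<circ> \<xi>\<^sub>0 = b"
proof -
  have "\<eta>\<^sub>0 \<circ> (\<xi>\<^sub>0 \<circ> b \<circ> \<eta>\<^sub>0) \<circ> \<xi>\<^sub>0 = (\<eta>\<^sub>0 \<circ> (\<xi>\<^sub>0 \<circ> b)) \<circ> (\<eta>\<^sub>0 \<circ> \<xi>\<^sub>0)"
    by (simp only: comp_assoc)
  then show ?thesis by (simp only: unit_left[OF b] unit_right[OF b])
qed

section \<open>Induced ideals\<close>

definition ind_gens :: "('x, 'x) opr set \<Rightarrow> ('x \<times> nat, 'x \<times> nat) opr set" where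
  "ind_gens I = {\<xi> \<circ> \<eta> | \<xi> \<eta>. \<xi> \<in> Egt_ideal p I \<and> \<eta> \<in> Lt}"

lemma ind_gens_UB: "ind_gens I \<subseteq> UBX"
proof
  fix g assume "g \<in> ind_gens I"
  then obtain \<xi> \<eta> where "g = \<xi> \<circ> \<eta>" "\<xi> \<in> Gt" "\<eta> \<in> Lt"
    unfolding ind_gens_def Egt_ideal_def by blast
  then show "g \<in> UBX" using cl_comp(2) by (simp only:)
qed

lemma span_gens_UB: "cop.span (ind_gens I) \<subseteq> UBX"
  by (rule cop.span_minimal[OF ind_gens_UB cl_sub(2)])

lemma span_gens_bops: "cop.span (ind_gens I) \<subseteq> bops p"
  using span_gens_UB cl_bops(2) by blast

lemma Ind_eq: "Ind p I = cl_lp p (cop.span (ind_gens I))"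
  unfolding Ind_def ind_gens_def[symmetric] by (rule op_closure_lp_sum[OF p span_gens_bops])

lemma Ind_closed: "cl_lp p (Ind p I) = Ind p I" for I :: "('x, 'x) opr set"
  unfolding Ind_eq by (rule cl_lp_idem[OF p span_gens_bops])

lemma Ind_UB: "Ind p I \<subseteq> UBX"
  unfolding Ind_eq by (rule cl_lp_minimal[OF span_gens_UB cl_closed(2)])

lemma Ind_subspace: "cop.subspace (Ind p I)" for I :: "('x, 'x) opr set"
  unfolding Ind_eq by (rule cl_lp_subspace[OF p span_gens_bops cop.subspace_span])

lemma IndI: "\<xi> \<in> Egt_ideal p I \<Longrightarrow> \<eta> \<in> Lt \<Longrightarrow> \<xi> \<circ> \<eta> \<in> Ind p I"
  unfolding Ind_eq
  by (rule subsetD[OF cl_lp_superset[OF span_gens_bops]], rule cop.span_base) (auto simp: ind_gens_def)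

lemma Ind_mono: "I \<subseteq> J \<Longrightarrow> Ind p I \<subseteq> Ind p J" for I J :: "('x, 'x) opr set"
  unfolding Ind_eq
  by (intro cl_lp_mono cop.span_mono) (auto simp: ind_gens_def Egt_ideal_def)

lemma Ind_subset:
  assumes "ind_gens I \<subseteq> J" "cop.subspace J" "cl_lp p J = J"
  shows "Ind p I \<subseteq> J"
  unfolding Ind_eq by (rule cl_lp_minimal[OF cop.span_minimal[OF assms(1,2)] assms(3)])

lemma Egt_idealD: "\<xi> \<in> Egt_ideal p I \<Longrightarrow> \<xi> \<in> Gt" "\<xi> \<in> Egt_ideal p I \<Longrightarrow> \<eta> \<in> Lt \<Longrightarrow> \<eta> \<circ> \<xi> \<in> I"
  by (auto simp: Egt_ideal_def)

text \<open>Pairing with a row gives \<open>(\<eta> \<circ> \<xi>) \<circ> b\<close>, a product of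
  an element of the algebra with one of I.\<close>

lemma Egt_idealI:
  assumes I: "closed_ideal (lp p) BU I" and \<xi>: "\<xi> \<in> Gt" and b: "b \<in> I"
  shows "\<xi> \<circ> b \<in> Egt_ideal p I"
proof -
  have "\<eta> \<circ> (\<xi> \<circ> b) \<in> I" if "\<eta> \<in> Lt" for \<eta>
    using closed_idealD(3)[OF I cl_comp(1)[OF that \<xi>] b] by (simp only: comp_assoc)
  moreover have "\<xi> \<circ> b \<in> Gt" using cl_comp(6)[OF \<xi>] closed_idealD(1)[OF I] b by blast
  ultimately show ?thesis by (simp add: Egt_ideal_def)
qed

text \<open>Testing \<open>a \<circ> \<xi>\<close> against a row \<open>\<zeta>\<close> is testing
  \<open>\<xi>\<close> against the row \<open>\<zeta> \<circ> a\<close>, so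
  \<open>Egt_ideal p I\<close> absorbs the algebra on the left; on the right it is absorbed by
  \<open>\<eta>\<close>. Spans and closures follow by linearity and continuity.\<close>

lemma Ind_closed_ideal:
  assumes I: "closed_ideal (lp p) BU I"
  shows "closed_ideal (lp p) UBX (Ind p I)"
  unfolding closed_ideal_def
proof (intro conjI ballI Ind_UB Ind_subspace Ind_closed)
  fix a j assume a: "a \<in> UBX" and j: "j \<in> Ind p I"
  have ab: "a \<in> bops p" using a cl_bops by blast
  have "a \<circ> j \<in> cl_lp p (cop.span (ind_gens I))"
  proof (rule cl_comp_left[OF p ab span_gens_bops j[unfolded Ind_eq]])
    fix s assume "s \<in> cop.span (ind_gens I)"
    then show "a \<circ> s \<in> cop.span (ind_gens I)"
    proof (rule span_comp_left[OF p ab subset_trans[OF ind_gens_UB cl_bops(2)] cop.subspace_span, rotated])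
      fix g assume "g \<in> ind_gens I"
      then obtain \<xi> \<eta> where g: "g = \<xi> \<circ> \<eta>" and \<xi>: "\<xi> \<in> Egt_ideal p I" and \<eta>: "\<eta> \<in> Lt"
        unfolding ind_gens_def by blast
      have "\<zeta> \<circ> (a \<circ> \<xi>) \<in> I" if "\<zeta> \<in> Lt" for \<zeta>
        using Egt_idealD(2)[OF \<xi> cl_comp(4)[OF that a]] by (simp only: comp_assoc)
      then have "a \<circ> \<xi> \<in> Egt_ideal p I"
        using cl_comp(3)[OF a Egt_idealD(1)[OF \<xi>]] by (simp add: Egt_ideal_def)
      then have "(a \<circ> \<xi>) \<circ> \<eta> \<in> ind_gens I" using \<eta> unfolding ind_gens_def by blast
      then show "a \<circ> g \<in> cop.span (ind_gens I)" unfolding g comp_assoc by (rule cop.span_base)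
    qed
  qed
  then show "a \<circ> j \<in> Ind p I" unfolding Ind_eq .
  have "j \<circ> a \<in> cl_lp p (cop.span (ind_gens I))"
  proof (rule cl_comp_right[OF p ab span_gens_bops j[unfolded Ind_eq]])
    fix s assume "s \<in> cop.span (ind_gens I)"
    then show "s \<circ> a \<in> cop.span (ind_gens I)"
    proof (rule span_comp_right[OF cop.subspace_span, rotated])
      fix g assume "g \<in> ind_gens I"
      then obtain \<xi> \<eta> where g: "g = \<xi> \<circ> \<eta>" and \<xi>: "\<xi> \<in> Egt_ideal p I" and \<eta>: "\<eta> \<in> Lt"
        unfolding ind_gens_def by blast
      have "\<xi> \<circ> (\<eta> \<circ> a) \<in> ind_gens I"
        using \<xi> cl_comp(4)[OF \<eta> a] unfolding ind_gens_def by blast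
      then show "g \<circ> a \<in> cop.span (ind_gens I)" unfolding g comp_assoc by (rule cop.span_base)
    qed
  qed
  then show "j \<circ> a \<in> Ind p I" unfolding Ind_eq .
qed

text \<open>Forward, \<open>\<xi>\<^sub>0 \<circ> b\<close> lies in the module of I. Backward,
  compression by \<open>\<eta>\<^sub>0\<close> and \<open>\<xi>\<^sub>0\<close> is linear and
  continuous, sends a generator to \<open>(\<eta>\<^sub>0 \<circ> \<xi>) \<circ> (\<eta> \<circ>
  \<xi>\<^sub>0)\<close>, which is in I, and sends the corner element back to b.\<close>

lemma mem_ideal_iff_Ind:
  assumes I: "closed_ideal (lp p) BU I" and b: "b \<in> BU"
  shows "b \<in> I \<longleftrightarrow> \<xi>\<^sub>0 \<circ> b \<circ> \<eta>\<^sub>0 \<in> Ind p I"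
proof
  assume "b \<in> I"
  then show "\<xi>\<^sub>0 \<circ> b \<circ> \<eta>\<^sub>0 \<in> Ind p I"
    by (intro IndI Egt_idealI[OF I unit_mem(1)] unit_mem(2))
next
  note Is = closed_idealD(2)[OF I]
  assume j: "\<xi>\<^sub>0 \<circ> b \<circ> \<eta>\<^sub>0 \<in> Ind p I"
  let ?C = "{\<eta>\<^sub>0 \<circ> s | s. s \<in> cop.span (ind_gens I)}"
  have 1: "\<eta>\<^sub>0 \<circ> s \<circ> \<xi>\<^sub>0 \<in> I" if s: "s \<in> cop.span (ind_gens I)" for s
    unfolding comp_assoc
  proof (rule span_comp_left[OF p unit_bops(2) _ Is])
    show "s \<circ> \<xi>\<^sub>0 \<in> cop.span ((\<lambda>g. g \<circ> \<xi>\<^sub>0) ` ind_gens I)"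
      by (rule span_comp_right[OF cop.subspace_span _ s]) (auto intro: cop.span_base)
    show "(\<lambda>g. g \<circ> \<xi>\<^sub>0) ` ind_gens I \<subseteq> bops p"
      using ind_gens_UB cl_bops(2) bops_comp[OF p _ unit_bops(1)] by blast
    fix h assume "h \<in> (\<lambda>g. g \<circ> \<xi>\<^sub>0) ` ind_gens I"
    then obtain \<xi> \<eta> where h: "h = \<xi> \<circ> \<eta> \<circ> \<xi>\<^sub>0" and \<xi>: "\<xi> \<in> Egt_ideal p I" and \<eta>: "\<eta> \<in> Lt"
      unfolding ind_gens_def by blast
    have "(\<eta>\<^sub>0 \<circ> \<xi>) \<circ> (\<eta> \<circ> \<xi>\<^sub>0) \<in> I"
      by (rule closed_idealD(4)[OF I cl_comp(1)[OF \<eta> unit_mem(1)] Egt_idealD(2)[OF \<xi> unit_mem(2)]])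
    then show "\<eta>\<^sub>0 \<circ> h \<in> I" unfolding h by (simp only: comp_assoc)
  qed
  have C: "?C \<subseteq> bops p" using bops_comp[OF p unit_bops(2)] span_gens_bops by blast
  have "\<eta>\<^sub>0 \<circ> (\<xi>\<^sub>0 \<circ> b \<circ> \<eta>\<^sub>0) \<in> cl_lp p ?C"
    by (rule cl_comp_left[OF p unit_bops(2) span_gens_bops j[unfolded Ind_eq]]) blast
  then have "\<eta>\<^sub>0 \<circ> (\<xi>\<^sub>0 \<circ> b \<circ> \<eta>\<^sub>0) \<circ> \<xi>\<^sub>0 \<in> cl_lp p I"
    by (rule cl_comp_right[OF p unit_bops(1) C]) (use 1 in blast)
  then show "b \<in> I" using b cl_bops(1) closed_idealD(5)[OF I] corner[of b] by auto
qed

text \<open>By \<open>mem_ideal_iff_Ind\<close>, membership in an ideal is a condition on the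
  induced ideal alone.\<close>

lemma Ind_subset_iff:
  assumes I: "closed_ideal (lp p) BU I" and J: "closed_ideal (lp p) BU J"
  shows "I \<subseteq> J \<longleftrightarrow> Ind p I \<subseteq> Ind p J"
proof
  assume L: "Ind p I \<subseteq> Ind p J"
  show "I \<subseteq> J"
  proof
    fix b assume b: "b \<in> I"
    then have "b \<in> BU" using closed_idealD(1)[OF I] by blast
    then show "b \<in> J" using b L mem_ideal_iff_Ind[OF I] mem_ideal_iff_Ind[OF J] by blast
  qed
qed (rule Ind_mono)

text \<open>Applied to \<open>\<xi>\<close>, the operator P gives a sum of
  \<open>\<zeta> s \<circ> (\<eta> s \<circ> \<xi>)\<close>, whose inner factors are pairings and
  hence lie in I. Since P is built for an algebraic approximant \<open>\<xi>'\<close> and not for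
  \<open>\<xi>\<close>, its norm bound 1 enters the error.\<close>

lemma Egt_ideal_approx:
  assumes I: "closed_ideal (lp p) BU I" and \<xi>: "\<xi> \<in> Egt_ideal p I"
  shows "\<xi> \<in> cl_lp p (cop.span {\<zeta> \<circ> b | \<zeta> b. \<zeta> \<in> Gt0 \<and> b \<in> I})" (is "\<xi> \<in> cl_lp p ?S")
proof -
  have \<xi>G: "\<xi> \<in> Gt" by (rule Egt_idealD(1)[OF \<xi>])
  have \<xi>b: "\<xi> \<in> bops p" using \<xi>G cl_bops by blast
  have "\<exists>R\<in>?S. onorm_lp p (\<xi> - R) < e" if e: "0 < e" for e
  proof -
    obtain \<xi>' where \<xi>': "\<xi>' \<in> Gt0" "onorm_lp p (\<xi> - \<xi>') < e / 4"
      using cl_lp_approx[of \<xi> p Gt0 "e / 4"] \<xi>G e unfolding Egt_eq by auto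
    have \<xi>'b: "\<xi>' \<in> bops p" using \<xi>'(1) alg_bops by blast
    have "0 < e / 4" using e by simp
    then obtain r and \<zeta> :: "nat \<Rightarrow> ('x, 'x \<times> nat) opr" and \<eta> :: "nat \<Rightarrow> ('x \<times> nat, 'x) opr"
      where \<zeta>: "\<And>s. s < r \<Longrightarrow> \<zeta> s \<in> Gt0" and \<eta>: "\<And>s. s < r \<Longrightarrow> \<eta> s \<in> Lt0"
      and P1: "onorm_lp p (\<Sum>s<r. \<zeta> s \<circ> \<eta> s) \<le> 1"
      and P2: "onorm_lp p (((\<Sum>s<r. \<zeta> s \<circ> \<eta> s) \<circ> \<xi>') - \<xi>') \<le> e / 4"
      using left_approximate_unit[OF bg p \<xi>'(1)] by blast
    define P where "P = (\<Sum>s<r. \<zeta> s \<circ> \<eta> s)"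
    have Pb: "P \<in> bops p" unfolding P_def
      by (intro bops_finite_sum p bops_comp) (use \<zeta> \<eta> alg_bops in auto)
    have "P \<circ> \<xi> = (\<Sum>s<r. \<zeta> s \<circ> (\<eta> s \<circ> \<xi>))"
      by (simp add: P_def fun_eq_iff sum_fn_apply)
    moreover have "(\<Sum>s<r. \<zeta> s \<circ> (\<eta> s \<circ> \<xi>)) \<in> ?S"
    proof (rule cop.span_sum)
      fix s assume "s \<in> {..<r}"
      then have s: "s < r" by simp
      have "\<eta> s \<circ> \<xi> \<in> I" using Egt_idealD(2)[OF \<xi>] \<eta>[OF s] alg_subset(4) by blast
      then show "\<zeta> s \<circ> (\<eta> s \<circ> \<xi>) \<in> ?S" using \<zeta>[OF s] by (intro cop.span_base) blast
    qed
    ultimately have mem: "P \<circ> \<xi> \<in> ?S" by (simp only:)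
    let ?d = "\<xi> - \<xi>'"
    have db: "?d \<in> bops p" by (intro bops_minus_op p \<xi>b \<xi>'b)
    have Qb: "(P \<circ> \<xi>') - \<xi>' \<in> bops p" by (intro bops_minus_op bops_comp p Pb \<xi>'b)
    have "onorm_lp p (P \<circ> ?d) \<le> onorm_lp p P * onorm_lp p ?d" by (rule onorm_lp_comp[OF p Pb db])
    also have "\<dots> \<le> 1 * onorm_lp p ?d"
      by (intro mult_right_mono onorm_lp_nonneg db) (use P1 in \<open>simp only: P_def\<close>)
    finally have n1: "onorm_lp p (P \<circ> ?d) < e / 4" using \<xi>'(2) by simp
    have n2: "onorm_lp p ((P \<circ> \<xi>') - \<xi>') \<le> e / 4" using P2 by (simp only: P_def)
    have n3: "onorm_lp p (oscale (-1) (((P \<circ> \<xi>') - \<xi>') + (P \<circ> ?d)))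
        \<le> onorm_lp p (((P \<circ> \<xi>') - \<xi>') + (P \<circ> ?d))"
      using onorm_lp_oscale_le[OF p bops_plus[OF p Qb bops_comp[OF p Pb db]], of "-1"] by simp
    have n4: "onorm_lp p (((P \<circ> \<xi>') - \<xi>') + (P \<circ> ?d)) \<le> onorm_lp p ((P \<circ> \<xi>') - \<xi>') + onorm_lp p (P \<circ> ?d)"
      by (rule onorm_lp_triangle[OF p Qb bops_comp[OF p Pb db]])
    \<comment> \<open>Three errors of at most e/4 each: approximation of \<open>\<xi>\<close>, the
      action of P on \<open>\<xi>'\<close>, and P on the difference. Scaling by -1 supplies the sign
      in the triangle inequality.\<close>
    have "\<xi> - (P \<circ> \<xi>) = ?d + oscale (-1) (((P \<circ> \<xi>') - \<xi>') + (P \<circ> ?d))"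
      unfolding bops_comp_diff_left[OF p Pb \<xi>b \<xi>'b] oscale_minus1 by simp
    then have "onorm_lp p (\<xi> - (P \<circ> \<xi>)) \<le> onorm_lp p ?d + onorm_lp p (oscale (-1) (((P \<circ> \<xi>') - \<xi>') + (P \<circ> ?d)))"
      using onorm_lp_triangle[OF p db bops_oscale[OF p bops_plus[OF p Qb bops_comp[OF p Pb db]], of "-1"]]
      by (simp only:)
    then have "onorm_lp p (\<xi> - (P \<circ> \<xi>)) < e" using n1 n2 n3 n4 \<xi>'(2) e by linarith
    then show ?thesis using mem by blast
  qed
  then show ?thesis using \<xi>b by (simp add: cl_lp_iff)
qed

lemma Gt_I_bops:
  assumes I: "closed_ideal (lp p) BU I"
  shows "cop.span {\<zeta> \<circ> b | \<zeta> b. \<zeta> \<in> Gt0 \<and> b \<in> I} \<subseteq> bops p"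
proof (rule cop.span_minimal[OF _ bops_subspace[OF p]])
  show "{\<zeta> \<circ> b | \<zeta> b. \<zeta> \<in> Gt0 \<and> b \<in> I} \<subseteq> bops p"
    using bops_comp[OF p] alg_bops(3) closed_idealD(1)[OF I] cl_bops(1) by blast
qed

text \<open>Every ingredient of a generator is replaced by an algebraic one: \<open>\<xi>\<close> by
  sums of \<open>\<zeta> \<circ> b\<close>, then b by elements of I in \<open>Cu p\<close>, and
  \<open>\<eta>\<close> by algebraic rows. The resulting products lie both in the induced ideal and
  in \<open>UC p\<close>.\<close>

lemma geometric_Ind:
  assumes I: "closed_ideal (lp p) BU I" and geo: "geometric (lp p) CU I"
  shows "geometric (lp p) UCX (Ind p I)"
proof -
  let ?J = "Ind p I"
  let ?H = "{\<zeta> \<circ> b | \<zeta> b. \<zeta> \<in> Gt0 \<and> b \<in> I \<inter> CU}"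
  have cg: "cl_lp p (I \<inter> CU) = I" using geo by (simp add: geometric_def)
  have JU: "?J \<inter> UCX \<subseteq> bops p" using alg_bops by blast
  have JUs: "cop.subspace (?J \<inter> UCX)" by (rule cop.subspace_inter[OF Ind_subspace UC_sub])
  have Hb: "?H \<subseteq> bops p" using bops_comp[OF p] alg_bops by blast
  have sHb: "cop.span ?H \<subseteq> bops p" by (rule cop.span_minimal[OF Hb bops_subspace[OF p]])
  have sub: "cop.subspace (cl_lp p (cop.span ?H))" by (rule cl_lp_subspace[OF p sHb cop.subspace_span])
  have "{\<zeta> \<circ> b | \<zeta> b. \<zeta> \<in> Gt0 \<and> b \<in> I} \<subseteq> cl_lp p (cop.span ?H)"
  proof safe
    fix \<zeta> b assume \<zeta>: "\<zeta> \<in> Gt0" and b: "b \<in> I"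
    have \<zeta>b: "\<zeta> \<in> bops p" and IC: "I \<inter> CU \<subseteq> bops p" using \<zeta> alg_bops by auto
    show "\<zeta> \<circ> b \<in> cl_lp p (cop.span ?H)"
    proof (rule cl_comp_left[OF p \<zeta>b IC])
      show "b \<in> cl_lp p (I \<inter> CU)" using b cg by blast
      show "\<And>s. s \<in> I \<inter> CU \<Longrightarrow> \<zeta> \<circ> s \<in> cop.span ?H" using \<zeta> by (intro cop.span_base) blast
    qed
  qed
  then have "cop.span {\<zeta> \<circ> b | \<zeta> b. \<zeta> \<in> Gt0 \<and> b \<in> I} \<subseteq> cl_lp p (cop.span ?H)"
    by (rule cop.span_minimal[OF _ sub])
  then have *: "cl_lp p (cop.span {\<zeta> \<circ> b | \<zeta> b. \<zeta> \<in> Gt0 \<and> b \<in> I}) \<subseteq> cl_lp p (cop.span ?H)"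
    by (rule cl_lp_minimal[OF _ cl_lp_idem[OF p sHb]])
  have "?J \<subseteq> cl_lp p (?J \<inter> UCX)"
  proof (rule Ind_subset[OF _ cl_lp_subspace[OF p JU JUs] cl_lp_idem[OF p JU]])
    show "ind_gens I \<subseteq> cl_lp p (?J \<inter> UCX)"
    proof
      fix g assume "g \<in> ind_gens I"
      then obtain \<xi> \<eta> where g: "g = \<xi> \<circ> \<eta>" and \<xi>: "\<xi> \<in> Egt_ideal p I" and \<eta>: "\<eta> \<in> Lt"
        unfolding ind_gens_def by blast
      have \<xi>c: "\<xi> \<in> cl_lp p (cop.span ?H)" using Egt_ideal_approx[OF I \<xi>] * by blast
      show "g \<in> cl_lp p (?J \<inter> UCX)" unfolding g
      proof (rule cl_lp_comp[OF p sHb alg_bops(4) \<xi>c \<eta>[unfolded Elt_eq]])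
        fix s \<eta>' assume s: "s \<in> cop.span ?H" and \<eta>': "\<eta>' \<in> Lt0"
        show "s \<circ> \<eta>' \<in> ?J \<inter> UCX"
        proof (rule span_comp_right[OF JUs _ s])
          fix h assume "h \<in> ?H"
          then obtain \<zeta> b where h: "h = \<zeta> \<circ> b" and \<zeta>: "\<zeta> \<in> Gt0" and b: "b \<in> I" "b \<in> CU" by blast
          have "h \<circ> \<eta>' \<in> ?J" unfolding h
            by (rule IndI[OF Egt_idealI[OF I _ b(1)]]) (use \<zeta> \<eta>' alg_subset in auto)
          moreover have "h \<circ> \<eta>' \<in> UCX" unfolding h by (rule alg_comp(2)[OF alg_comp(6)[OF \<zeta> b(2)] \<eta>'])
          ultimately show "h \<circ> \<eta>' \<in> ?J \<inter> UCX" by blast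
        qed
      qed
    qed
  qed
  moreover have "cl_lp p (?J \<inter> UCX) \<subseteq> ?J" by (rule cl_lp_minimal[OF Int_lower1 Ind_closed])
  ultimately show ?thesis by (simp add: geometric_def)
qed

section \<open>Restriction of ideals to the corner\<close>

definition res_ideal :: "('x \<times> nat, 'x \<times> nat) opr set \<Rightarrow> ('x, 'x) opr set" where
  "res_ideal J = {b \<in> BU. \<xi>\<^sub>0 \<circ> b \<circ> \<eta>\<^sub>0 \<in> J}"

lemma corner_UB: "b \<in> BU \<Longrightarrow> \<xi>\<^sub>0 \<circ> b \<circ> \<eta>\<^sub>0 \<in> UBX"
  by (rule cl_comp(2)[OF cl_comp(6)[OF unit_mem(1)] unit_mem(2)])

lemma res_closed_ideal:
  assumes J: "closed_ideal (lp p) UBX J"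
  shows "closed_ideal (lp p) BU (res_ideal J)"
  unfolding closed_ideal_def
proof (intro conjI ballI)
  have Bb: "b \<in> bops p" if "b \<in> BU" for b using that cl_bops by blast
  show "res_ideal J \<subseteq> BU" by (auto simp: res_ideal_def)
  show "cop.subspace (res_ideal J)"
  proof (rule cop.subspaceI)
    have "\<xi>\<^sub>0 \<circ> 0 \<circ> \<eta>\<^sub>0 = 0" using bops_zero[OF unit_bops(1)] by (simp add: fun_eq_iff)
    then show "0 \<in> res_ideal J"
      using cop.subspace_0[OF cl_sub(1)] cop.subspace_0[OF closed_idealD(2)[OF J]]
      by (simp add: res_ideal_def del: o_apply)
  next
    fix b c assume "b \<in> res_ideal J" "c \<in> res_ideal J"
    then have b: "b \<in> BU" "\<xi>\<^sub>0 \<circ> b \<circ> \<eta>\<^sub>0 \<in> J" and c: "c \<in> BU" "\<xi>\<^sub>0 \<circ> c \<circ> \<eta>\<^sub>0 \<in> J"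
      by (auto simp: res_ideal_def)
    have "\<xi>\<^sub>0 \<circ> (b + c) \<circ> \<eta>\<^sub>0 \<in> J"
      unfolding bops_comp_distrib_left[OF p unit_bops(1) Bb[OF b(1)] Bb[OF c(1)]] comp_distrib_right(1)
      by (rule cop.subspace_add[OF closed_idealD(2)[OF J] b(2) c(2)])
    then show "b + c \<in> res_ideal J"
      using cop.subspace_add[OF cl_sub(1) b(1) c(1)] by (simp add: res_ideal_def del: o_apply)
  next
    fix k b assume "b \<in> res_ideal J"
    then have b: "b \<in> BU" "\<xi>\<^sub>0 \<circ> b \<circ> \<eta>\<^sub>0 \<in> J" by (auto simp: res_ideal_def)
    have "\<xi>\<^sub>0 \<circ> oscale k b \<circ> \<eta>\<^sub>0 \<in> J"
      unfolding bops_comp_oscale_left[OF unit_bops(1) Bb[OF b(1)]] comp_oscale_right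
      by (rule cop.subspace_scale[OF closed_idealD(2)[OF J] b(2)])
    then show "oscale k b \<in> res_ideal J"
      using cop.subspace_scale[OF cl_sub(1) b(1)] by (simp add: res_ideal_def del: o_apply)
  qed
  \<comment> \<open>Passing to the corner is multiplicative because
    \<open>\<eta>\<^sub>0 \<circ> \<xi>\<^sub>0\<close> acts as a unit between b and c; products
    with elements of \<open>Bu p\<close> thus become products with elements of
    \<open>UB p\<close>.\<close>
  have split: "\<xi>\<^sub>0 \<circ> (b \<circ> c) \<circ> \<eta>\<^sub>0 = (\<xi>\<^sub>0 \<circ> b \<circ> \<eta>\<^sub>0) \<circ> (\<xi>\<^sub>0 \<circ> c \<circ> \<eta>\<^sub>0)" if "c \<in> BU" for b c
  proof -
    have "(\<xi>\<^sub>0 \<circ> b \<circ> \<eta>\<^sub>0) \<circ> (\<xi>\<^sub>0 \<circ> c \<circ> \<eta>\<^sub>0) = \<xi>\<^sub>0 \<circ> (b \<circ> (\<eta>\<^sub>0 \<circ> (\<xi>\<^sub>0 \<circ> c))) \<circ> \<eta>\<^sub>0"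
      by (simp only: comp_assoc)
    then show ?thesis by (simp only: unit_left[OF Bb[OF that]])
  qed
  fix a b assume a: "a \<in> BU" and "b \<in> res_ideal J"
  then have b: "b \<in> BU" "\<xi>\<^sub>0 \<circ> b \<circ> \<eta>\<^sub>0 \<in> J" by (auto simp: res_ideal_def)
  have "\<xi>\<^sub>0 \<circ> (a \<circ> b) \<circ> \<eta>\<^sub>0 \<in> J"
    unfolding split[OF b(1)] by (rule closed_idealD(3)[OF J corner_UB[OF a] b(2)])
  then show "a \<circ> b \<in> res_ideal J" using cl_comp(7)[OF a b(1)] unfolding res_ideal_def by blast
  have "\<xi>\<^sub>0 \<circ> (b \<circ> a) \<circ> \<eta>\<^sub>0 \<in> J"
    unfolding split[OF a] by (rule closed_idealD(4)[OF J corner_UB[OF a] b(2)])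
  then show "b \<circ> a \<in> res_ideal J" using cl_comp(7)[OF b(1) a] unfolding res_ideal_def by blast
next
  have rB: "res_ideal J \<subseteq> BU" by (auto simp: res_ideal_def)
  have rb: "res_ideal J \<subseteq> bops p" using rB cl_bops by blast
  have "cl_lp p (res_ideal J) \<subseteq> res_ideal J"
  proof
    fix b assume b: "b \<in> cl_lp p (res_ideal J)"
    then have bB: "b \<in> BU" using cl_lp_minimal[OF rB cl_closed(1)] by blast
    let ?C = "{\<xi>\<^sub>0 \<circ> c | c. c \<in> res_ideal J}"
    have C: "?C \<subseteq> bops p" using bops_comp[OF p unit_bops(1)] rb by blast
    have "\<xi>\<^sub>0 \<circ> b \<in> cl_lp p ?C"
      by (rule cl_comp_left[OF p unit_bops(1) rb b]) blast
    then have "\<xi>\<^sub>0 \<circ> b \<circ> \<eta>\<^sub>0 \<in> cl_lp p J"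
      by (rule cl_comp_right[OF p unit_bops(2) C]) (auto simp: res_ideal_def simp del: o_apply)
    then show "b \<in> res_ideal J" using bB closed_idealD(5)[OF J] unfolding res_ideal_def by blast
  qed
  then show "cl_lp p (res_ideal J) = res_ideal J" using cl_lp_superset[OF rb] by blast
qed

text \<open>Approximants T of a corner element may lie outside the corner. Compressing them to
  \<open>\<eta>\<^sub>0 \<circ> T \<circ> \<xi>\<^sub>0\<close> keeps finite propagation, and with e
  = \<open>\<xi>\<^sub>0 \<circ> \<eta>\<^sub>0\<close> the corner copy of the result is e T e,
  which is in J.\<close>

lemma geometric_res:
  assumes J: "closed_ideal (lp p) UBX J" and geo: "geometric (lp p) UCX J"
  shows "geometric (lp p) CU (res_ideal J)"
proof -
  have cg: "cl_lp p (J \<inter> UCX) = J" using geo by (simp add: geometric_def)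
  have JU: "J \<inter> UCX \<subseteq> bops p" using alg_bops by blast
  have e: "\<xi>\<^sub>0 \<circ> \<eta>\<^sub>0 \<in> UBX" by (rule cl_comp(2)[OF unit_mem])
  have "res_ideal J \<subseteq> cl_lp p (res_ideal J \<inter> CU)"
  proof
    fix b assume "b \<in> res_ideal J"
    then have b: "b \<in> BU" "\<xi>\<^sub>0 \<circ> b \<circ> \<eta>\<^sub>0 \<in> J" by (auto simp: res_ideal_def)
    let ?C = "{\<eta>\<^sub>0 \<circ> T | T. T \<in> J \<inter> UCX}"
    have C: "?C \<subseteq> bops p" using bops_comp[OF p unit_bops(2)] JU by blast
    have "\<xi>\<^sub>0 \<circ> b \<circ> \<eta>\<^sub>0 \<in> cl_lp p (J \<inter> UCX)" using b cg by simp
    then have "\<eta>\<^sub>0 \<circ> (\<xi>\<^sub>0 \<circ> b \<circ> \<eta>\<^sub>0) \<in> cl_lp p ?C"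
      by (rule cl_comp_left[OF p unit_bops(2) JU]) blast
    then have "\<eta>\<^sub>0 \<circ> (\<xi>\<^sub>0 \<circ> b \<circ> \<eta>\<^sub>0) \<circ> \<xi>\<^sub>0 \<in> cl_lp p (res_ideal J \<inter> CU)"
    proof (rule cl_comp_right[OF p unit_bops(1) C])
      fix s assume "s \<in> ?C"
      then obtain T where s: "s = \<eta>\<^sub>0 \<circ> T" and T: "T \<in> J" "T \<in> UCX" by blast
      have "\<eta>\<^sub>0 \<circ> (T \<circ> \<xi>\<^sub>0) \<in> CU" by (rule alg_comp(1)[OF unit_mem0(2) alg_comp(3)[OF T(2) unit_mem0(1)]])
      then have sC: "s \<circ> \<xi>\<^sub>0 \<in> CU" unfolding s comp_assoc .
      have "(\<xi>\<^sub>0 \<circ> \<eta>\<^sub>0) \<circ> T \<circ> (\<xi>\<^sub>0 \<circ> \<eta>\<^sub>0) \<in> J"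
        by (rule closed_idealD(4)[OF J e closed_idealD(3)[OF J e T(1)]])
      then have "\<xi>\<^sub>0 \<circ> (s \<circ> \<xi>\<^sub>0) \<circ> \<eta>\<^sub>0 \<in> J" unfolding s by (simp only: comp_assoc)
      then show "s \<circ> \<xi>\<^sub>0 \<in> res_ideal J \<inter> CU"
        using sC alg_subset(1) unfolding res_ideal_def by blast
    qed
    then show "b \<in> cl_lp p (res_ideal J \<inter> CU)"
      using corner[of b] b(1) cl_bops(1) by auto
  qed
  moreover have "cl_lp p (res_ideal J \<inter> CU) \<subseteq> res_ideal J"
    by (rule cl_lp_minimal[OF Int_lower1 closed_idealD(5)[OF res_closed_ideal[OF J]]])
  ultimately show ?thesis by (simp add: geometric_def)
qed

text \<open>After approximation a generator has the form
  \<open>\<zeta> \<circ> b \<circ> \<eta>\<close>. Inserting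
  \<open>\<eta>\<^sub>0 \<circ> \<xi>\<^sub>0\<close> on both sides of b exhibits the corner element
  of b, which is in J, between two elements of \<open>UB p\<close>.\<close>

lemma Ind_res_subset:
  assumes J: "closed_ideal (lp p) UBX J"
  shows "Ind p (res_ideal J) \<subseteq> J"
proof (rule Ind_subset[OF _ closed_idealD(2,5)[OF J]])
  let ?S = "{\<zeta> \<circ> b | \<zeta> b. \<zeta> \<in> Gt0 \<and> b \<in> res_ideal J}"
  note I = res_closed_ideal[OF J]
  show "ind_gens (res_ideal J) \<subseteq> J"
  proof
    fix g assume "g \<in> ind_gens (res_ideal J)"
    then obtain \<xi> \<eta> where g: "g = \<xi> \<circ> \<eta>" and \<xi>: "\<xi> \<in> Egt_ideal p (res_ideal J)" and \<eta>: "\<eta> \<in> Lt"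
      unfolding ind_gens_def by blast
    have \<eta>b: "\<eta> \<in> bops p" using \<eta> cl_bops by blast
    have "g \<in> cl_lp p J" unfolding g
    proof (rule cl_comp_right[OF p \<eta>b Gt_I_bops[OF I] Egt_ideal_approx[OF I \<xi>]])
      fix s assume "s \<in> cop.span ?S"
      then show "s \<circ> \<eta> \<in> J"
      proof (rule span_comp_right[OF closed_idealD(2)[OF J], rotated])
        fix h assume "h \<in> ?S"
        then obtain \<zeta> b where h: "h = \<zeta> \<circ> b" and \<zeta>: "\<zeta> \<in> Gt0" and "b \<in> res_ideal J" by blast
        then have b: "b \<in> BU" "\<xi>\<^sub>0 \<circ> b \<circ> \<eta>\<^sub>0 \<in> J" by (auto simp: res_ideal_def)
        have bb: "b \<in> bops p" using b cl_bops by blast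
        have "\<zeta> \<circ> \<eta>\<^sub>0 \<in> UBX" by (rule cl_comp(2)[OF subsetD[OF alg_subset(3) \<zeta>] unit_mem(2)])
        then have "(\<zeta> \<circ> \<eta>\<^sub>0) \<circ> (\<xi>\<^sub>0 \<circ> b \<circ> \<eta>\<^sub>0) \<circ> (\<xi>\<^sub>0 \<circ> \<eta>) \<in> J"
          by (rule closed_idealD(4)[OF J cl_comp(2)[OF unit_mem(1) \<eta>] closed_idealD(3)[OF J _ b(2)]])
        also have "(\<zeta> \<circ> \<eta>\<^sub>0) \<circ> (\<xi>\<^sub>0 \<circ> b \<circ> \<eta>\<^sub>0) \<circ> (\<xi>\<^sub>0 \<circ> \<eta>) = \<zeta> \<circ> (\<eta>\<^sub>0 \<circ> (\<xi>\<^sub>0 \<circ> b \<circ> \<eta>\<^sub>0) \<circ> \<xi>\<^sub>0) \<circ> \<eta>"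
          by (simp only: comp_assoc)
        also have "\<dots> = h \<circ> \<eta>" by (simp only: corner[OF bb] h)
        finally show "h \<circ> \<eta> \<in> J" .
      qed
    qed
    then show "g \<in> J" using closed_idealD(5)[OF J] by blast
  qed
qed

text \<open>Induction on the column rank. \<open>T \<circ> U\<close> is in the module of the
  restricted ideal because the corner element of its pairing with \<open>\<eta>\<close> is
  \<open>(\<xi>\<^sub>0 \<circ> \<eta>) \<circ> T \<circ> (U \<circ> \<eta>\<^sub>0)\<close>. The
  remainder is T minus a right multiple of T, so it is again in J; finite propagation is carried
  along for \<open>column_rank_0\<close> and for \<open>T \<circ> U\<close> to be algebraic.\<close>

lemma finite_rank_mem_Ind_res:
  assumes J: "closed_ideal (lp p) UBX J"
  shows "T \<in> J \<Longrightarrow> T \<in> (\<Union>R. fprop p fst fst R) \<Longrightarrow> column_rank_le p n T \<Longrightarrow> T \<in> Ind p (res_ideal J)"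
proof (induction n arbitrary: T)
  case 0
  then obtain R where "T \<in> fprop p fst fst R" by blast
  then have "T = 0" by (rule column_rank_0[OF bg p _ 0(3)])
  then show ?case using cop.subspace_0[OF Ind_subspace] by blast
next
  case (Suc n)
  note T = Suc.prems(1,2)
  have Tb: "T \<in> bops p" using T(2) fprop_bops by blast
  obtain U \<Phi> where U: "U \<in> Gt0" and \<Phi>: "\<Phi> \<in> Lt0" and rk: "column_rank_le p n (T - ((T \<circ> U) \<circ> \<Phi>))"
    using column_rank_drop[OF bg p Tb Suc.prems(3)] by blast
  have UG: "U \<in> Gt" and \<Phi>L: "\<Phi> \<in> Lt" using U \<Phi> alg_subset by auto
  have TU: "T \<circ> U \<in> Gt0"
    using Union_fprop_comp[OF _ T(2)] U unfolding Egt_alg_eq[OF bg p] by blast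
  have "\<eta> \<circ> (T \<circ> U) \<in> res_ideal J" if \<eta>: "\<eta> \<in> Lt" for \<eta>
  proof -
    have "\<eta> \<circ> (T \<circ> U) \<in> BU" using cl_comp(1)[OF \<eta>] TU alg_subset by blast
    moreover have "(\<xi>\<^sub>0 \<circ> \<eta>) \<circ> T \<circ> (U \<circ> \<eta>\<^sub>0) \<in> J"
      by (intro closed_idealD(3,4)[OF J] T(1) cl_comp(2) unit_mem UG \<eta>)
    then have "\<xi>\<^sub>0 \<circ> (\<eta> \<circ> (T \<circ> U)) \<circ> \<eta>\<^sub>0 \<in> J" by (simp only: comp_assoc)
    ultimately show ?thesis unfolding res_ideal_def by blast
  qed
  then have "T \<circ> U \<in> Egt_ideal p (res_ideal J)"
    using TU alg_subset(3) unfolding Egt_ideal_def by blast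
  then have 1: "(T \<circ> U) \<circ> \<Phi> \<in> Ind p (res_ideal J)" by (rule IndI[OF _ \<Phi>L])
  have "T \<circ> (U \<circ> \<Phi>) \<in> J" by (intro closed_idealD(4)[OF J] T(1) cl_comp(2) UG \<Phi>L)
  then have "T - ((T \<circ> U) \<circ> \<Phi>) \<in> J"
    using cop.subspace_diff[OF closed_idealD(2)[OF J] T(1)] by (simp only: comp_assoc)
  moreover have "(T \<circ> U) \<circ> \<Phi> \<in> (\<Union>R. fprop p fst fst R)"
    using alg_comp(2)[OF TU \<Phi>] UC_fprop by blast
  then have "T - ((T \<circ> U) \<circ> \<Phi>) \<in> (\<Union>R. fprop p fst fst R)"
    by (rule cop.subspace_diff[OF Union_fprop_subspace[OF p] T(2)])
  ultimately have 2: "T - ((T \<circ> U) \<circ> \<Phi>) \<in> Ind p (res_ideal J)" using Suc.IH rk by blast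
  have "T = (T - ((T \<circ> U) \<circ> \<Phi>)) + ((T \<circ> U) \<circ> \<Phi>)" by simp
  then show ?case using cop.subspace_add[OF Ind_subspace 2 1] by (simp only:)
qed

text \<open>The rank induction reaches the elements of J in \<open>UC p\<close>, whose columns have
  uniformly bounded rank; for a geometric J their closure is all of J.\<close>

lemma Ind_res:
  assumes J: "closed_ideal (lp p) UBX J" and geo: "geometric (lp p) UCX J"
  shows "Ind p (res_ideal J) = J"
proof
  have "J \<inter> UCX \<subseteq> Ind p (res_ideal J)"
  proof
    fix T assume T: "T \<in> J \<inter> UCX"
    then obtain n where "column_rank_le p n T" using UC_column_rank[OF bg p] by blast
    then show "T \<in> Ind p (res_ideal J)"
      using finite_rank_mem_Ind_res[OF J] T UC_fprop by blast
  qed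
  then have "cl_lp p (J \<inter> UCX) \<subseteq> Ind p (res_ideal J)" by (rule cl_lp_minimal[OF _ Ind_closed])
  then show "J \<subseteq> Ind p (res_ideal J)" using geo by (simp add: geometric_def)
qed (rule Ind_res_subset[OF J])

lemma res_Ind:
  assumes I: "closed_ideal (lp p) BU I"
  shows "res_ideal (Ind p I) = I"
  using mem_ideal_iff_Ind[OF I] closed_idealD(1)[OF I] unfolding res_ideal_def by blast

text \<open>For the converse the induced ideal is restricted again, and \<open>res_Ind\<close>
  identifies the result with I.\<close>

lemma geometric_iff_Ind:
  assumes I: "closed_ideal (lp p) BU I"
  shows "geometric (lp p) CU I \<longleftrightarrow> geometric (lp p) UCX (Ind p I)"
  using geometric_Ind[OF I] geometric_res[OF Ind_closed_ideal[OF I]] res_Ind[OF I] by auto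

lemma Ind_order_isomorphism:
  "bij_betw (Ind p) (geometric_ideals (lp p) BU CU) (geometric_ideals (lp p) UBX UCX)"
proof (rule bij_betwI[where g = res_ideal])
  show "Ind p \<in> geometric_ideals (lp p) BU CU \<rightarrow> geometric_ideals (lp p) UBX UCX"
    by (auto simp: geometric_ideals_def Ind_closed_ideal geometric_Ind)
  show "res_ideal \<in> geometric_ideals (lp p) UBX UCX \<rightarrow> geometric_ideals (lp p) BU CU"
    by (auto simp: geometric_ideals_def res_closed_ideal geometric_res)
qed (auto simp: geometric_ideals_def res_Ind Ind_res)

end

theorem theorem7p2:
  fixes p :: real
  assumes "bounded_geometry TYPE('x::metric_space)"
    and "1 \<le> p"
  shows "(bij_betw (Ind p)
           (geometric_ideals (lp p) (Bu p) (Cu p :: ('x, 'x) opr set))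
           (geometric_ideals (lp_sum p) (UB p) (UC p :: ('x \<times> nat, 'x \<times> nat) opr set)) \<and>
          (\<forall>I \<in> geometric_ideals (lp p) (Bu p) (Cu p :: ('x, 'x) opr set).
           \<forall>J \<in> geometric_ideals (lp p) (Bu p) (Cu p).
             I \<subseteq> J \<longleftrightarrow> Ind p I \<subseteq> Ind p J)) \<and>
         (\<forall>I :: ('x, 'x) opr set. closed_ideal (lp p) (Bu p) I \<longrightarrow>
           (geometric (lp p) (Cu p) I \<longleftrightarrow> geometric (lp_sum p) (UC p) (Ind p I)))"
proof -
  \<comment> \<open>The results above use the norm of \<open>lp p\<close> on X x N; ideals and
    geometricity over \<open>lp_sum p\<close> are translated to it.\<close>
  note g = geometric_lp_sum_iff[OF assms(2) alg_bops(2)[OF assms]]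
  have "geometric_ideals (lp_sum p) (UB p) (UC p :: ('x \<times> nat, 'x \<times> nat) opr set)
      = geometric_ideals (lp p) (UB p) (UC p)"
    unfolding geometric_ideals_def g closed_ideal_lp_sum_iff[OF assms(2) cl_bops(2)[OF assms]] ..
  then show ?thesis
    using Ind_order_isomorphism[OF assms] Ind_subset_iff[OF assms] geometric_iff_Ind[OF assms]
    by (auto simp: g geometric_ideals_def)
qed

end
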